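(* Consider a RAP-modulated fluid process $\{(R_t,\mathbf{A}_t)\}_{t\ge 0}$ with $n^0=0$. For $\boldsymbol{\alpha}\in\mathfrak{Z}^+$ and $x\ge0$, $$\mathbb{E}_{\boldsymbol{\alpha}}\left[\mathbf{O}_x\mathbb{1}\{\tau_-^x<\infty\}\right]=\boldsymbol{\alpha}\Psi e^{(C^-+D^{-+}\Psi)x},\qquad \mathbb{P}_{\boldsymbol{\alpha}}(\tau_-^x<\infty)=\boldsymbol{\alpha}\Psi e^{(C^-+D^{-+}\Psi)x}\mathbf{1}.$$
   Context: Setting (RAP-modulated fluid process with $n^0=0$). Elements of state spaces are row vectors; $\mathbf{1}$ is a column vector of ones of appropriate dimension. For $k\in\{+,-\}$ let $n^k\ge 1$, $m^k_1,\dots,m^k_{n^k}\ge1$ be integers, $\eta^k=\sum_i m^k_i$, and split $\mathbb{R}^{\eta^k}$ into $n^k$ consecutive blocks of sizes $m_1^k,\dots,m^k_{n^k}$. For $1\le i\le n^k$ let $\mathfrak{Z}^k_i$ be a subset of $\{\boldsymbol{x}\in\mathbb{R}^{\eta^k}:\boldsymbol{x}$ vanishes outside block $i$ and $\boldsymbol{x}\mathbf{1}=1\}$ which is bounded and minimal, i.e. not contained in any affine subspace of dimension $m^k_i-2$ (the only affine subspace of dimension $-1$ is $\varnothing$). Put $\mathfrak{Z}^k=\bigcup_i\mathfrak{Z}^k_i$; $\mathfrak{Z}^+$ and $\mathfrak{Z}^-$ are regarded as lying in different spaces, hence disjoint. Given are real matrices $C^k_{ij}\in\mathbb{R}^{m^k_i\times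 m^k_j}$ and $D^{k\ell}_{ij}\in\mathbb{R}^{m^k_i\times m^\ell_j}$ ($\ell\ne k$); let $C^k=(C^k_{ij})_{i,j}\in\mathbb{R}^{\eta^k\times\eta^k}$ and $D^{k\ell}=(D^{k\ell}_{ij})_{i,j}\in\mathbb{R}^{\eta^k\times\eta^\ell}$ be the full block matrices, $\Gamma^k=\mathrm{diag}(C^k_{11},\dots,C^k_{n^kn^k})$, and let $\widehat C^k_{ij}$ ($i\neq j$), $\widehat D^{k\ell}_{ij}$ be the matrices of the sizes of $C^k$, $D^{k\ell}$ whose $(i,j)$ block is $C^k_{ij}$, $D^{k\ell}_{ij}$ and which are zero elsewhere. Assume $C^k\mathbf{1}+D^{k\ell}\mathbf{1}=\mathbf{0}$ for $k\neq\ell$. The orbit process $\{\mathbf{A}_t\}_{t\ge0}$ is a càdlàg piecewise-deterministic Markov process on $\mathfrak{Z}^+\cup\mathfrak{Z}^-$: with no jumps after $t$ and $\mathbf{A}_t\in\mathfrak{Z}^k$, $\mathbf{A}_{t+r}=\mathbf{A}_te^{\Gamma^kr}/(\mathbf{A}_te^{\Gamma^kr}\mathbf{1})\in\mathfrak{Z}^k$; from a state $\boldsymbol{a}\in\mathfrak{Z}^k_i$ it jumps to $\boldsymbol{a}\widehat C^k_{ij}/(\boldsymbol{a}\widehat C^k_{ij}\mathbf{1})\in\mathfrak{Z}^k_j$ ($j\ne i$) with intensity $\boldsymbol{a}\widehat C^k_{ij}\mathbf{1}\ge0$, and to $\boldsymbol{a}\widehat D^{k\ell}_{ij}/(\boldsymbol{a}\widehat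 D^{k\ell}_{ij}\mathbf{1})\in\mathfrak{Z}^\ell_j$ ($\ell\neq k$) with intensity $\boldsymbol{a}\widehat D^{k\ell}_{ij}\mathbf{1}\ge0$. It is assumed that the data are such that all these intensities are nonnegative and all these points lie in the indicated sets. The level process is $R_t=\int_0^t(\mathbb{1}\{\mathbf{A}_s\in\mathfrak{Z}^+\}-\mathbb{1}\{\mathbf{A}_s\in\mathfrak{Z}^-\})\,\mathrm{d}s$. Nontriviality assumption: for $k\in\{+,-\}$ and all $\boldsymbol{\alpha}\in\mathfrak{Z}^k$, $\mathbb{P}(\mathbf{A}_s\in\mathfrak{Z}^k\ \forall s\in[0,t]\mid\mathbf{A}_0=\boldsymbol{\alpha})\to0$ as $t\to\infty$. $\mathbb{P}_{\boldsymbol{\alpha}},\mathbb{E}_{\boldsymbol{\alpha}}$ denote law and expectation given $\mathbf{A}_0=\boldsymbol{\alpha}$. $\Psi=\lim_{n\to\infty}\Psi_n$, where $\Psi_0=0$ and $\Psi_n=\int_0^\infty e^{C^+y}(D^{+-}+\Psi_{n-1}D^{-+}\Psi_{n-1})e^{C^-y}\,\mathrm{d}y$ for $n\ge1$; equivalently $\Psi$ is the unique matrix with $\mathbb{E}_{\boldsymbol{\alpha}}[\mathbf{A}_{\tau_-}\mathbb{1}\{\tau_-<\infty\}]=\boldsymbol{\alpha}\Psi$ for all $\boldsymbol{\alpha}\in\mathfrak{Z}^+$, where $\tau_-=\inf\{t>0:R_t\le0\}$. For $x\ge0$, $\tau_-^x=\inf\{t\ge0:R_t=-x,\ \mathbf{A}_t\in\mathfrak{Z}^-\}$,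 and $\mathbf{O}_x=\mathbf{A}_{\tau_-^x}$ if $\tau_-^x<\infty$, $\mathbf{O}_x=\Delta$ (an isolated cemetery state) otherwise; $\mathbf{O}_x\mathbb{1}\{\tau_-^x<\infty\}$ is read as $\mathbf{0}$ when $\tau_-^x=\infty$.
   Formalization: Where a jump intensity vanishes, so that the normalized destination is undefined, the formal statement requires the unnormalized row vector (a times the block matrix) to be zero; without this the formula can fail. *)

theory Defs
  imports "HOL-Probability.Probability"
begin

text \<open>
  Elements of the state spaces are row vectors: they act on matrices by \<open>v*\<close>, and \<open>x \<bullet> 1\<close> is the
  product of \<open>x\<close> with the column vector of ones.
\<close>

text \<open>The ring operations (hence \<open>^\<close>) on \<open>real^'n^'n\<close> are componentwise, so the powers of a matrix
  are written as iterated matrix products.\<close>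

definition mat_exp :: "real^'n^'n \<Rightarrow> real^'n^'n" where
  "mat_exp M = (\<Sum>k. (1 / fact k) *\<^sub>R (((**) M ^^ k) (mat 1)))"

definition normalize_row :: "real^'n \<Rightarrow> real^'n" where
  "normalize_row x = (1 / (x \<bullet> 1)) *\<^sub>R x"

text \<open>The matrix that agrees with \<open>M\<close> on its \<open>(i,j)\<close> block and is zero elsewhere, where \<open>b p\<close>,
  \<open>c q\<close> are the blocks of row \<open>p\<close> and column \<open>q\<close>.\<close>

definition block_part ::
    "('a::finite \<Rightarrow> nat) \<Rightarrow> ('b::finite \<Rightarrow> nat) \<Rightarrow> real^'b^'a \<Rightarrow> nat \<Rightarrow> nat \<Rightarrow> real^'b^'a" where
  "block_part b c M i j = (\<chi> p q. if b p = i \<and> c q = j then M $ p $ q else 0)"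


subsection \<open>Data\<close>

text \<open>
  The data of one sign \<open>k\<close>. The coordinates of \<open>\<real>\<^bsup>\<eta>\<^esup>\<close> are indexed by the type \<open>'n\<close>;
  the coordinate \<open>p\<close> belongs to block \<open>block s p \<in> {1..nblocks s}\<close>, so the block size \<open>m\<^sub>i\<close> is
  \<open>card {p. block s p = i}\<close>.
\<close>

record 'n side =
  nblocks :: nat
  block :: "'n \<Rightarrow> nat"
  orbit_set :: "nat \<Rightarrow> (real^'n) set"
  Cmat :: "real^'n^'n"

definition orbits :: "('n::finite) side \<Rightarrow> (real^'n) set" where
  "orbits s = (\<Union>i\<in>{1..nblocks s}. orbit_set s i)"

definition Gamma_mat :: "('n::finite) side \<Rightarrow> real^'n^'n" where
  "Gamma_mat s = (\<chi> p q. if block s p = block s q then Cmat s $ p $ q else 0)"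

definition side_flow :: "('n::finite) side \<Rightarrow> real \<Rightarrow> real^'n \<Rightarrow> real^'n" where
  "side_flow s r a = normalize_row (a v* mat_exp (r *\<^sub>R Gamma_mat s))"

text \<open>Monotonicity of \<open>block\<close> says that the blocks are consecutive, surjectivity that they are all
  nonempty. The last condition includes that the normalization in the flow is well defined, since
  \<^term>\<open>normalize_row x\<close> is \<open>0\<close> if \<open>x \<bullet> 1 = 0\<close>.\<close>

definition valid_side :: "('n::{finite,linorder}) side \<Rightarrow> bool" where
  "valid_side s \<longleftrightarrow>
     1 \<le> nblocks s \<and> mono (block s) \<and> range (block s) = {1..nblocks s} \<and>
     (\<forall>i\<in>{1..nblocks s}.
        (\<forall>a\<in>orbit_set s i. (\<forall>p. block s p \<noteq> i \<longrightarrow> a $ p = 0) \<and> a \<bullet> 1 = 1) \<and>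
        bounded (orbit_set s i) \<and>
        (\<forall>S. affine S \<and> aff_dim S = int (card {p. block s p = i}) - 2 \<longrightarrow> \<not> orbit_set s i \<subseteq> S)) \<and>
     (\<forall>a\<in>orbits s. \<forall>r\<ge>0. side_flow s r a \<in> orbits s)"

record ('p, 'm) rap =
  plus :: "'p side"
  minus :: "'m side"
  Dpm :: "real^'m^'p"
  Dmp :: "real^'p^'m"

text \<open>
  A jump of \<open>a\<close> through the block matrix \<open>M\<close> has intensity \<open>a M 1\<close> and destination \<open>a M / (a M 1)\<close>.
  If the intensity vanishes, the requirement that the destination be a point of \<open>Z\<close> is read as
  \<open>a M = (a M 1) z\<close> with \<open>z \<in> Z\<close>, that is, \<open>a M = 0\<close>.
\<close>

definition admissible_jump :: "real^'a \<Rightarrow> real^'b^'a \<Rightarrow> (real^'b) set \<Rightarrow> bool" where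
  "admissible_jump a M Z \<longleftrightarrow>
     0 \<le> (a v* M) \<bullet> 1 \<and>
     (if (a v* M) \<bullet> 1 = 0 then a v* M = 0 else normalize_row (a v* M) \<in> Z)"

definition admissible_jumps ::
    "('a::finite) side \<Rightarrow> ('b::finite) side \<Rightarrow> real^'b^'a \<Rightarrow> bool" where
  "admissible_jumps s s' D \<longleftrightarrow>
     (\<forall>i\<in>{1..nblocks s}. \<forall>a\<in>orbit_set s i.
        (\<forall>j\<in>{1..nblocks s} - {i}.
           admissible_jump a (block_part (block s) (block s) (Cmat s) i j) (orbit_set s j)) \<and>
        (\<forall>j\<in>{1..nblocks s'}.
           admissible_jump a (block_part (block s) (block s') D i j) (orbit_set s' j)))"

definition valid_rap :: "('p::{finite,linorder}, 'm::{finite,linorder}) rap \<Rightarrow> bool" where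
  "valid_rap X \<longleftrightarrow>
     valid_side (plus X) \<and> valid_side (minus X) \<and>
     Cmat (plus X) *v 1 + Dpm X *v 1 = 0 \<and>
     Cmat (minus X) *v 1 + Dmp X *v 1 = 0 \<and>
     admissible_jumps (plus X) (minus X) (Dpm X) \<and>
     admissible_jumps (minus X) (plus X) (Dmp X)"


subsection \<open>The orbit process\<close>

text \<open>
  The disjoint union of the two families of orbits is realized in \<open>\<real>\<^bsup>\<eta>+\<^esup> \<times> \<real>\<^bsup>\<eta>-\<^esup>\<close>, as pairs
  \<open>(a, 0)\<close> and \<open>(0, b)\<close>. The pieces are separated by \<open>a \<bullet> 1 = 1\<close>, respectively \<open>b \<bullet> 1 = 1\<close>.
\<close>

type_synonym ('p, 'm) state = "(real^'p) \<times> (real^'m)"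

definition plus_states :: "('p::finite, 'm::finite) rap \<Rightarrow> ('p, 'm) state set" where
  "plus_states X = orbits (plus X) \<times> {0}"

definition minus_states :: "('p::finite, 'm::finite) rap \<Rightarrow> ('p, 'm) state set" where
  "minus_states X = {0} \<times> orbits (minus X)"

text \<open>The zero component of a state remains zero, as \<^term>\<open>normalize_row 0 = 0\<close>.\<close>

definition flow ::
    "('p::finite, 'm::finite) rap \<Rightarrow> real \<Rightarrow> ('p, 'm) state \<Rightarrow> ('p, 'm) state" where
  "flow X r z = (side_flow (plus X) r (fst z), side_flow (minus X) r (snd z))"

definition jump_rate :: "real^'a \<Rightarrow> real^'b^'a \<Rightarrow> (real^'b) set \<Rightarrow> real" where
  "jump_rate a M B = ((a v* M) \<bullet> 1) * indicator B (normalize_row (a v* M))"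

text \<open>
  Total intensity, in state \<open>z\<close>, of the jumps whose destination lies in \<open>B\<close>. A state is supported on
  a single block, so in the sums over all blocks \<open>i\<close> of both signs only the block of \<open>z\<close> contributes.
\<close>

definition jump_intensity ::
    "('p::finite, 'm::finite) rap \<Rightarrow> ('p, 'm) state \<Rightarrow> ('p, 'm) state set \<Rightarrow> real" where
  "jump_intensity X z B =
     (let P = plus X; M = minus X; a = fst z; b = snd z;
          B\<^sub>P = {v. (v, 0) \<in> B}; B\<^sub>M = {w. (0, w) \<in> B}
      in (\<Sum>i\<in>{1..nblocks P}.
            (\<Sum>j\<in>{1..nblocks P} - {i}. jump_rate a (block_part (block P) (block P) (Cmat P) i j) B\<^sub>P) +
            (\<Sum>j\<in>{1..nblocks M}. jump_rate a (block_part (block P) (block M) (Dpm X) i j) B\<^sub>M)) +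
         (\<Sum>i\<in>{1..nblocks M}.
            (\<Sum>j\<in>{1..nblocks M} - {i}. jump_rate b (block_part (block M) (block M) (Cmat M) i j) B\<^sub>M) +
            (\<Sum>j\<in>{1..nblocks P}. jump_rate b (block_part (block M) (block P) (Dmp X) i j) B\<^sub>P)))"

text \<open>Probability that, starting from \<open>z\<close>, the first jump occurs by time \<open>s\<close> and leads into \<open>B\<close>.\<close>

definition jump_kernel ::
    "('p::finite, 'm::finite) rap \<Rightarrow> ('p, 'm) state \<Rightarrow> real \<Rightarrow> ('p, 'm) state set \<Rightarrow> real" where
  "jump_kernel X z s B =
     (LBINT u:{0..s}. exp (- (LBINT r:{0..u}. jump_intensity X (flow X r z) UNIV)) *
                      jump_intensity X (flow X u z) B)"

text \<open>The sigma-algebra generated by the first \<open>n\<close> jump times and the states entered there.\<close>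

definition jump_history ::
    "'w measure \<Rightarrow> (nat \<Rightarrow> 'w \<Rightarrow> ereal) \<Rightarrow> (nat \<Rightarrow> 'w \<Rightarrow> 's::topological_space) \<Rightarrow> nat \<Rightarrow> 'w measure"
  where
  "jump_history M T Y n =
     sigma (space M) (\<Union>i\<in>{..n}. {T i -` E \<inter> space M |E. E \<in> sets borel} \<union>
                                 {Y i -` E \<inter> space M |E. E \<in> sets borel})"

text \<open>
  Under \<open>M\<close>, the process \<open>A\<close> is the piecewise-deterministic Markov process started in \<open>z\<close> with the
  above flow and jump intensities, in Davis's sense: \<open>T 0 = 0 < T 1 < \<dots>\<close> are the
  jump times (\<open>\<infinity>\<close> once there are no further jumps), \<open>A\<close> follows the flow in
  between, and the conditional law of the next jump time and the state entered, given the past jumps,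
  is \<^const>\<open>jump_kernel\<close>. As the jump times do not accumulate and the flow is continuous, the paths
  are right-continuous with left limits.
\<close>

definition pdmp_from ::
    "('p::finite, 'm::finite) rap \<Rightarrow> 'w measure \<Rightarrow> (real \<Rightarrow> 'w \<Rightarrow> ('p, 'm) state) \<Rightarrow> ('p, 'm) state \<Rightarrow> bool"
  where
  "pdmp_from X M A z \<longleftrightarrow>
     prob_space M \<and>
     (\<forall>t\<ge>0. A t \<in> borel_measurable M) \<and>
     (\<forall>\<omega>\<in>space M. \<forall>t\<ge>0. A t \<omega> \<in> plus_states X \<union> minus_states X) \<and>
     (AE \<omega> in M. A 0 \<omega> = z) \<and>
     (\<exists>T Y.
        (\<forall>n. T n \<in> borel_measurable M \<and> Y n \<in> borel_measurable M) \<and>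
        (\<forall>n. \<forall>\<omega>\<in>space M. Y n \<omega> = A (real_of_ereal (T n \<omega>)) \<omega>) \<and>
        (\<forall>\<omega>\<in>space M.
           T 0 \<omega> = 0 \<and>
           (\<forall>n. if T n \<omega> < \<infinity> then T n \<omega> < T (Suc n) \<omega> else T (Suc n) \<omega> = \<infinity>) \<and>
           (\<lambda>n. T n \<omega>) \<longlonglongrightarrow> \<infinity> \<and>
           (\<forall>n t. T n \<omega> \<le> ereal t \<and> ereal t < T (Suc n) \<omega> \<longrightarrow>
              A t \<omega> = flow X (t - real_of_ereal (T n \<omega>)) (Y n \<omega>))) \<and>
        (\<forall>n. \<forall>s\<ge>0. \<forall>B\<in>sets borel. AE \<omega> in M. T n \<omega> < \<infinity> \<longrightarrow>
           real_cond_exp M (jump_history M T Y n)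
             (indicator {\<omega>\<in>space M. T (Suc n) \<omega> \<le> T n \<omega> + ereal s \<and> Y (Suc n) \<omega> \<in> B}) \<omega> =
           jump_kernel X (Y n \<omega>) s B))"

text \<open>\<open>P z\<close> is the law given \<open>A\<^sub>0 = z\<close>; the last two conditions are the nontriviality assumption.\<close>

definition rap_fluid_process ::
    "('p::{finite,linorder}, 'm::{finite,linorder}) rap \<Rightarrow> (('p, 'm) state \<Rightarrow> 'w measure) \<Rightarrow>
     (real \<Rightarrow> 'w \<Rightarrow> ('p, 'm) state) \<Rightarrow> bool"
  where
  "rap_fluid_process X P A \<longleftrightarrow>
     valid_rap X \<and>
     (\<forall>z\<in>plus_states X \<union> minus_states X. pdmp_from X (P z) A z) \<and>
     (\<forall>z\<in>plus_states X.
        ((\<lambda>t. measure (P z) {\<omega>\<in>space (P z). \<forall>s\<in>{0..t}. A s \<omega> \<in> plus_states X}) \<longlongrightarrow> 0) at_top) \<and>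
     (\<forall>z\<in>minus_states X.
        ((\<lambda>t. measure (P z) {\<omega>\<in>space (P z). \<forall>s\<in>{0..t}. A s \<omega> \<in> minus_states X}) \<longlongrightarrow> 0) at_top)"


subsection \<open>The level process, first return matrix and downward records\<close>

text \<open>In the following, \<open>a\<close> is a path of the orbit process.\<close>

definition level :: "('p::finite, 'm::finite) rap \<Rightarrow> (real \<Rightarrow> ('p, 'm) state) \<Rightarrow> real \<Rightarrow> real" where
  "level X a t = (LBINT s:{0..t}. indicator (plus_states X) (a s) - indicator (minus_states X) (a s))"

definition tau_minus ::
    "('p::finite, 'm::finite) rap \<Rightarrow> (real \<Rightarrow> ('p, 'm) state) \<Rightarrow> real \<Rightarrow> ereal" where
  "tau_minus X a x = Inf (ereal ` {t. 0 \<le> t \<and> level X a t = - x \<and> a t \<in> minus_states X})"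

text \<open>\<^const>\<open>None\<close> is the cemetery state.\<close>

definition down_record ::
    "('p::finite, 'm::finite) rap \<Rightarrow> (real \<Rightarrow> ('p, 'm) state) \<Rightarrow> real \<Rightarrow> (real^'m) option" where
  "down_record X a x =
     (if tau_minus X a x < \<infinity> then Some (snd (a (real_of_ereal (tau_minus X a x)))) else None)"

primrec Psi_iter :: "('p::finite, 'm::finite) rap \<Rightarrow> nat \<Rightarrow> real^'m^'p" where
  "Psi_iter X 0 = 0"
| "Psi_iter X (Suc n) =
     (LBINT y:{0..}. mat_exp (y *\<^sub>R Cmat (plus X)) **
        (Dpm X + Psi_iter X n ** Dmp X ** Psi_iter X n) ** mat_exp (y *\<^sub>R Cmat (minus X)))"

definition Psi :: "('p::finite, 'm::finite) rap \<Rightarrow> real^'m^'p" where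
  "Psi X = lim (Psi_iter X)"

end

theory Submission
  imports Defs
begin

text \<open>
  Column vectors are ordered by their values on orbits: \<open>w \<ge> 0\<close> means \<open>a \<bullet> w \<ge> 0\<close> for all orbits \<open>a\<close>. The cones of
  nonnegative vectors are pointed because, by minimality, the orbits span the space, and the vector \<open>1\<close> is an
  order unit because the orbits are bounded. A matrix counts as positive if it maps one such cone into the
  other. The admissibility of flow and jumps says exactly that \<open>mat_exp (t *\<^sub>R Gamma)\<close>, the off-diagonal parts
  \<open>C - Gamma\<close> and the matrices \<open>D\<close> are positive in this sense, so the theory of Markov-modulated fluid queues,
  where positivity is entrywise, can be followed with the cones in place of the orthants.

  Between jumps the unnormalized orbit moves linearly, its mass is the probability of no jump so far, and
  rate times destination of a jump is again linear in the orbit. Hence the expectation of \<open>record \<bullet> w\<close> on the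
  event that the record at distance \<open>u\<close> is reached before the \<open>k\<close>-th jump is linear in the initial state,
  given by matrices \<open>F k u\<close> (upward start) and \<open>G k u\<close> (downward start). Conditioning on the first jump gives
  a recursion, which in differential form reads
  \<open>F (k+1)' = - Gamma F (k+1) - (C - Gamma) F k - D G k\<close> with \<open>F (k+1)\<close> bounded and, for the downward start,
  \<open>G (k+1)' = Gamma G (k+1) + (C - Gamma) G k + D F k\<close> with \<open>G (k+1) 0 = mat 1\<close>. The limits \<open>F\<close>, \<open>G\<close> exist by
  monotonicity and solve the linear system \<open>f' = - C f - D g\<close>, \<open>g' = C g + D f\<close>. They are its minimal
  nonnegative solution (lemmas \<open>regular\<close> and \<open>limit_le\<close>). Minimality takes the place of the strong Markov
  property at level crossings.

  Put \<open>Phi = F 0\<close>. Shifting the solution by \<open>v\<close> gives another solution, so minimality yields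
  \<open>F v \<ge> Phi G v\<close>. Both sides agree at \<open>v = 0\<close>, and comparing derivatives there shows that \<open>Phi\<close> is a
  supersolution of the Riccati equation \<open>C psi + psi C + D + psi D psi = 0\<close>. Therefore the iterates
  \<open>Psi_iter\<close> increase to some \<open>psi \<le> Phi\<close> which solves this equation. With \<open>U = C + D psi\<close> the functions
  \<open>psi mat_exp (u *\<^sub>R U)\<close>, \<open>mat_exp (u *\<^sub>R U)\<close> solve the linear system, so minimality gives \<open>Phi \<le> psi\<close>. Thus
  \<open>psi = Phi\<close>, and the two solutions coincide (lemma \<open>limit_eq\<close>).

  All improper integrals and limits at infinity rest on \<open>mat_exp (t *\<^sub>R C)\<close> tending to zero for the plus side.
  This is where nontriviality enters: \<open>\<alpha> \<bullet> (mat_exp (t *\<^sub>R C) *v 1)\<close> is bounded by the probability of staying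
  in the plus states up to time \<open>t\<close> (lemma \<open>staying_probability\<close>).

  On the probabilistic side everything is reduced to the embedded chain of jump times and post-jump states:
  lemmas \<open>next_jump\<close> and \<open>no_jump_before\<close> evaluate expectations that involve the next jump, and
  \<open>hit_step\<close> turns them into the recursion above.
\<close>


section \<open>The matrix exponential\<close>

lemma matrix_matrix_mult_bounded_bilinear:
  "bounded_bilinear ((**) :: real^'n^'m \<Rightarrow> real^'k^'n \<Rightarrow> real^'k^'m)"
  unfolding bilinear_conv_bounded_bilinear[symmetric] bilinear_def
  by (auto intro!: linearI simp: vec_eq_iff matrix_matrix_mult_def sum.distrib sum_distrib_left
      algebra_simps)

lemma matrix_vector_mult_bounded_bilinear:
  "bounded_bilinear ((*v) :: real^'n^'m \<Rightarrow> real^'n \<Rightarrow> real^'m)"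
  unfolding bilinear_conv_bounded_bilinear[symmetric] bilinear_def
  by (auto intro!: linearI simp: vec_eq_iff matrix_vector_mult_def sum.distrib sum_distrib_left
      algebra_simps)

lemma vector_matrix_mult_bounded_bilinear:
  "bounded_bilinear ((v*) :: real^'m \<Rightarrow> real^'n^'m \<Rightarrow> real^'n)"
  unfolding bilinear_conv_bounded_bilinear[symmetric] bilinear_def
  by (auto intro!: linearI simp: vec_eq_iff vector_matrix_mult_def sum.distrib sum_distrib_left
      algebra_simps)

text \<open>
  Continuity, limits and the product rule for the three matrix products come from their being bounded
  bilinear maps; \<open>mm\<close>, \<open>mv\<close>, \<open>vm\<close> stand for matrix-matrix, matrix-vector and vector-matrix.
\<close>

interpretation mm: bounded_bilinear "(**) :: real^'n^'m \<Rightarrow> real^'k^'n \<Rightarrow> real^'k^'m"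
  by (rule matrix_matrix_mult_bounded_bilinear)
interpretation mv: bounded_bilinear "(*v) :: real^'n^'m \<Rightarrow> real^'n \<Rightarrow> real^'m"
  by (rule matrix_vector_mult_bounded_bilinear)
interpretation vm: bounded_bilinear "(v*) :: real^'m \<Rightarrow> real^'n^'m \<Rightarrow> real^'n"
  by (rule vector_matrix_mult_bounded_bilinear)

lemma matrix_mult_norm_const:
  obtains K where "1 \<le> K" and "\<And>(A::real^'n^'m) (B::real^'k^'n). norm (A ** B) \<le> norm A * norm B * K"
proof -
  obtain K where "0 < K" "\<And>(A::real^'n^'m) (B::real^'k^'n). norm (A ** B) \<le> norm A * norm B * K"
    using mm.pos_bounded by blast
  then show thesis
    by (intro that[of "max 1 K"]) (auto intro: order_trans[OF _ mult_left_mono[of K]])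
qed

definition mpow :: "real^'n^'n \<Rightarrow> nat \<Rightarrow> real^'n^'n" where
  "mpow M k = (((**) M) ^^ k) (mat 1)"

lemma mpow_0 [simp]: "mpow M 0 = mat 1" and mpow_Suc: "mpow M (Suc k) = M ** mpow M k"
  by (simp_all add: mpow_def)

lemma mpow_Suc2: "mpow M (Suc k) = mpow M k ** M"
proof (induction k)
  case (Suc k) then show ?case by (metis matrix_mul_assoc mpow_Suc)
qed (simp add: mpow_Suc)

lemma mpow_scaleR: "mpow (t *\<^sub>R M) k = t ^ k *\<^sub>R mpow M k"
  by (induction k) (simp_all add: mpow_Suc mm.scaleR_left mm.scaleR_right)

lemma summable_mpow:
  fixes M :: "real^'n^'n"
  shows "summable (\<lambda>k. (t ^ k / fact k) *\<^sub>R mpow M k)"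
proof -
  obtain K where K: "1 \<le> K" "\<And>(A::real^'n^'n) (B::real^'n^'n). norm (A ** B) \<le> norm A * norm B * K"
    using matrix_mult_norm_const by blast
  have b: "norm (mpow M k) \<le> norm (mat 1 :: real^'n^'n) * (norm M * K) ^ k" for k
  proof (induction k)
    case (Suc k)
    have "norm (mpow M (Suc k)) \<le> norm M * norm (mpow M k) * K"
      unfolding mpow_Suc by (rule K(2))
    also have "\<dots> \<le> norm M * (norm (mat 1 :: real^'n^'n) * (norm M * K) ^ k) * K"
      using Suc K(1) by (intro mult_right_mono mult_left_mono) auto
    finally show ?case by (simp add: mult_ac)
  qed simp
  have s: "summable (\<lambda>k. norm (mat 1 :: real^'n^'n) * (inverse (fact k) * (\<bar>t\<bar> * (norm M * K)) ^ k))"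
    by (intro summable_mult summable_exp)
  have "\<exists>N. \<forall>k\<ge>N. norm ((t ^ k / fact k) *\<^sub>R mpow M k) \<le>
      norm (mat 1 :: real^'n^'n) * (inverse (fact k) * (\<bar>t\<bar> * (norm M * K)) ^ k)"
  proof (intro exI allI impI)
    fix k :: nat
    have "norm ((t ^ k / fact k) *\<^sub>R mpow M k) = \<bar>t\<bar> ^ k / fact k * norm (mpow M k)"
      by (simp add: power_abs)
    also have "\<dots> \<le> \<bar>t\<bar> ^ k / fact k * (norm (mat 1 :: real^'n^'n) * (norm M * K) ^ k)"
      by (intro mult_left_mono b) auto
    finally show "norm ((t ^ k / fact k) *\<^sub>R mpow M k) \<le>
      norm (mat 1 :: real^'n^'n) * (inverse (fact k) * (\<bar>t\<bar> * (norm M * K)) ^ k)"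
      by (simp add: field_simps power_mult_distrib)
  qed
  then show ?thesis
    by (rule summable_comparison_test[OF _ s])
qed

lemma mat_exp_series: "mat_exp (t *\<^sub>R M) = (\<Sum>k. (t ^ k / fact k) *\<^sub>R mpow M k)"
  unfolding mat_exp_def mpow_def[symmetric] mpow_scaleR by simp

lemma mat_exp_0 [simp]: "mat_exp (0::real^'n^'n) = mat 1"
proof -
  have "(\<lambda>k. (0 ^ k / fact k) *\<^sub>R mpow (0::real^'n^'n) k) sums mat 1"
    using sums_finite[of "{0}" "\<lambda>k. (0 ^ k / fact k) *\<^sub>R mpow (0::real^'n^'n) k"] by simp
  then show ?thesis
    using mat_exp_series[of 0 "0::real^'n^'n"] by (simp add: sums_iff del: power_0_left)
qed

lemma mat_exp_commute: "M ** mat_exp (t *\<^sub>R M) = mat_exp (t *\<^sub>R M) ** M"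
proof -
  have "M ** mat_exp (t *\<^sub>R M) = (\<Sum>k. M ** ((t ^ k / fact k) *\<^sub>R mpow M k))"
    unfolding mat_exp_series by (rule bounded_linear.suminf[OF mm.bounded_linear_right summable_mpow])
  also have "\<dots> = (\<Sum>k. ((t ^ k / fact k) *\<^sub>R mpow M k) ** M)"
    by (simp only: mm.scaleR_left mm.scaleR_right flip: mpow_Suc mpow_Suc2)
  also have "\<dots> = mat_exp (t *\<^sub>R M) ** M"
    unfolding mat_exp_series by (rule bounded_linear.suminf[OF mm.bounded_linear_left summable_mpow, symmetric])
  finally show ?thesis .
qed

lemma has_vector_derivative_entrywise:
  fixes f :: "real \<Rightarrow> real^'n^'m"
  assumes "\<And>i j. ((\<lambda>t. f t $ i $ j) has_real_derivative f' $ i $ j) (at t within S)"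
  shows "(f has_vector_derivative f') (at t within S)"
  unfolding has_vector_derivative_def has_derivative_componentwise_within[of f]
proof
  fix b :: "real^'n^'m" assume "b \<in> Basis"
  then obtain i j where b: "b = axis i (axis j 1)"
    by (auto simp: Basis_vec_def)
  show "((\<lambda>x. f x \<bullet> b) has_derivative (\<lambda>x. x *\<^sub>R f' \<bullet> b)) (at t within S)"
    using assms[of i j] by (simp add: b inner_axis has_field_derivative_def mult_commute_abs)
qed

text \<open>
  Every entry is an everywhere convergent scalar power series, which may be differentiated term by term.
\<close>

lemma mat_exp_deriv:
  fixes M :: "real^'n^'n"
  shows "((\<lambda>t. mat_exp (t *\<^sub>R M)) has_vector_derivative M ** mat_exp (t *\<^sub>R M)) (at t within S)"
proof (rule has_vector_derivative_at_within, rule has_vector_derivative_entrywise)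
  fix i j :: 'n
  let ?c = "\<lambda>k. mpow M k $ i $ j / fact k"
  have bl: "bounded_linear (\<lambda>A::real^'n^'n. A $ i $ j)"
    by (intro bounded_linear_compose[OF bounded_linear_vec_nth] bounded_linear_vec_nth)
  have ent: "summable (\<lambda>k. ?c k * t ^ k)" "mat_exp (t *\<^sub>R M) $ i $ j = (\<Sum>k. ?c k * t ^ k)" for t
    using bounded_linear.suminf[OF bl summable_mpow[of t M]]
      bounded_linear.summable[OF bl summable_mpow[of t M]]
    by (simp_all add: mat_exp_series mult.commute)
  have "((\<lambda>t. \<Sum>k. ?c k * t ^ k) has_real_derivative (\<Sum>k. diffs ?c k * t ^ k)) (at t)"
    by (intro termdiffs_strong_converges_everywhere ent)
  also have "(\<Sum>k. diffs ?c k * t ^ k) = (M ** mat_exp (t *\<^sub>R M)) $ i $ j"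
  proof -
    have "M ** mat_exp (t *\<^sub>R M) = (\<Sum>k. M ** ((t ^ k / fact k) *\<^sub>R mpow M k))"
      unfolding mat_exp_series by (rule bounded_linear.suminf[OF mm.bounded_linear_right summable_mpow])
    then have "(M ** mat_exp (t *\<^sub>R M)) $ i $ j = (\<Sum>k. M ** ((t ^ k / fact k) *\<^sub>R mpow M k)) $ i $ j"
      by simp
    also have "(\<Sum>k. M ** ((t ^ k / fact k) *\<^sub>R mpow M k)) $ i $ j = (\<Sum>k. (M ** ((t ^ k / fact k) *\<^sub>R mpow M k)) $ i $ j)"
      by (intro bounded_linear.suminf[OF bl]
          bounded_linear.summable[OF mm.bounded_linear_right summable_mpow])
    also have "\<dots> = (\<Sum>k. diffs ?c k * t ^ k)"
      by (intro suminf_cong) (simp add: diffs_def mm.scaleR_right mpow_Suc divide_simps del: of_nat_Suc)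
    finally show ?thesis by simp
  qed
  finally show "((\<lambda>t. mat_exp (t *\<^sub>R M) $ i $ j) has_real_derivative (M ** mat_exp (t *\<^sub>R M)) $ i $ j) (at t)"
    by (simp add: ent)
qed

lemma mat_exp_deriv_affine:
  "((\<lambda>s. mat_exp ((t - s) *\<^sub>R M)) has_vector_derivative - (mat_exp ((t - s) *\<^sub>R M) ** M)) (at s within S)"
proof -
  have "((\<lambda>s. mat_exp (s *\<^sub>R M)) \<circ> (\<lambda>s. t - s) has_vector_derivative
      - 1 *\<^sub>R (M ** mat_exp ((t - s) *\<^sub>R M))) (at s within S)"
    by (rule vector_diff_chain_within[OF _ mat_exp_deriv]) (auto intro!: derivative_eq_intros)
  then show ?thesis by (simp add: o_def mat_exp_commute)
qed

lemma mat_exp_deriv_left: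
  "((\<lambda>s. mat_exp (s *\<^sub>R M)) has_vector_derivative mat_exp (s *\<^sub>R M) ** M) (at s within S)"
  using mat_exp_deriv[of M s S] by (simp add: mat_exp_commute)

lemma continuous_on_mat_exp [continuous_intros]:
  assumes "continuous_on S f" shows "continuous_on S (\<lambda>x. mat_exp (f x *\<^sub>R M))"
proof -
  have "continuous_on UNIV (\<lambda>t. mat_exp (t *\<^sub>R M))"
    by (intro continuous_on_vector_derivative[OF mat_exp_deriv])
  from continuous_on_compose2[OF this assms] show ?thesis by simp
qed

lemma borel_measurable_mat_exp [measurable (raw)]:
  assumes "f \<in> borel_measurable N" shows "(\<lambda>x. mat_exp (f x *\<^sub>R M)) \<in> borel_measurable N"
proof -
  have "(\<lambda>t. mat_exp (t *\<^sub>R M)) \<in> borel_measurable borel"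
    by (intro borel_measurable_continuous_onI continuous_intros)
  from measurable_compose[OF assms this] show ?thesis .
qed

text \<open>
  The derivative of \<open>r \<mapsto> mat_exp ((s + t - r) *\<^sub>R M) ** mat_exp (r *\<^sub>R M)\<close> vanishes.
\<close>

lemma mat_exp_add: "mat_exp ((s + t) *\<^sub>R M) = mat_exp (s *\<^sub>R M) ** mat_exp (t *\<^sub>R M)"
proof -
  let ?\<phi> = "\<lambda>r. mat_exp ((s + t - r) *\<^sub>R M) ** mat_exp (r *\<^sub>R M)"
  have "(?\<phi> has_vector_derivative 0) (at r within UNIV)" for r
    using mm.has_vector_derivative[OF mat_exp_deriv_affine[of "s + t" M r UNIV] mat_exp_deriv[of M r]]
    by (simp add: mm.minus_left matrix_mul_assoc)
  then obtain c where "\<And>r. ?\<phi> r = c"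
    using has_vector_derivative_zero_constant[of UNIV ?\<phi>] by auto
  from this[of t] this[of 0] show ?thesis by simp
qed

lemma mat_exp_inverse: "mat_exp (s *\<^sub>R M) ** mat_exp (- s *\<^sub>R M) = mat 1"
    "mat_exp (- s *\<^sub>R M) ** mat_exp (s *\<^sub>R M) = mat 1"
  using mat_exp_add[of s "-s" M] mat_exp_add[of "-s" s M] by simp_all

lemma mat_exp_bounded_Icc: "\<exists>K>0. \<forall>t\<in>{a..b}. norm (mat_exp (t *\<^sub>R M)) \<le> K"
proof -
  have "bounded ((\<lambda>t. mat_exp (t *\<^sub>R M)) ` {a..b})"
    by (intro compact_imp_bounded compact_continuous_image continuous_intros) auto
  then show ?thesis unfolding bounded_pos by auto
qed

text \<open>
  Convergence to zero is automatically exponential: as soon as one \<open>mat_exp (h *\<^sub>R M)\<close> is so small that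
  multiplication by it shrinks norms by the factor \<open>exp (- 1)\<close>, the semigroup law shrinks them at every multiple
  of \<open>h\<close>.
\<close>

lemma mat_exp_decay:
  fixes M :: "real^'n^'n"
  assumes lim: "((\<lambda>t. mat_exp (t *\<^sub>R M)) \<longlongrightarrow> 0) at_top"
  obtains K c where "0 < K" "0 < c" "\<And>t. 0 \<le> t \<Longrightarrow> norm (mat_exp (t *\<^sub>R M)) \<le> K * exp (- c * t)"
proof -
  obtain k where k: "1 \<le> k" "\<And>(A::real^'n^'n) (B::real^'n^'n). norm (A ** B) \<le> norm A * norm B * k"
    using matrix_mult_norm_const by blast
  have "eventually (\<lambda>t. norm (mat_exp (t *\<^sub>R M)) < exp (- 1) / k) at_top"
    using order_tendstoD(2)[OF tendsto_norm[OF lim], of "exp (- 1) / k"] k by simp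
  then obtain t1 where t1: "\<And>t. t1 \<le> t \<Longrightarrow> norm (mat_exp (t *\<^sub>R M)) < exp (- 1) / k"
    by (auto simp: eventually_at_top_linorder)
  define h where "h = max 1 t1"
  have h: "1 \<le> h" "norm (mat_exp (h *\<^sub>R M)) \<le> exp (- 1) / k"
    using t1[of h] by (auto simp: h_def)
  obtain B where B: "0 < B" "\<And>t. 0 \<le> t \<Longrightarrow> t \<le> h \<Longrightarrow> norm (mat_exp (t *\<^sub>R M)) \<le> B"
    using mat_exp_bounded_Icc[of 0 h M] by auto
  have step: "norm (mat_exp ((r + real n * h) *\<^sub>R M)) \<le> B * exp (- real n)" if "0 \<le> r" "r \<le> h" for n r
  proof (induction n)
    case 0 then show ?case using B that by simp
  next
    case (Suc n)
    have "norm (mat_exp ((r + real (Suc n) * h) *\<^sub>R M)) =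
        norm (mat_exp ((r + real n * h) *\<^sub>R M) ** mat_exp (h *\<^sub>R M))"
      by (simp add: mat_exp_add[symmetric] distrib_right add_ac)
    also have "\<dots> \<le> norm (mat_exp ((r + real n * h) *\<^sub>R M)) * norm (mat_exp (h *\<^sub>R M)) * k"
      by (rule k)
    also have "\<dots> \<le> (B * exp (- real n)) * (exp (- 1) / k) * k"
      using k B h Suc by (intro mult_right_mono mult_mono) auto
    also have "\<dots> = B * exp (- real (Suc n))"
      using k by (simp add: exp_add[symmetric] algebra_simps)
    finally show ?case .
  qed
  show thesis
  proof (rule that)
    show "0 < B * exp 1" "0 < 1 / h" using B h by auto
    fix t :: real assume t: "0 \<le> t"
    define n where "n = nat \<lfloor>t / h\<rfloor>"
    have n: "real n \<le> t / h" "t / h < real n + 1"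
      using t h by (auto simp: n_def)
    then have r: "0 \<le> t - real n * h" "t - real n * h \<le> h"
      using h by (auto simp: field_simps)
    have "norm (mat_exp (t *\<^sub>R M)) \<le> B * exp (- real n)"
      using step[OF r, of n] by simp
    also have "\<dots> \<le> B * exp (1 - t / h)"
      using n B by (intro mult_left_mono) auto
    finally show "norm (mat_exp (t *\<^sub>R M)) \<le> B * exp 1 * exp (- (1 / h) * t)"
      by (simp add: exp_add[symmetric] mult.assoc)
  qed
qed

section \<open>Positive matrices with respect to dual cones\<close>

text \<open>
  The column vectors that are nonnegative on all orbits. Writing \<open>w - v \<in> dual_cone Z\<close> for \<open>v \<le> w\<close> turns
  the space of column vectors into an ordered vector space.
\<close>

definition dual_cone :: "(real^'n) set \<Rightarrow> (real^'n) set" where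
  "dual_cone Z = {w. \<forall>a\<in>Z. 0 \<le> a \<bullet> w}"

definition cone_positive :: "(real^'a) set \<Rightarrow> (real^'b) set \<Rightarrow> real^'b^'a \<Rightarrow> bool" where
  "cone_positive Z Z' M \<longleftrightarrow> (\<forall>w\<in>dual_cone Z'. M *v w \<in> dual_cone Z)"

definition exp_positive :: "(real^'n) set \<Rightarrow> real^'n^'n \<Rightarrow> bool" where
  "exp_positive Z M \<longleftrightarrow> (\<forall>t\<ge>0. cone_positive Z Z (mat_exp (t *\<^sub>R M)))"

lemma dual_cone_0 [simp]: "0 \<in> dual_cone Z"
  and dual_cone_add: "v \<in> dual_cone Z \<Longrightarrow> w \<in> dual_cone Z \<Longrightarrow> v + w \<in> dual_cone Z"
  and dual_cone_scaleR: "w \<in> dual_cone Z \<Longrightarrow> 0 \<le> c \<Longrightarrow> c *\<^sub>R w \<in> dual_cone Z"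
  by (auto simp: dual_cone_def inner_add_right)

lemma cone_positiveD: "cone_positive Z Z' M \<Longrightarrow> w \<in> dual_cone Z' \<Longrightarrow> M *v w \<in> dual_cone Z"
  by (simp add: cone_positive_def)

lemma cone_positive_0 [simp]: "cone_positive Z Z' 0"
  and cone_positive_one [simp]: "cone_positive Z Z (mat 1)"
  and cone_positive_add: "cone_positive Z Z' M \<Longrightarrow> cone_positive Z Z' N \<Longrightarrow> cone_positive Z Z' (M + N)"
  and cone_positive_mult: "cone_positive Z Z' M \<Longrightarrow> cone_positive Z' Z'' N' \<Longrightarrow> cone_positive Z Z'' (M ** N')"
  by (auto simp: cone_positive_def mv.zero_left mv.add_left dual_cone_add
      simp flip: matrix_vector_mul_assoc)

lemma exp_positiveD: "exp_positive Z M \<Longrightarrow> 0 \<le> t \<Longrightarrow> cone_positive Z Z (mat_exp (t *\<^sub>R M))"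
  by (simp add: exp_positive_def)

lemma dual_cone_lim:
  assumes "(f \<longlongrightarrow> w) F" "\<forall>\<^sub>F t in F. f t \<in> dual_cone Z" "F \<noteq> bot" shows "w \<in> dual_cone Z"
  unfolding dual_cone_def
proof safe
  fix a assume a: "a \<in> Z"
  show "0 \<le> a \<bullet> w"
    by (rule tendsto_lowerbound[OF tendsto_inner[OF tendsto_const assms(1)]])
       (use assms a in \<open>auto simp: dual_cone_def elim: eventually_mono\<close>)
qed

text \<open>
  A function with nonnegative derivative increases, also in the cone order. This replaces integration in
  all comparison arguments below.
\<close>

lemma mean_value_dual_cone:
  fixes f :: "real \<Rightarrow> real^'n"
  assumes d: "\<And>s. a \<le> s \<Longrightarrow> s \<le> b \<Longrightarrow> (f has_vector_derivative f' s) (at s within {a..b})"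
    and pos: "\<And>s. a \<le> s \<Longrightarrow> s \<le> b \<Longrightarrow> f' s \<in> dual_cone Z" and ab: "a \<le> b"
  shows "f b - f a \<in> dual_cone Z"
  unfolding dual_cone_def
proof safe
  fix z assume z: "z \<in> Z"
  show "0 \<le> z \<bullet> (f b - f a)"
  proof (cases "a = b")
    case False
    have "\<exists>x\<in>{a<..<b}. z \<bullet> f b - z \<bullet> f a = (\<lambda>r. r *\<^sub>R (z \<bullet> f' x)) (b - a)"
    proof (rule mvt_simple)
      show "a < b" using ab False by simp
      fix s assume s: "a \<le> s" "s \<le> b"
      from bounded_linear.has_vector_derivative[OF bounded_linear_inner_right d[OF s], of z]
      show "((\<lambda>x. z \<bullet> f x) has_derivative (\<lambda>r. r *\<^sub>R (z \<bullet> f' s))) (at s within {a..b})"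
        by (simp add: has_vector_derivative_def)
    qed
    then obtain x where x: "a < x" "x < b" "z \<bullet> f b - z \<bullet> f a = (b - a) * (z \<bullet> f' x)" by auto
    then have "0 \<le> (b - a) * (z \<bullet> f' x)"
      using pos[of x] z ab by (auto simp: dual_cone_def)
    with x show ?thesis by (simp add: inner_diff_right)
  qed simp
qed

text \<open>
  The condition \<open>total\<close> says that the orbits span the space. It makes the dual cone pointed, and it lets
  bounds and limits be checked on orbits only.
\<close>

locale total_orbits =
  fixes Z :: "(real^'n) set"
  assumes bounded: "bounded Z"
    and one: "a \<in> Z \<Longrightarrow> a \<bullet> 1 = 1"
    and total: "(\<And>a. a \<in> Z \<Longrightarrow> a \<bullet> c = 0) \<Longrightarrow> c = 0"
begin

lemma nonempty: "Z \<noteq> {}"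
proof
  assume "Z = {}"
  then have "(1::real^'n) = 0" by (intro total) auto
  then show False by simp
qed

lemma span_UNIV: "span Z = UNIV"
proof (rule ccontr)
  assume "span Z \<noteq> UNIV"
  then have "dim Z < DIM(real^'n)"
    by (metis dim_eq_full dim_subset_UNIV le_neq_implies_less)
  then obtain x where "x \<noteq> 0" "\<And>y. y \<in> span Z \<Longrightarrow> orthogonal x y"
    using orthogonal_to_subspace_exists by blast
  then show False
    using total[of x] by (auto simp: orthogonal_def inner_commute span_base)
qed

lemma one_dual [simp]: "1 \<in> dual_cone Z"
  by (simp add: dual_cone_def one)

lemma dual_antisym: "w \<in> dual_cone Z \<Longrightarrow> - w \<in> dual_cone Z \<Longrightarrow> w = 0"
  by (rule total) (force simp: dual_cone_def)

lemma inner_bound: obtains R where "0 < R" "\<And>a v. a \<in> Z \<Longrightarrow> \<bar>a \<bullet> v\<bar> \<le> R * norm v"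
proof -
  obtain R where "0 < R" "\<And>a. a \<in> Z \<Longrightarrow> norm a \<le> R"
    using bounded by (auto simp: bounded_pos)
  then show thesis
    by (intro that[of R]) (auto intro: order_trans[OF Cauchy_Schwarz_ineq2 mult_right_mono])
qed

text \<open>
  The vector \<open>1\<close> dominates every other vector up to a factor, since \<open>a \<bullet> 1 = 1\<close> and orbits are bounded.
\<close>

lemma order_unit:
  obtains R where "0 < R" "\<And>v. (R * norm v) *\<^sub>R 1 - v \<in> dual_cone Z" "\<And>v. (R * norm v) *\<^sub>R 1 + v \<in> dual_cone Z"
proof -
  obtain R where R: "0 < R" "\<And>a v. a \<in> Z \<Longrightarrow> \<bar>a \<bullet> v\<bar> \<le> R * norm v" by (rule inner_bound) (rule that)
  show thesis
  proof
    show "(R * norm v) *\<^sub>R 1 - v \<in> dual_cone Z" "(R * norm v) *\<^sub>R 1 + v \<in> dual_cone Z" for v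
      using R(2)[of _ v] by (force simp: dual_cone_def inner_diff_right inner_add_right one)+
  qed (rule R)
qed

text \<open>
  The row vectors \<open>a\<close> for which \<open>\<bar>a \<bullet> w\<bar>\<close> is controlled by the values of \<open>w\<close> on the orbits form a subspace
  that contains all orbits, hence all unit vectors.
\<close>

lemma norm_bound:
  obtains K where "0 < K" "\<And>w c. (\<And>a. a \<in> Z \<Longrightarrow> \<bar>a \<bullet> w\<bar> \<le> c) \<Longrightarrow> norm w \<le> K * c"
proof -
  let ?S = "{a. \<exists>K\<ge>0. \<forall>w c. (\<forall>a\<in>Z. \<bar>a \<bullet> w\<bar> \<le> c) \<longrightarrow> \<bar>a \<bullet> w\<bar> \<le> K * c}"
  have c0: "0 \<le> c" if "\<forall>a\<in>Z. \<bar>a \<bullet> w\<bar> \<le> c" for w c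
    using that nonempty by (meson abs_ge_zero all_not_in_conv order_trans)
  have "span Z \<subseteq> ?S"
  proof (rule span_minimal)
    show "Z \<subseteq> ?S" by (auto intro: exI[of _ 1])
    show "subspace ?S"
    proof (rule subspaceI)
      show "0 \<in> ?S" by (auto intro!: exI[of _ 0])
      fix x y assume "x \<in> ?S" "y \<in> ?S"
      then obtain K L where K: "0 \<le> K" "\<forall>w c. (\<forall>a\<in>Z. \<bar>a \<bullet> w\<bar> \<le> c) \<longrightarrow> \<bar>x \<bullet> w\<bar> \<le> K * c"
        and L: "0 \<le> L" "\<forall>w c. (\<forall>a\<in>Z. \<bar>a \<bullet> w\<bar> \<le> c) \<longrightarrow> \<bar>y \<bullet> w\<bar> \<le> L * c" by auto
      have "\<bar>(x + y) \<bullet> w\<bar> \<le> (K + L) * c" if "\<forall>a\<in>Z. \<bar>a \<bullet> w\<bar> \<le> c" for w c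
        using K(2)[rule_format, of w c] L(2)[rule_format, of w c] that
        by (auto simp: inner_add_left distrib_right)
      with K L show "x + y \<in> ?S" by (auto intro!: exI[of _ "K + L"])
    next
      fix r x assume "x \<in> ?S"
      then obtain K where K: "0 \<le> K" "\<forall>w c. (\<forall>a\<in>Z. \<bar>a \<bullet> w\<bar> \<le> c) \<longrightarrow> \<bar>x \<bullet> w\<bar> \<le> K * c" by auto
      have "\<bar>(r *\<^sub>R x) \<bullet> w\<bar> \<le> (\<bar>r\<bar> * K) * c" if "\<forall>a\<in>Z. \<bar>a \<bullet> w\<bar> \<le> c" for w c
        using K(2)[rule_format, of w c] that by (simp add: abs_mult mult.assoc mult_left_mono)
      with K show "r *\<^sub>R x \<in> ?S" by (auto intro!: exI[of _ "\<bar>r\<bar> * K"])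
    qed
  qed
  then have "\<forall>i. axis i 1 \<in> ?S" by (auto simp: span_UNIV)
  then obtain K where K: "\<And>i. 0 \<le> K i"
      "\<And>i w c. (\<And>a. a \<in> Z \<Longrightarrow> \<bar>a \<bullet> w\<bar> \<le> c) \<Longrightarrow> \<bar>axis i 1 \<bullet> w\<bar> \<le> K i * c"
    by simp metis
  show thesis
  proof
    show "0 < sum K UNIV + 1" using K(1) by (intro add_nonneg_pos sum_nonneg) auto
    fix w c assume w: "\<And>a. a \<in> Z \<Longrightarrow> \<bar>a \<bullet> w\<bar> \<le> c"
    have "norm w \<le> (\<Sum>i\<in>UNIV. \<bar>w $ i\<bar>)" by (rule norm_le_l1_cart)
    also have "\<dots> \<le> (\<Sum>i\<in>UNIV. K i * c)"
      using K(2)[OF w] by (intro sum_mono) (simp add: inner_axis')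
    also have "\<dots> \<le> (sum K UNIV + 1) * c"
      using c0[of w c] w by (simp add: sum_distrib_right distrib_right)
    finally show "norm w \<le> (sum K UNIV + 1) * c" .
  qed
qed

lemma tendsto_cone:
  assumes "\<And>a. a \<in> Z \<Longrightarrow> ((\<lambda>t. a \<bullet> w t) \<longlongrightarrow> a \<bullet> l) F"
  shows "(w \<longlongrightarrow> l) F"
proof -
  have "span Z \<subseteq> {a. ((\<lambda>t. a \<bullet> w t) \<longlongrightarrow> a \<bullet> l) F}"
  proof (rule span_minimal)
    show "Z \<subseteq> {a. ((\<lambda>t. a \<bullet> w t) \<longlongrightarrow> a \<bullet> l) F}" using assms by auto
    show "subspace {a. ((\<lambda>t. a \<bullet> w t) \<longlongrightarrow> a \<bullet> l) F}"
      by (rule subspaceI) (auto simp: inner_add_left intro: tendsto_intros)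
  qed
  then have "((\<lambda>t. axis i 1 \<bullet> w t) \<longlongrightarrow> axis i 1 \<bullet> l) F" for i
    by (auto simp: span_UNIV)
  then show ?thesis by (intro vec_tendstoI) (simp add: inner_axis')
qed

lemma convergent_cone:
  assumes "\<And>a. a \<in> Z \<Longrightarrow> convergent (\<lambda>k. a \<bullet> w k)"
  shows "convergent w"
proof -
  have "span Z \<subseteq> {a. convergent (\<lambda>k. a \<bullet> w k)}"
  proof (rule span_minimal)
    show "Z \<subseteq> {a. convergent (\<lambda>k. a \<bullet> w k)}" using assms by auto
    show "subspace {a. convergent (\<lambda>k. a \<bullet> w k)}"
      by (rule subspaceI)
         (auto simp: inner_add_left convergent_const intro: convergent_add convergent_mult_const_iff[THEN iffD2] convergent_mult[OF convergent_const])
  qed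
  then have "convergent (\<lambda>k. axis i 1 \<bullet> w k)" for i
    by (auto simp: span_UNIV)
  then have "(\<lambda>k. w k $ i) \<longlonglongrightarrow> lim (\<lambda>k. w k $ i)" for i
    by (simp add: inner_axis' convergent_LIMSEQ_iff)
  then have "w \<longlonglongrightarrow> (\<chi> i. lim (\<lambda>k. w k $ i))"
    by (intro vec_tendstoI) simp
  then show ?thesis by (rule convergentI)
qed

lemma convergent_monotone_cone:
  assumes mono: "\<And>k. w (Suc k) - w k \<in> dual_cone Z" and ub: "\<And>k. b - w k \<in> dual_cone Z"
  shows "convergent w"
proof (rule convergent_cone)
  fix a assume a: "a \<in> Z"
  show "convergent (\<lambda>k. a \<bullet> w k)"
  proof (rule Bseq_mono_convergent)
    have m: "incseq (\<lambda>k. a \<bullet> w k)"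
      using mono a by (intro incseq_SucI) (force simp: dual_cone_def inner_diff_right)
    have "\<bar>a \<bullet> w k\<bar> \<le> \<bar>a \<bullet> w 0\<bar> + \<bar>a \<bullet> b\<bar>" for k
      using incseqD[OF m, of 0 k] ub[of k] a by (force simp: dual_cone_def inner_diff_right)
    then show "Bseq (\<lambda>k. a \<bullet> w k)" by (intro BseqI') (auto simp: real_norm_def)
    show "\<forall>m n. m \<le> n \<longrightarrow> a \<bullet> w m \<le> a \<bullet> w n" using m by (auto dest: incseqD)
  qed
qed

text \<open>
  Variation of constants, in a form without integrals: \<open>mat_exp ((t - s) *\<^sub>R M) *v e s\<close> increases in \<open>s\<close>.
\<close>

lemma exp_positive_forward:
  assumes G: "exp_positive Z M"
    and d: "\<And>s. 0 \<le> s \<Longrightarrow> (e has_vector_derivative M *v e s + r s) (at s within {0..})"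
    and r: "\<And>s. 0 \<le> s \<Longrightarrow> r s \<in> dual_cone Z" and e0: "e 0 \<in> dual_cone Z" and t: "0 \<le> t"
  shows "e t \<in> dual_cone Z"
proof -
  let ?f = "\<lambda>s. mat_exp ((t - s) *\<^sub>R M) *v e s"
  have "?f t - ?f 0 \<in> dual_cone Z"
  proof (rule mean_value_dual_cone[OF _ _ t])
    fix s assume s: "0 \<le> s" "s \<le> t"
    have "(?f has_vector_derivative mat_exp ((t - s) *\<^sub>R M) *v (M *v e s + r s) +
        (- (mat_exp ((t - s) *\<^sub>R M) ** M)) *v e s) (at s within {0..t})"
      by (rule mv.has_vector_derivative[OF mat_exp_deriv_affine
          has_vector_derivative_within_subset[OF d[OF s(1)]]]) auto
    then show "(?f has_vector_derivative mat_exp ((t - s) *\<^sub>R M) *v r s) (at s within {0..t})"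
      by (simp add: mv.add_right mv.minus_left matrix_vector_mul_assoc)
    show "mat_exp ((t - s) *\<^sub>R M) *v r s \<in> dual_cone Z"
      using G s r by (auto intro!: cone_positiveD[OF exp_positiveD])
  qed
  moreover have "?f 0 \<in> dual_cone Z"
    using G t e0 by (auto intro!: cone_positiveD[OF exp_positiveD])
  ultimately show ?thesis
    using dual_cone_add by fastforce
qed

text \<open>
  The analogue for an equation solved backwards from infinity: \<open>mat_exp (s *\<^sub>R M) *v e s\<close> decreases, and its
  limit is nonnegative since \<open>e\<close> is bounded below and \<open>mat_exp (s *\<^sub>R M) *v 1\<close> vanishes at infinity.
\<close>

lemma exp_positive_backward:
  assumes G: "exp_positive Z M" and lim: "((\<lambda>t. mat_exp (t *\<^sub>R M) *v 1) \<longlongrightarrow> 0) at_top"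
    and d: "\<And>s. 0 \<le> s \<Longrightarrow> (e has_vector_derivative - (M *v e s) - r s) (at s within {0..})"
    and r: "\<And>s. 0 \<le> s \<Longrightarrow> r s \<in> dual_cone Z"
    and lb: "\<And>s. 0 \<le> s \<Longrightarrow> e s + K *\<^sub>R 1 \<in> dual_cone Z" and u: "0 \<le> u"
  shows "e u \<in> dual_cone Z"
proof -
  let ?f = "\<lambda>s. - (mat_exp ((s - u) *\<^sub>R M) *v e s)"
  have L: "e u + K *\<^sub>R (mat_exp (L *\<^sub>R M) *v 1) \<in> dual_cone Z" if L: "0 \<le> L" for L
  proof -
    have "?f (u + L) - ?f u \<in> dual_cone Z"
    proof (rule mean_value_dual_cone)
      fix s assume s: "u \<le> s" "s \<le> u + L"
      have "((\<lambda>s. mat_exp (s *\<^sub>R M)) \<circ> (\<lambda>s. s - u) has_vector_derivative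
          1 *\<^sub>R (M ** mat_exp ((s - u) *\<^sub>R M))) (at s within {u..u + L})"
        by (rule vector_diff_chain_within[OF _ mat_exp_deriv]) (auto intro!: derivative_eq_intros)
      then have D: "((\<lambda>s. mat_exp ((s - u) *\<^sub>R M)) has_vector_derivative (mat_exp ((s - u) *\<^sub>R M) ** M)) (at s within {u..u + L})"
        by (simp add: o_def mat_exp_commute)
      have "((\<lambda>s. mat_exp ((s - u) *\<^sub>R M) *v e s) has_vector_derivative
         mat_exp ((s - u) *\<^sub>R M) *v (- (M *v e s) - r s) +
          (mat_exp ((s - u) *\<^sub>R M) ** M) *v e s) (at s within {u..u+L})"
        by (rule mv.has_vector_derivative[OF D
            has_vector_derivative_within_subset[OF d]]) (use s u in auto)
      from has_vector_derivative_minus[OF this]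
      show "(?f has_vector_derivative mat_exp ((s - u) *\<^sub>R M) *v r s) (at s within {u..u+L})"
        by (simp add: mv.diff_right mv.minus_right matrix_vector_mul_assoc)
      show "mat_exp ((s - u) *\<^sub>R M) *v r s \<in> dual_cone Z"
        using G s u r by (auto intro!: cone_positiveD[OF exp_positiveD])
    qed (use L in auto)
    then have 1: "e u - mat_exp (L *\<^sub>R M) *v e (u + L) \<in> dual_cone Z" by simp
    have "mat_exp (L *\<^sub>R M) *v (e (u + L) + K *\<^sub>R 1) \<in> dual_cone Z"
      using G L u lb by (auto intro!: cone_positiveD[OF exp_positiveD])
    from dual_cone_add[OF 1 this] show ?thesis
      by (simp add: mv.add_right mv.scaleR_right)
  qed
  have "((\<lambda>L. e u + K *\<^sub>R (mat_exp (L *\<^sub>R M) *v 1)) \<longlongrightarrow> e u + K *\<^sub>R 0) at_top"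
    by (intro tendsto_intros lim)
  then show ?thesis
    using L by (intro dual_cone_lim[OF _ _ trivial_limit_at_top_linorder]) (auto intro: eventually_at_top_linorderI[of 0])
qed

lemma exp_positive_nat:
  assumes "cone_positive Z Z (mat_exp (h *\<^sub>R M))" shows "cone_positive Z Z (mat_exp ((real n * h) *\<^sub>R M))"
proof (induction n)
  case (Suc n)
  then have "cone_positive Z Z (mat_exp (h *\<^sub>R M) ** mat_exp ((real n * h) *\<^sub>R M))"
    using assms by (rule cone_positive_mult[rotated])
  then show ?case by (simp add: mat_exp_add[symmetric] distrib_right add_ac)
qed simp

text \<open>
  Let \<open>N \<ge> 0\<close> be the least number such that \<open>v s = mat_exp (s *\<^sub>R (M + B)) *v w\<close> satisfies \<open>v s + N *\<^sub>R 1 \<ge> 0\<close> on a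
  short interval \<open>[0, h]\<close>. By variation of constants the perturbation \<open>B\<close> can make \<open>v\<close> smaller than
  \<open>mat_exp (s *\<^sub>R M) *v w \<ge> 0\<close> by at most \<open>h K N\<close>, where \<open>K\<close> bounds \<open>mat_exp (s *\<^sub>R M) *v (B *v 1)\<close>. For
  \<open>h K \<le> 1/2\<close> this gives \<open>N \<le> N / 2\<close>, so \<open>N = 0\<close>. The semigroup law extends positivity to all times.
\<close>

lemma exp_positive_add:
  assumes G: "exp_positive Z M" and B: "cone_positive Z Z B"
  shows "exp_positive Z (M + B)"
proof -
  obtain R where R: "0 < R" "\<And>v. (R * norm v) *\<^sub>R 1 - v \<in> dual_cone Z" "\<And>v. (R * norm v) *\<^sub>R 1 + v \<in> dual_cone Z"
    by (rule order_unit) (rule that)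
  obtain R' where R': "0 < R'" "\<And>a v. a \<in> Z \<Longrightarrow> \<bar>a \<bullet> v\<bar> \<le> R' * norm v" by (rule inner_bound) (rule that)
  have "bounded ((\<lambda>s. mat_exp (s *\<^sub>R M) *v (B *v 1)) ` {0..1})"
    by (intro compact_imp_bounded compact_continuous_image continuous_intros mv.continuous_on) auto
  then obtain b where b: "0 < b" "\<And>s. 0 \<le> s \<Longrightarrow> s \<le> 1 \<Longrightarrow> norm (mat_exp (s *\<^sub>R M) *v (B *v 1)) \<le> b"
    by (auto simp: bounded_pos)
  define K where "K = R * b"
  have K0: "0 < K" using R b by (simp add: K_def)
  have K: "K *\<^sub>R 1 - mat_exp (s *\<^sub>R M) *v (B *v 1) \<in> dual_cone Z" if "0 \<le> s" "s \<le> 1" for s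
  proof -
    let ?v = "mat_exp (s *\<^sub>R M) *v (B *v 1)"
    have "(R * norm ?v) *\<^sub>R 1 - ?v + (R * (b - norm ?v)) *\<^sub>R 1 \<in> dual_cone Z"
      using R b that by (intro dual_cone_add dual_cone_scaleR) auto
    then show ?thesis by (simp add: K_def algebra_simps)
  qed
  \<comment> \<open>the bound \<open>K\<close> holds on \<open>[0, 1]\<close> only\<close>
  define h where "h = min 1 (1 / (2 * K))"
  have h: "0 < h" "h \<le> 1" "h * K \<le> 1 / 2"
    using K0 by (auto simp: h_def field_simps min_def)
  have small: "cone_positive Z Z (mat_exp (t *\<^sub>R (M + B)))" if t: "0 \<le> t" "t \<le> h" for t
    unfolding cone_positive_def
  proof
    fix w assume w: "w \<in> dual_cone Z"
    define v where "v s = mat_exp (s *\<^sub>R (M + B)) *v w" for s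
    define I where "I = (\<lambda>(a, s). - (a \<bullet> v s)) ` (Z \<times> {0..h})"
    have "bounded (v ` {0..h})"
      unfolding v_def
      by (intro compact_imp_bounded compact_continuous_image continuous_intros mv.continuous_on) auto
    then obtain c where c: "0 < c" "\<And>s. 0 \<le> s \<Longrightarrow> s \<le> h \<Longrightarrow> norm (v s) \<le> c"
      by (auto simp: bounded_pos)
    have bdd: "bdd_above I"
    proof (rule bdd_aboveI)
      fix x assume "x \<in> I"
      then obtain a s where as: "a \<in> Z" "0 \<le> s" "s \<le> h" "x = - (a \<bullet> v s)" by (auto simp: I_def)
      have "x \<le> R' * norm (v s)" using R'(2)[OF as(1), of "v s"] as by auto
      also have "\<dots> \<le> R' * c" using R' c as by simp
      finally show "x \<le> R' * c" .
    qed
    define N where "N = max 0 (Sup I)"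
    have vN: "v s + N *\<^sub>R 1 \<in> dual_cone Z" if "0 \<le> s" "s \<le> h" for s
      unfolding dual_cone_def
    proof safe
      fix a assume "a \<in> Z"
      then have "- (a \<bullet> v s) \<le> Sup I" using that bdd by (intro cSup_upper) (auto simp: I_def)
      then show "0 \<le> a \<bullet> (v s + N *\<^sub>R 1)"
        using \<open>a \<in> Z\<close> by (simp add: inner_add_right one N_def)
    qed
    have half: "v t + (N / 2) *\<^sub>R 1 \<in> dual_cone Z" if t: "0 \<le> t" "t \<le> h" for t
    proof -
      let ?f = "\<lambda>s. mat_exp ((t - s) *\<^sub>R M) *v v s + s *\<^sub>R ((N * K) *\<^sub>R 1)"
      have "?f t - ?f 0 \<in> dual_cone Z"
      proof (rule mean_value_dual_cone[OF _ _ t(1)])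
        fix s assume s: "0 \<le> s" "s \<le> t"
        have dv: "(v has_vector_derivative ((M + B) ** mat_exp (s *\<^sub>R (M + B))) *v w) (at s within {0..t})"
          unfolding v_def by (rule bounded_linear.has_vector_derivative[OF mv.bounded_linear_left mat_exp_deriv])
        have "(?f has_vector_derivative mat_exp ((t - s) *\<^sub>R M) *v (((M + B) ** mat_exp (s *\<^sub>R (M + B))) *v w) +
            (- (mat_exp ((t - s) *\<^sub>R M) ** M)) *v v s + (N * K) *\<^sub>R 1) (at s within {0..t})"
          by (intro has_vector_derivative_add mv.has_vector_derivative[OF mat_exp_deriv_affine dv])
             (auto intro!: derivative_eq_intros)
        moreover have "mat_exp ((t - s) *\<^sub>R M) *v (((M + B) ** mat_exp (s *\<^sub>R (M + B))) *v w) +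
            (- (mat_exp ((t - s) *\<^sub>R M) ** M)) *v v s + (N * K) *\<^sub>R 1 =
            mat_exp ((t - s) *\<^sub>R M) *v (B *v (v s + N *\<^sub>R 1)) +
            N *\<^sub>R (K *\<^sub>R 1 - mat_exp ((t - s) *\<^sub>R M) *v (B *v 1))"
          by (simp add: v_def mv.add_right mv.add_left mm.add_left mm.add_right mv.minus_left mv.scaleR_right algebra_simps
              flip: matrix_vector_mul_assoc)
        ultimately show "(?f has_vector_derivative mat_exp ((t - s) *\<^sub>R M) *v (B *v (v s + N *\<^sub>R 1)) +
            N *\<^sub>R (K *\<^sub>R 1 - mat_exp ((t - s) *\<^sub>R M) *v (B *v 1))) (at s within {0..t})" by simp
        show "mat_exp ((t - s) *\<^sub>R M) *v (B *v (v s + N *\<^sub>R 1)) +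
            N *\<^sub>R (K *\<^sub>R 1 - mat_exp ((t - s) *\<^sub>R M) *v (B *v 1)) \<in> dual_cone Z"
          using s t h
          by (intro dual_cone_add[OF cone_positiveD[OF exp_positiveD[OF G] cone_positiveD[OF B vN]] dual_cone_scaleR[OF K]])
             (auto simp: N_def)
      qed
      moreover have "?f 0 \<in> dual_cone Z"
        using G t w by (auto simp: v_def intro!: cone_positiveD[OF exp_positiveD])
      ultimately have "?f t \<in> dual_cone Z" using dual_cone_add by fastforce
      moreover have "(N / 2 - t * (N * K)) *\<^sub>R (1::real^'n) \<in> dual_cone Z"
      proof (intro dual_cone_scaleR one_dual)
        have "t * K \<le> 1 / 2" using h t K0 by (smt (verit) mult_right_mono)
        from mult_left_mono[OF this, of N] show "0 \<le> N / 2 - t * (N * K)"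
          by (simp add: N_def mult_ac)
      qed
      ultimately have "?f t + (N / 2 - t * (N * K)) *\<^sub>R (1::real^'n) \<in> dual_cone Z"
        by (rule dual_cone_add)
      then show ?thesis by (simp add: algebra_simps)
    qed
    have "Sup I \<le> N / 2"
    proof (rule cSup_least)
      show "I \<noteq> {}" using nonempty h by (auto simp: I_def)
      fix x assume "x \<in> I"
      then obtain a s where as: "a \<in> Z" "0 \<le> s" "s \<le> h" "x = - (a \<bullet> v s)" by (auto simp: I_def)
      then show "x \<le> N / 2" using half[of s] by (auto simp: dual_cone_def inner_add_right one)
    qed
    then have "N = 0" by (auto simp: N_def max_def split: if_splits)
    then show "mat_exp (t *\<^sub>R (M + B)) *v w \<in> dual_cone Z"
      using vN[OF t] by (simp add: v_def)
  qed
  show ?thesis unfolding exp_positive_def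
  proof safe
    fix t :: real assume t: "0 \<le> t"
    define n where "n = nat \<lceil>t / h\<rceil> + 1"
    have n: "t / h \<le> real n" "0 < real n" by (auto simp: n_def) linarith
    then have "t / real n \<le> h" using h by (simp add: field_simps)
    from exp_positive_nat[OF small[OF _ this], of n] n t
    show "cone_positive Z Z (mat_exp (t *\<^sub>R (M + B)))" by simp
  qed
qed

end

section \<open>Differential equations on a half-line\<close>

lemma has_vector_derivative_atLeast_of_Icc:
  fixes f :: "real \<Rightarrow> 'a::real_normed_vector"
  assumes "(f has_vector_derivative D) (at u within {a..u + 1})"
  shows "(f has_vector_derivative D) (at u within {a..})"
proof -
  have "at u within {a..u + 1} = at u within {a..}"
    by (rule at_within_nhd[of u "{..<u + 1}"]) auto
  with assms show ?thesis by simp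
qed

lemma integral_has_vector_derivative_atLeast:
  fixes f :: "real \<Rightarrow> 'a::banach"
  assumes "continuous_on {a..} f" "a \<le> u"
  shows "((\<lambda>u. integral {a..u} f) has_vector_derivative f u) (at u within {a..})"
  by (intro has_vector_derivative_atLeast_of_Icc integral_has_vector_derivative
      continuous_on_subset[OF assms(1)]) (use assms(2) in auto)

lemma continuous_on_limit_bounded_derivative:
  fixes f d :: "nat \<Rightarrow> real \<Rightarrow> 'a::euclidean_space"
  assumes f: "\<And>k u. 0 \<le> u \<Longrightarrow> (f k has_vector_derivative d k u) (at u within {0..})"
    and K: "\<And>k u. 0 \<le> u \<Longrightarrow> norm (d k u) \<le> K"
    and lf: "\<And>u. 0 \<le> u \<Longrightarrow> (\<lambda>k. f k u) \<longlonglongrightarrow> g u"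
  shows "continuous_on {0..} g"
proof -
  have lip: "norm (f k a - f k b) \<le> K * norm (a - b)" if "0 \<le> a" "0 \<le> b" for a b k
  proof (rule differentiable_bound)
    show "convex {0::real..}" by simp
    show "(f k has_derivative (\<lambda>r. r *\<^sub>R d k x)) (at x within {0..})" if "x \<in> {0..}" for x
      using f that by (auto simp: has_vector_derivative_def)
    show "onorm (\<lambda>r. r *\<^sub>R d k x) \<le> K" if "x \<in> {0..}" for x
    proof (rule onorm_bound)
      show "0 \<le> K" using K[of x k] that order_trans[OF norm_ge_zero] by auto
      show "norm (r *\<^sub>R d k x) \<le> K * norm r" for r
        using mult_right_mono[OF K[of x k], of "\<bar>r\<bar>"] that by (simp add: mult.commute)
    qed
  qed (use that in auto)
  have "norm (g a - g b) \<le> K * norm (a - b)" if "0 \<le> a" "0 \<le> b" for a b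
    using that lip[OF that]
    by (intro tendsto_upperbound[OF tendsto_norm[OF tendsto_diff[OF lf lf]]] always_eventually) auto
  then have "K-lipschitz_on {0..} g"
    using order_trans[OF norm_ge_zero K[of 0 0]] by (intro lipschitz_onI) (auto simp: dist_norm)
  then show ?thesis by (rule lipschitz_on_continuous_on)
qed

text \<open>
  Pointwise limits suffice because the derivatives are uniformly bounded: the fundamental theorem of calculus
  passes to the limit by dominated convergence.
\<close>

lemma has_vector_derivative_limit:
  fixes f d :: "nat \<Rightarrow> real \<Rightarrow> 'a::euclidean_space"
  assumes f: "\<And>k u. 0 \<le> u \<Longrightarrow> (f k has_vector_derivative d k u) (at u within {0..})"
    and K: "\<And>k u. 0 \<le> u \<Longrightarrow> norm (d k u) \<le> K"
    and lf: "\<And>u. 0 \<le> u \<Longrightarrow> (\<lambda>k. f k u) \<longlonglongrightarrow> g u"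
    and ld: "\<And>u. 0 \<le> u \<Longrightarrow> (\<lambda>k. d k u) \<longlonglongrightarrow> d' u"
    and cd: "continuous_on {0..} d'" and u: "0 \<le> u"
  shows "(g has_vector_derivative d' u) (at u within {0..})"
proof -
  have eq: "g s = g 0 + integral {0..s} d'" if s: "0 \<le> s" for s
  proof -
    have h: "(d k has_integral f k s - f k 0) {0..s}" for k
      using s by (intro fundamental_theorem_of_calculus has_vector_derivative_within_subset[OF f]) auto
    have "(\<lambda>k. integral {0..s} (d k)) \<longlonglongrightarrow> integral {0..s} d'"
    proof (rule dominated_convergence(2))
      show "d k integrable_on {0..s}" for k using h[of k] by (auto simp: has_integral_iff)
      show "(\<lambda>_. K) integrable_on {0..s}" by (rule integrable_const_ivl)
    qed (use K ld in auto)
    moreover have "integral {0..s} (d k) = f k s - f k 0" for k using h[of k] by (auto simp: has_integral_iff)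
    moreover have "(\<lambda>k. f k s - f k 0) \<longlonglongrightarrow> g s - g 0" by (intro tendsto_diff lf) (use s in auto)
    ultimately have "integral {0..s} d' = g s - g 0" by (simp add: LIMSEQ_unique)
    then show ?thesis by simp
  qed
  have "((\<lambda>s. g 0 + integral {0..s} d') has_vector_derivative 0 + d' u) (at u within {0..})"
    by (intro has_vector_derivative_add has_vector_derivative_const integral_has_vector_derivative_atLeast cd u)
  then show ?thesis
    using has_vector_derivative_transform[of u "{0..}" g, OF _ eq] u by fastforce
qed

lemma set_integrable_exp_minus:
  assumes "0 < c" shows "set_integrable lborel {u..} (\<lambda>s::real. exp (- c * s))"
proof -
  have "(\<lambda>s::real. exp (- c * s)) absolutely_integrable_on {u..}"
    by (intro nonnegative_absolutely_integrable_1 integrable_on_exp_minus_to_infinity assms) auto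
  then show ?thesis unfolding set_integrable_def
    by (subst (asm) integrable_completion) auto
qed

lemma set_integral_exp_minus:
  fixes c :: real
  assumes "0 < c" shows "(LBINT s:{u..}. exp (- c * s)) = exp (- c * u) / c"
  using set_borel_integral_eq_integral(2)[OF set_integrable_exp_minus[OF assms, of u]]
    integral_unique[OF has_integral_exp_minus_to_infinity[OF assms, of u]] by simp

locale exp_bounded =
  fixes g :: "real \<Rightarrow> 'a::euclidean_space" and K c :: real
  assumes cont: "continuous_on {0..} g" and c: "0 < c"
    and bnd: "\<And>s. 0 \<le> s \<Longrightarrow> norm (g s) \<le> K * exp (- c * s)"
begin

lemma integrable: "set_integrable lborel {0..} g"
proof (rule set_integrable_bound)
  show "set_integrable lborel {0..} (\<lambda>s. K * exp (- c * s))"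
    using set_integrable_exp_minus[OF c, of 0] by simp
  show "set_borel_measurable lborel {0..} g"
    using borel_measurable_continuous_on_indicator[OF _ cont]
    by (simp add: set_borel_measurable_def)
  show "AE x in lborel. x \<in> {0..} \<longrightarrow> norm (g x) \<le> norm (K * exp (- c * x))"
    using bnd by (intro AE_I2) (auto intro: order_trans[OF _ abs_ge_self])
qed

lemma integrable_tail: "0 \<le> u \<Longrightarrow> set_integrable lborel {u<..} g"
  by (rule set_integrable_subset[OF integrable]) auto

lemma tail_bound: assumes u: "0 \<le> u" shows "norm (LBINT s:{u<..}. g s) \<le> K * exp (- c * u) / c"
proof -
  have "norm (LBINT s:{u<..}. g s) \<le> (LBINT s:{u<..}. norm (g s))"
    by (rule set_integral_norm_bound[OF integrable_tail[OF u]])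
  also have "\<dots> \<le> (LBINT s:{u..}. K * exp (- c * s))"
    unfolding set_lebesgue_integral_def
  proof (rule integral_mono)
    show "integrable lborel (\<lambda>x. indicat_real {u<..} x *\<^sub>R norm (g x))"
      using integrable_norm[OF integrable_tail[OF u, unfolded set_integrable_def]] by simp
    show "integrable lborel (\<lambda>x. indicat_real {u..} x *\<^sub>R (K * exp (- c * x)))"
      using set_integrable_exp_minus[OF c, of u] by (simp add: set_integrable_def mult.left_commute)
    show "indicat_real {u<..} x *\<^sub>R norm (g x) \<le> indicat_real {u..} x *\<^sub>R (K * exp (- c * x))" for x
      using bnd[of x] u order_trans[OF norm_ge_zero bnd, of x] by (auto simp: indicator_def)
  qed
  also have "\<dots> = K * exp (- c * u) / c"
    using set_integral_exp_minus[OF c, of u] by simp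
  finally show ?thesis .
qed

lemma tail_eq: assumes u: "0 \<le> u"
  shows "(LBINT s:{u<..}. g s) = (LBINT s:{0..}. g s) - integral {0..u} g"
proof -
  have i: "set_integrable lborel {0..u} g" by (rule set_integrable_subset[OF integrable]) auto
  have e: "{0..} = {0..u} \<union> {u<..}" using u by auto
  have "(LBINT s:{0..}. g s) = (LBINT s:{0..u}. g s) + (LBINT s:{u<..}. g s)"
    by (subst e) (rule set_integral_Un[OF _ i integrable_tail[OF u]], auto)
  then show ?thesis using set_borel_integral_eq_integral(2)[OF i] by simp
qed

lemma tail_deriv: assumes u: "0 \<le> u"
  shows "((\<lambda>u. LBINT s:{u<..}. g s) has_vector_derivative - g u) (at u within {0..})"
proof -
  have "((\<lambda>u. (LBINT s:{0..}. g s) - integral {0..u} g) has_vector_derivative 0 - g u) (at u within {0..})"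
    by (intro has_vector_derivative_diff has_vector_derivative_const integral_has_vector_derivative_atLeast cont u)
  then show ?thesis
    by (intro has_vector_derivative_transform[of u "{0..}" "\<lambda>u. LBINT s:{u<..}. g s"])
       (use u tail_eq in auto)
qed

lemma integral_lim: "((\<lambda>u. integral {0..u} g) \<longlongrightarrow> (LBINT s:{0..}. g s)) at_top"
proof -
  have "((\<lambda>u. K * exp (- c * u) / c) \<longlongrightarrow> 0) at_top"
  proof -
    have "filterlim (\<lambda>u. - c * u) at_bot at_top"
      using c by (intro filterlim_tendsto_neg_mult_at_bot[OF tendsto_const]) (auto simp: filterlim_ident)
    from filterlim_compose[OF exp_at_bot this]
    have "((\<lambda>u. K * exp (- c * u) / c) \<longlongrightarrow> K * 0 / c) at_top" using c by (intro tendsto_intros) auto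
    then show ?thesis by simp
  qed
  then have "((\<lambda>u. LBINT s:{u<..}. g s) \<longlongrightarrow> 0) at_top"
    by (rule Lim_null_comparison[rotated]) (use tail_bound in \<open>auto intro: eventually_at_top_linorderI[of 0]\<close>)
  then have "((\<lambda>u. (LBINT s:{0..}. g s) - (LBINT s:{u<..}. g s)) \<longlongrightarrow> (LBINT s:{0..}. g s) - 0) at_top"
    by (intro tendsto_diff tendsto_const)
  then have "((\<lambda>u. (LBINT s:{0..}. g s) - (LBINT s:{u<..}. g s)) \<longlongrightarrow> (LBINT s:{0..}. g s)) at_top" by simp
  then show ?thesis
    by (rule Lim_transform_eventually) (auto simp: tail_eq intro!: eventually_at_top_linorderI[of 0])
qed

end

text \<open>
  The bounded solution of \<open>f' = - M f - h\<close> on the half-line, for decaying \<open>mat_exp (t *\<^sub>R M)\<close>.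
\<close>

definition anticausal :: "real^'n^'n \<Rightarrow> (real \<Rightarrow> real^'k^'n) \<Rightarrow> real \<Rightarrow> real^'k^'n" where
  "anticausal M h u = mat_exp (- u *\<^sub>R M) ** (LBINT s:{u<..}. mat_exp (s *\<^sub>R M) ** h s)"

text \<open>
  The solution of \<open>f' = M f + h\<close> with \<open>f 0 = mat 1\<close>.
\<close>

definition causal :: "real^'n^'n \<Rightarrow> (real \<Rightarrow> real^'n^'n) \<Rightarrow> real \<Rightarrow> real^'n^'n" where
  "causal M h u = mat_exp (u *\<^sub>R M) ** (mat 1 + integral {0..u} (\<lambda>s. mat_exp (- s *\<^sub>R M) ** h s))"

lemma mat_exp_deriv_minus:
  "((\<lambda>s. mat_exp (- s *\<^sub>R M)) has_vector_derivative - (mat_exp (- s *\<^sub>R M) ** M)) (at s within S)"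
  using mat_exp_deriv_affine[of 0 M s S] by simp

lemma causal_0 [simp]: "causal M h 0 = mat 1"
  by (simp add: causal_def)

lemma causal_deriv:
  assumes h: "continuous_on {0..} h" and u: "0 \<le> u"
  shows "(causal M h has_vector_derivative M ** causal M h u + h u) (at u within {0..})"
proof -
  have "continuous_on {0..} (\<lambda>s. mat_exp (- s *\<^sub>R M) ** h s)"
    by (intro mm.continuous_on h continuous_intros)
  then have "(causal M h has_vector_derivative
      mat_exp (u *\<^sub>R M) ** (0 + mat_exp (- u *\<^sub>R M) ** h u) +
      (M ** mat_exp (u *\<^sub>R M)) ** (mat 1 + integral {0..u} (\<lambda>s. mat_exp (- s *\<^sub>R M) ** h s))) (at u within {0..})"
    unfolding causal_def[abs_def] using u
    by (intro mm.has_vector_derivative mat_exp_deriv has_vector_derivative_add has_vector_derivative_const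
        integral_has_vector_derivative_atLeast)
  then show ?thesis
    by (simp add: causal_def matrix_mul_assoc mat_exp_inverse add.commute flip: scaleR_minus_left)
qed

lemma anticausal_props:
  fixes M :: "real^'n^'n" and h :: "real \<Rightarrow> real^'k^'n"
  assumes lim: "((\<lambda>t. mat_exp (t *\<^sub>R M)) \<longlongrightarrow> 0) at_top"
    and h: "continuous_on {0..} h" and H: "\<And>s. 0 \<le> s \<Longrightarrow> norm (h s) \<le> H"
  shows "\<And>u. 0 \<le> u \<Longrightarrow> (anticausal M h has_vector_derivative - (M ** anticausal M h u) - h u) (at u within {0..})"
    and "\<exists>B. \<forall>u\<ge>0. norm (anticausal M h u) \<le> B"
proof -
  obtain K c where Kc: "0 < K" "0 < c" "\<And>t. 0 \<le> t \<Longrightarrow> norm (mat_exp (t *\<^sub>R M)) \<le> K * exp (- c * t)"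
    by (rule mat_exp_decay[OF lim]) blast
  obtain k where k: "1 \<le> k" "\<And>(A::real^'n^'n) (B::real^'k^'n). norm (A ** B) \<le> norm A * norm B * k"
    using matrix_mult_norm_const by blast
  have H0: "0 \<le> H" using H[of 0] norm_ge_zero order_trans by blast
  let ?g = "\<lambda>s. mat_exp (s *\<^sub>R M) ** h s"
  have cg: "continuous_on {0..} ?g" by (intro mm.continuous_on h continuous_intros)
  have gb: "norm (mat_exp (r *\<^sub>R M) ** h s) \<le> (K * H * k) * exp (- c * r)" if "0 \<le> r" "0 \<le> s" for r s
  proof -
    have "norm (mat_exp (r *\<^sub>R M) ** h s) \<le> norm (mat_exp (r *\<^sub>R M)) * norm (h s) * k" by (rule k)
    also have "\<dots> \<le> (K * exp (- c * r)) * H * k"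
      using that k Kc H H0 by (intro mult_mono) auto
    finally show ?thesis by (simp add: mult_ac)
  qed
  interpret g: exp_bounded ?g "K * H * k" c
    by standard (use cg Kc gb in auto)
  show "(anticausal M h has_vector_derivative - (M ** anticausal M h u) - h u) (at u within {0..})" if u: "0 \<le> u" for u
  proof -
    have "(anticausal M h has_vector_derivative
        mat_exp (- u *\<^sub>R M) ** - (mat_exp (u *\<^sub>R M) ** h u) +
        - (mat_exp (- u *\<^sub>R M) ** M) ** (LBINT s:{u<..}. ?g s)) (at u within {0..})"
      unfolding anticausal_def[abs_def]
      by (intro mm.has_vector_derivative mat_exp_deriv_minus g.tail_deriv u)
    moreover have "mat_exp (- u *\<^sub>R M) ** M = M ** mat_exp (- u *\<^sub>R M)" by (rule mat_exp_commute[symmetric])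
    ultimately show ?thesis
      by (simp add: anticausal_def mm.minus_left mm.minus_right matrix_mul_assoc mat_exp_inverse
          minus_diff_commute[of _ "h u"] flip: scaleR_minus_left)
  qed
  have "norm (anticausal M h u) \<le> K * H * k / c" if u: "0 \<le> u" for u
  proof -
    let ?gu = "\<lambda>s. mat_exp (s *\<^sub>R M) ** h (s + u)"
    have eq: "anticausal M h u = (LBINT s:{u<..}. mat_exp ((s - u) *\<^sub>R M) ** h s)"
    proof -
      have "anticausal M h u = (LBINT s:{u<..}. mat_exp (- u *\<^sub>R M) ** ?g s)"
        unfolding anticausal_def set_lebesgue_integral_def
        using integral_bounded_linear[OF mm.bounded_linear_right g.integrable_tail[OF u, unfolded set_integrable_def],
          of "mat_exp (- u *\<^sub>R M)"]
        by (simp add: mm.scaleR_right)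
      also have "\<dots> = (LBINT s:{u<..}. mat_exp ((s - u) *\<^sub>R M) ** h s)"
        by (simp only: matrix_mul_assoc mat_exp_add[symmetric]) (simp add: add.commute)
      finally show ?thesis .
    qed
    have eq2: "\<dots> = (LBINT s:{0<..}. ?gu s)"
      unfolding set_lebesgue_integral_def
      by (subst lborel_integral_real_affine[of 1 _ u]) (auto simp: indicator_def add.commute intro!: Bochner_Integration.integral_cong)
    interpret gu: exp_bounded ?gu "K * H * k" c
    proof
      have "continuous_on {0..} (\<lambda>s. h (s + u))"
        by (rule continuous_on_compose2[OF h]) (use u in \<open>auto intro!: continuous_intros\<close>)
      then show "continuous_on {0..} ?gu" by (intro mm.continuous_on continuous_intros)
    qed (use Kc gb u in auto)
    show ?thesis using gu.tail_bound[of 0] eq eq2 by simp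
  qed
  then show "\<exists>B. \<forall>u\<ge>0. norm (anticausal M h u) \<le> B" by blast
qed

text \<open>
  Integrate the derivative of \<open>mat_exp (y *\<^sub>R C) ** Q ** mat_exp (y *\<^sub>R C')\<close> over the half-line.
\<close>

lemma sylvester_integral:
  fixes C :: "real^'n^'n" and C' :: "real^'k^'k" and Q :: "real^'k^'n"
  assumes lim: "((\<lambda>t. mat_exp (t *\<^sub>R C)) \<longlongrightarrow> 0) at_top"
    and B: "\<And>t. 0 \<le> t \<Longrightarrow> norm (mat_exp (t *\<^sub>R C')) \<le> B"
  defines "J \<equiv> (LBINT y:{0..}. mat_exp (y *\<^sub>R C) ** Q ** mat_exp (y *\<^sub>R C'))"
  shows "C ** J + J ** C' + Q = 0"
proof -
  obtain K c where Kc: "0 < K" "0 < c" "\<And>t. 0 \<le> t \<Longrightarrow> norm (mat_exp (t *\<^sub>R C)) \<le> K * exp (- c * t)"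
    by (rule mat_exp_decay[OF lim]) blast
  obtain k where k: "1 \<le> k" "\<And>(A::real^'n^'n) (B::real^'k^'n). norm (A ** B) \<le> norm A * norm B * k"
    using matrix_mult_norm_const by blast
  obtain k' where k': "1 \<le> k'" "\<And>(A::real^'k^'n) (B::real^'k^'k). norm (A ** B) \<le> norm A * norm B * k'"
    using matrix_mult_norm_const by blast
  let ?q = "\<lambda>y. mat_exp (y *\<^sub>R C) ** Q ** mat_exp (y *\<^sub>R C')"
  have B0: "0 \<le> B" using B[of 0] norm_ge_zero order_trans by blast
  interpret q: exp_bounded ?q "K * norm Q * k * B * k'" c
  proof
    show "continuous_on {0..} ?q" by (intro mm.continuous_on continuous_intros)
    fix s :: real assume s: "0 \<le> s"
    have "norm (?q s) \<le> norm (mat_exp (s *\<^sub>R C) ** Q) * norm (mat_exp (s *\<^sub>R C')) * k'" by (rule k')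
    also have "\<dots> \<le> (norm (mat_exp (s *\<^sub>R C)) * norm Q * k) * B * k'"
      using k k' B s B0 by (intro mult_mono) auto
    also have "\<dots> \<le> ((K * exp (- c * s)) * norm Q * k) * B * k'"
      using k k' B0 Kc s by (intro mult_right_mono) auto
    finally show "norm (?q s) \<le> K * norm Q * k * B * k' * exp (- c * s)" by (simp add: mult_ac)
  qed (rule Kc)
  have D: "(?q has_vector_derivative C ** ?q y + ?q y ** C') (at y within S)" for y S
  proof -
    have "(?q has_vector_derivative (mat_exp (y *\<^sub>R C) ** Q) ** (mat_exp (y *\<^sub>R C') ** C') +
       (mat_exp (y *\<^sub>R C) ** 0 + (C ** mat_exp (y *\<^sub>R C)) ** Q) ** mat_exp (y *\<^sub>R C')) (at y within S)"
      by (intro mm.has_vector_derivative mat_exp_deriv mat_exp_deriv_left has_vector_derivative_const)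
    then show ?thesis by (simp add: mm.add_left mm.zero_right matrix_mul_assoc add.commute)
  qed
  have eq: "C ** integral {0..L} ?q + integral {0..L} ?q ** C' = ?q L - Q" if L: "0 \<le> L" for L
  proof -
    have i: "?q integrable_on {0..L}"
      by (intro integrable_continuous_real mm.continuous_on continuous_intros)
    have "((\<lambda>y. C ** ?q y + ?q y ** C') has_integral ?q L - ?q 0) {0..L}"
      by (rule fundamental_theorem_of_calculus[OF L D])
    moreover have "((\<lambda>y. C ** ?q y + ?q y ** C') has_integral C ** integral {0..L} ?q + integral {0..L} ?q ** C') {0..L}"
      using has_integral_linear[OF integrable_integral[OF i] mm.bounded_linear_right[of C]]
        has_integral_linear[OF integrable_integral[OF i] mm.bounded_linear_left[of C']]
      by (intro has_integral_add) (simp_all add: o_def)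
    ultimately show ?thesis by (auto dest: has_integral_unique)
  qed
  have "((\<lambda>y. K * norm Q * k * B * k' * exp (- c * y)) \<longlongrightarrow> 0) at_top"
  proof -
    have "filterlim (\<lambda>u. - c * u) at_bot at_top"
      using Kc by (intro filterlim_tendsto_neg_mult_at_bot[OF tendsto_const]) (auto simp: filterlim_ident)
    from tendsto_mult_right_zero[OF filterlim_compose[OF exp_at_bot this]] show ?thesis by simp
  qed
  then have q0: "(?q \<longlongrightarrow> 0) at_top"
    by (rule Lim_null_comparison[rotated]) (use q.bnd in \<open>auto intro: eventually_at_top_linorderI[of 0]\<close>)
  have "((\<lambda>L. C ** integral {0..L} ?q + integral {0..L} ?q ** C') \<longlongrightarrow> C ** J + J ** C') at_top"
    unfolding J_def by (intro tendsto_add mm.tendsto tendsto_const q.integral_lim)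
  moreover have "((\<lambda>L. C ** integral {0..L} ?q + integral {0..L} ?q ** C') \<longlongrightarrow> 0 - Q) at_top"
    by (rule Lim_transform_eventually[OF tendsto_diff[OF q0 tendsto_const]])
       (use eq in \<open>auto intro!: eventually_at_top_linorderI[of 0]\<close>)
  ultimately have "C ** J + J ** C' = 0 - Q"
    by (rule tendsto_unique[rotated]) simp
  then show ?thesis by simp
qed

section \<open>Expected records with a bounded number of jumps\<close>

lemma bounded_matrix_mult_image:
  fixes f :: "'a \<Rightarrow> real^'k^'n"
  shows "bounded (f ` S) \<Longrightarrow> bounded ((\<lambda>u. A ** f u) ` S)"
  using bounded_linear_image[OF _ mm.bounded_linear_right, of "f ` S" A] by (simp add: image_image)

lemma bounded_matrix_vector_image:
  fixes f :: "'a \<Rightarrow> real^'k^'n"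
  shows "bounded (f ` S) \<Longrightarrow> bounded ((\<lambda>u. f u *v w) ` S)"
  using bounded_linear_image[OF _ mv.bounded_linear_left, of "f ` S" w] by (simp add: image_image)

lemma convergent_matrix_columns:
  fixes M :: "nat \<Rightarrow> real^'n^'m"
  assumes "\<And>w. convergent (\<lambda>k. M k *v w)" shows "convergent M"
proof -
  have "(\<lambda>k. M k $ i $ j) \<longlonglongrightarrow> lim (\<lambda>k. M k *v axis j 1) $ i" for i j
    using tendsto_vec_nth[OF assms[of "axis j 1", unfolded convergent_LIMSEQ_iff], of i]
    by (simp add: matrix_vector_mult_basis column_def)
  then have "M \<longlonglongrightarrow> (\<chi> i j. lim (\<lambda>k. M k *v axis j 1) $ i)"
    by (intro vec_tendstoI) simp
  then show ?thesis by (rule convergentI)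
qed

context total_orbits
begin

lemma dual_decompose: obtains c where "0 \<le> c" "w + c *\<^sub>R 1 \<in> dual_cone Z" "c *\<^sub>R 1 - w \<in> dual_cone Z"
proof -
  obtain R where "0 < R" "\<And>v. (R * norm v) *\<^sub>R 1 - v \<in> dual_cone Z" "\<And>v. (R * norm v) *\<^sub>R 1 + v \<in> dual_cone Z"
    by (rule order_unit) (rule that)
  then show thesis by (intro that[of "R * norm w"]) (simp_all add: add.commute)
qed

lemma bounded_below_dual:
  assumes "bounded (f ` S)" obtains K where "\<And>s. s \<in> S \<Longrightarrow> f s + K *\<^sub>R 1 \<in> dual_cone Z"
proof -
  obtain R where R: "0 < R" "\<And>v. (R * norm v) *\<^sub>R 1 - v \<in> dual_cone Z" "\<And>v. (R * norm v) *\<^sub>R 1 + v \<in> dual_cone Z"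
    by (rule order_unit) (rule that)
  obtain b where b: "\<And>s. s \<in> S \<Longrightarrow> norm (f s) \<le> b" using assms by (auto simp: bounded_iff)
  show thesis
  proof
    fix s assume "s \<in> S"
    then have "0 \<le> R * (b - norm (f s))" using b[of s] R(1) by simp
    then have "((R * norm (f s)) *\<^sub>R 1 + f s) + (R * (b - norm (f s))) *\<^sub>R 1 \<in> dual_cone Z"
      by (rule dual_cone_add[OF R(3) dual_cone_scaleR[OF one_dual]])
    then show "f s + (R * b) *\<^sub>R 1 \<in> dual_cone Z" by (simp add: algebra_simps)
  qed
qed

lemma matrix_eqI_dual:
  assumes "\<And>w. w \<in> dual_cone Z \<Longrightarrow> M *v w = N *v w" shows "M = N"
proof -
  have "M *v w = N *v w" for w
  proof -
    obtain c where c: "0 \<le> c" "w + c *\<^sub>R 1 \<in> dual_cone Z" by (rule dual_decompose) (rule that)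
    have "M *v (w + c *\<^sub>R 1) = N *v (w + c *\<^sub>R 1)" "M *v 1 = N *v 1"
      by (rule assms[OF c(2)], rule assms[OF one_dual])
    then show ?thesis by (simp add: mv.add_right mv.scaleR_right)
  qed
  then show ?thesis by (simp add: matrix_eq)
qed

lemma convergent_matrix_dual:
  assumes "\<And>w. w \<in> dual_cone Z \<Longrightarrow> convergent (\<lambda>k. M k *v w)" shows "convergent M"
proof (rule convergent_matrix_columns)
  fix w
  obtain c where c: "0 \<le> c" "w + c *\<^sub>R 1 \<in> dual_cone Z" by (rule dual_decompose) (rule that)
  have "convergent (\<lambda>k. M k *v (w + c *\<^sub>R 1) - c *\<^sub>R (M k *v 1))"
    using tendsto_diff[OF assms[OF c(2), unfolded convergent_LIMSEQ_iff]
        tendsto_scaleR[OF tendsto_const assms[OF one_dual, unfolded convergent_LIMSEQ_iff], of c]]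
    by (rule convergentI)
  then show "convergent (\<lambda>k. M k *v w)" by (simp add: mv.add_right mv.scaleR_right)
qed

lemma exp_tendsto_zero:
  assumes G: "exp_positive Z M" and lim: "((\<lambda>t. mat_exp (t *\<^sub>R M) *v 1) \<longlongrightarrow> 0) at_top"
  shows "((\<lambda>t. mat_exp (t *\<^sub>R M)) \<longlongrightarrow> 0) at_top"
proof -
  have v: "((\<lambda>t. mat_exp (t *\<^sub>R M) *v w) \<longlongrightarrow> 0) at_top" for w
  proof (rule tendsto_cone)
    fix a assume a: "a \<in> Z"
    obtain c where c: "0 \<le> c" "w + c *\<^sub>R 1 \<in> dual_cone Z" "c *\<^sub>R 1 - w \<in> dual_cone Z" by (rule dual_decompose) (rule that)
    have l: "((\<lambda>t. c * (a \<bullet> (mat_exp (t *\<^sub>R M) *v 1))) \<longlongrightarrow> c * (a \<bullet> 0)) at_top"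
      by (intro tendsto_intros lim)
    have "norm (a \<bullet> (mat_exp (t *\<^sub>R M) *v w)) \<le> c * (a \<bullet> (mat_exp (t *\<^sub>R M) *v 1))" if "0 \<le> t" for t
    proof -
      have "0 \<le> a \<bullet> (mat_exp (t *\<^sub>R M) *v (w + c *\<^sub>R 1))" "0 \<le> a \<bullet> (mat_exp (t *\<^sub>R M) *v (c *\<^sub>R 1 - w))"
        using cone_positiveD[OF exp_positiveD[OF G that] c(2)] cone_positiveD[OF exp_positiveD[OF G that] c(3)] a
        by (simp_all add: dual_cone_def)
      then show ?thesis
        by (simp add: mv.add_right mv.diff_right mv.scaleR_right inner_add_right inner_diff_right abs_le_iff)
    qed
    then have ev: "\<forall>\<^sub>F t in at_top. norm (a \<bullet> (mat_exp (t *\<^sub>R M) *v w)) \<le> c * (a \<bullet> (mat_exp (t *\<^sub>R M) *v 1))"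
      by (rule eventually_at_top_linorderI)
    from Lim_null_comparison[OF this] l
    show "((\<lambda>t. a \<bullet> (mat_exp (t *\<^sub>R M) *v w)) \<longlongrightarrow> a \<bullet> 0) at_top" by simp
  qed
  have "((\<lambda>t. mat_exp (t *\<^sub>R M) $ i $ j) \<longlongrightarrow> 0) at_top" for i j
    using tendsto_vec_nth[OF v[of "axis j 1"], of i] by (simp add: matrix_vector_mult_basis column_def)
  then show ?thesis by (intro vec_tendstoI) simp
qed

lemma deriv_dual:
  assumes d: "(e has_vector_derivative d) (at 0 within {0::real..})" and e0: "e 0 = 0"
    and pos: "\<And>s. 0 \<le> s \<Longrightarrow> e s \<in> dual_cone Z"
  shows "d \<in> dual_cone Z"
  unfolding dual_cone_def
proof safe
  fix a assume a: "a \<in> Z"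
  have "((\<lambda>s. a \<bullet> e s) has_real_derivative a \<bullet> d) (at 0 within {0..})"
    using bounded_linear.has_vector_derivative[OF bounded_linear_inner_right d, of a]
    by (simp add: has_real_derivative_iff_has_vector_derivative)
  then have l: "((\<lambda>s. (a \<bullet> e s) / s) \<longlongrightarrow> a \<bullet> d) (at 0 within {0..})"
    by (simp add: has_field_derivative_iff e0)
  have ev: "\<forall>\<^sub>F s in at 0 within {0..}. 0 \<le> (a \<bullet> e s) / s"
    using pos a by (auto simp: eventually_at_filter dual_cone_def intro!: always_eventually divide_nonneg_nonneg)
  have "at 0 within {0::real..} \<noteq> bot" unfolding at_within_Ici_at_right by (rule trivial_limit_at_right_real)
  from tendsto_lowerbound[OF l ev this] show "0 \<le> a \<bullet> d" .
qed

text \<open>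
  The hypothesis \<open>sub\<close> says that mass can only be lost: \<open>1 - mat_exp (u *\<^sub>R M) *v 1\<close> solves a forward
  equation with inhomogeneity \<open>- (M *v 1)\<close>.
\<close>

lemma exp_one_le:
  assumes M: "exp_positive Z M" and sub: "- (M *v 1) \<in> dual_cone Z" and u: "0 \<le> u"
  shows "1 - mat_exp (u *\<^sub>R M) *v 1 \<in> dual_cone Z"
proof (rule exp_positive_forward[OF M _ _ _ u])
  fix s :: real assume "0 \<le> s"
  have "((\<lambda>t. 1 - mat_exp (t *\<^sub>R M) *v 1) has_vector_derivative 0 - (M ** mat_exp (s *\<^sub>R M)) *v 1) (at s within {0..})"
    by (intro has_vector_derivative_diff has_vector_derivative_const
        bounded_linear.has_vector_derivative[OF mv.bounded_linear_left mat_exp_deriv])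
  then show "((\<lambda>t. 1 - mat_exp (t *\<^sub>R M) *v 1) has_vector_derivative
       M *v (1 - mat_exp (s *\<^sub>R M) *v 1) + - (M *v 1)) (at s within {0..})"
    by (simp add: mv.diff_right matrix_vector_mul_assoc)
qed (use sub in simp_all)

lemma exp_one_mono:
  assumes M: "exp_positive Z M" and B: "cone_positive Z Z B" and u: "0 \<le> u"
  shows "mat_exp (u *\<^sub>R (M + B)) *v 1 - mat_exp (u *\<^sub>R M) *v 1 \<in> dual_cone Z"
proof (rule exp_positive_forward[OF M _ _ _ u])
  let ?C = "M + B"
  fix s :: real assume "0 \<le> s"
  have "((\<lambda>t. mat_exp (t *\<^sub>R ?C) *v 1 - mat_exp (t *\<^sub>R M) *v 1) has_vector_derivative
    (?C ** mat_exp (s *\<^sub>R ?C)) *v 1 - (M ** mat_exp (s *\<^sub>R M)) *v 1) (at s within {0..})"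
    by (intro has_vector_derivative_diff bounded_linear.has_vector_derivative[OF mv.bounded_linear_left mat_exp_deriv])
  then show "((\<lambda>t. mat_exp (t *\<^sub>R ?C) *v 1 - mat_exp (t *\<^sub>R M) *v 1) has_vector_derivative
    M *v (mat_exp (s *\<^sub>R ?C) *v 1 - mat_exp (s *\<^sub>R M) *v 1) + B *v (mat_exp (s *\<^sub>R ?C) *v 1)) (at s within {0..})"
    by (simp add: mv.diff_right mm.add_left mv.add_left matrix_vector_mul_assoc diff_add_eq)
  show "B *v (mat_exp (s *\<^sub>R ?C) *v 1) \<in> dual_cone Z"
    using \<open>0 \<le> s\<close> by (intro cone_positiveD[OF B] cone_positiveD[OF exp_positiveD[OF exp_positive_add[OF M B]]]) auto
qed simp

end

text \<open>
  A positive matrix \<open>M\<close> with \<open>M *v 1 \<le> 1\<close> is bounded, as \<open>\<bar>a \<bullet> (M *v w)\<bar> \<le> c\<close> whenever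
  \<open>- c *\<^sub>R 1 \<le> w \<le> c *\<^sub>R 1\<close>. This is the source of all uniform bounds on the iterates.
\<close>

lemma substochastic_norm_bound:
  fixes Z :: "(real^'a) set" and Z' :: "(real^'b) set"
  assumes "total_orbits Z" "total_orbits Z'"
  obtains K where "0 < K" "\<And>M. cone_positive Z Z' M \<Longrightarrow> 1 - M *v 1 \<in> dual_cone Z \<Longrightarrow> norm M \<le> K"
proof -
  interpret P: total_orbits Z by fact
  interpret Q: total_orbits Z' by fact
  obtain K where K: "0 < K" "\<And>w c. (\<And>a. a \<in> Z \<Longrightarrow> \<bar>a \<bullet> w\<bar> \<le> c) \<Longrightarrow> norm w \<le> K * c" by (rule P.norm_bound) (rule that, assumption, blast)
  have "\<exists>c. \<forall>j::'b. 0 \<le> c j \<and> axis j 1 + c j *\<^sub>R 1 \<in> dual_cone Z' \<and> c j *\<^sub>R 1 - axis j 1 \<in> dual_cone Z'"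
  proof (intro choice allI)
    fix j :: 'b
    obtain c where "0 \<le> c" "axis j 1 + c *\<^sub>R 1 \<in> dual_cone Z'" "c *\<^sub>R 1 - axis j 1 \<in> dual_cone Z'"
      by (rule Q.dual_decompose) (rule that)
    then show "\<exists>c\<ge>0. axis j 1 + c *\<^sub>R 1 \<in> dual_cone Z' \<and> c *\<^sub>R 1 - axis j 1 \<in> dual_cone Z'" by blast
  qed
  then obtain c where c: "\<And>j. 0 \<le> c j" "\<And>j. axis j 1 + c j *\<^sub>R 1 \<in> dual_cone Z'" "\<And>j. c j *\<^sub>R 1 - axis j 1 \<in> dual_cone Z'"
    by blast
  show thesis
  proof
    let ?K = "real CARD('a) * (\<Sum>j\<in>UNIV. K * c j) + 1"
    show "0 < ?K" using K c by (intro add_nonneg_pos mult_nonneg_nonneg sum_nonneg) auto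
    fix M :: "real^'b^'a" assume M: "cone_positive Z Z' M" "1 - M *v 1 \<in> dual_cone Z"
    have col: "norm (M *v axis j 1) \<le> K * c j" for j
    proof (rule K(2))
      fix a assume a: "a \<in> Z"
      have 1: "a \<bullet> (M *v 1) \<le> 1" using M(2) a by (auto simp: dual_cone_def inner_diff_right P.one)
      have "\<bar>a \<bullet> (M *v axis j 1)\<bar> \<le> c j * (a \<bullet> (M *v 1))"
      proof -
        have "0 \<le> a \<bullet> (M *v (axis j 1 + c j *\<^sub>R 1))" "0 \<le> a \<bullet> (M *v (c j *\<^sub>R 1 - axis j 1))"
          using cone_positiveD[OF M(1) c(2)[of j]] cone_positiveD[OF M(1) c(3)[of j]] a
          by (simp_all add: dual_cone_def)
        then show ?thesis
          by (simp add: mv.add_right mv.diff_right mv.scaleR_right inner_add_right inner_diff_right abs_le_iff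
              del: matrix_vector_mult_basis)
      qed
      also have "\<dots> \<le> c j * 1" using 1 c by (intro mult_left_mono) auto
      finally show "\<bar>a \<bullet> (M *v axis j 1)\<bar> \<le> c j" by simp
    qed
    have ent: "norm (M $ i $ j) \<le> K * c j" for i j
      using order_trans[OF component_le_norm_cart col[of j], of i]
      by (simp add: matrix_vector_mult_basis column_def)
    have "norm M \<le> (\<Sum>i\<in>UNIV. norm (M $ i))" by (simp add: norm_vec_def L2_set_le_sum)
    also have "\<dots> \<le> (\<Sum>i\<in>(UNIV::'a set). \<Sum>j\<in>UNIV. K * c j)"
    proof (rule sum_mono)
      fix i
      have "norm (M $ i) \<le> (\<Sum>j\<in>UNIV. norm (M $ i $ j))"
        by (subst norm_vec_def) (rule L2_set_le_sum, simp)
      also have "\<dots> \<le> (\<Sum>j\<in>UNIV. K * c j)" by (intro sum_mono ent)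
      finally show "norm (M $ i) \<le> (\<Sum>j\<in>UNIV. K * c j)" .
    qed
    finally show "norm M \<le> ?K" by simp
  qed
qed

text \<open>
  The analytic data of a fluid process: \<open>Gp\<close>, \<open>Gm\<close> generate the flows, \<open>Bp\<close>, \<open>Bm\<close> and \<open>Dpm\<close>, \<open>Dmp\<close>
  describe jumps within a sign and between the signs. The suffixes \<open>p\<close> and \<open>m\<close> refer to the plus and the
  minus side.
\<close>

locale fluid_data = P: total_orbits Zp + N: total_orbits Zm
  for Zp :: "(real^'p) set" and Zm :: "(real^'m) set" +
  fixes Gp Bp :: "real^'p^'p" and Gm Bm :: "real^'m^'m" and Dpm :: "real^'m^'p" and Dmp :: "real^'p^'m"
  assumes Gp_pos: "exp_positive Zp Gp" and Gm_pos: "exp_positive Zm Gm"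
    and Bp_pos: "cone_positive Zp Zp Bp" and Bm_pos: "cone_positive Zm Zm Bm"
    and Dpm_pos: "cone_positive Zp Zm Dpm" and Dmp_pos: "cone_positive Zm Zp Dmp"
    and p_one: "(Gp + Bp) *v 1 + Dpm *v 1 = 0" and m_one: "(Gm + Bm) *v 1 + Dmp *v 1 = 0"
    and p_decay: "((\<lambda>t. mat_exp (t *\<^sub>R (Gp + Bp)) *v 1) \<longlongrightarrow> 0) at_top"
begin

abbreviation "Cp \<equiv> Gp + Bp"
abbreviation "Cm \<equiv> Gm + Bm"

lemma Cp_pos: "exp_positive Zp Cp" by (rule P.exp_positive_add[OF Gp_pos Bp_pos])
lemma Cm_pos: "exp_positive Zm Cm" by (rule N.exp_positive_add[OF Gm_pos Bm_pos])

lemma mv_deriv: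
  fixes F :: "real \<Rightarrow> real^'a^'b"
  assumes "(F has_vector_derivative F') net"
  shows "((\<lambda>u. F u *v w) has_vector_derivative F' *v w) net"
  by (rule bounded_linear.has_vector_derivative[OF mv.bounded_linear_left assms])

lemma Gp_decay_one: "((\<lambda>t. mat_exp (t *\<^sub>R Gp) *v 1) \<longlongrightarrow> 0) at_top"
proof (rule P.tendsto_cone)
  fix a assume a: "a \<in> Zp"
  note le = P.exp_one_mono[OF Gp_pos Bp_pos]
  have lim: "((\<lambda>t. a \<bullet> (mat_exp (t *\<^sub>R Cp) *v 1)) \<longlongrightarrow> 0) at_top"
    using tendsto_inner[OF tendsto_const p_decay, of a] by simp
  have "((\<lambda>t. a \<bullet> (mat_exp (t *\<^sub>R Gp) *v 1)) \<longlongrightarrow> 0) at_top"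
  proof (rule tendsto_sandwich[OF _ _ tendsto_const lim])
    show "\<forall>\<^sub>F t in at_top. 0 \<le> a \<bullet> (mat_exp (t *\<^sub>R Gp) *v 1)"
    proof (rule eventually_at_top_linorderI)
      fix t :: real assume "0 \<le> t"
      from cone_positiveD[OF exp_positiveD[OF Gp_pos this] P.one_dual] a
      show "0 \<le> a \<bullet> (mat_exp (t *\<^sub>R Gp) *v 1)" by (simp add: dual_cone_def)
    qed
    show "\<forall>\<^sub>F t in at_top. a \<bullet> (mat_exp (t *\<^sub>R Gp) *v 1) \<le> a \<bullet> (mat_exp (t *\<^sub>R Cp) *v 1)"
    proof (rule eventually_at_top_linorderI)
      fix t :: real assume "0 \<le> t"
      from le[OF this] a
      show "a \<bullet> (mat_exp (t *\<^sub>R Gp) *v 1) \<le> a \<bullet> (mat_exp (t *\<^sub>R Cp) *v 1)"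
        by (simp add: dual_cone_def inner_diff_right)
    qed
  qed
  then show "((\<lambda>t. a \<bullet> (mat_exp (t *\<^sub>R Gp) *v 1)) \<longlongrightarrow> a \<bullet> 0) at_top" by simp
qed

lemmas Gp_decay = P.exp_tendsto_zero[OF Gp_pos Gp_decay_one]
lemmas Cp_decay = P.exp_tendsto_zero[OF Cp_pos p_decay]

lemma Cm_bounded: obtains B where "\<And>t. 0 \<le> t \<Longrightarrow> norm (mat_exp (t *\<^sub>R Cm)) \<le> B"
proof -
  obtain K where K: "0 < K" "\<And>M. cone_positive Zm Zm M \<Longrightarrow> 1 - M *v 1 \<in> dual_cone Zm \<Longrightarrow> norm M \<le> K"
    by (rule substochastic_norm_bound[OF N.total_orbits_axioms N.total_orbits_axioms]) (rule that)
  have "- (Cm *v 1) = Dmp *v 1" using m_one by (rule minus_unique)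
  then have one_minus: "1 - mat_exp (t *\<^sub>R Cm) *v 1 \<in> dual_cone Zm" if "0 \<le> t" for t
    using cone_positiveD[OF Dmp_pos P.one_dual] by (intro N.exp_one_le[OF Cm_pos _ that]) simp
  have "norm (mat_exp (t *\<^sub>R Cm)) \<le> K" if "0 \<le> t" for t
    by (intro K(2) exp_positiveD[OF Cm_pos] one_minus that)
  then show thesis by (rule that)
qed

text \<open>
  \<open>F k u\<close> and \<open>G k u\<close> are the expected positions at the first descent by \<open>u\<close>, from an upward or a
  downward start, restricted to fewer than \<open>k\<close> jumps. The level starts at the distance \<open>u\<close> from its target,
  increases during upward motion (hence the backward equation for \<open>F\<close>) and decreases during downward motion.
\<close>

primrec iterates :: "nat \<Rightarrow> (real \<Rightarrow> real^'m^'p) \<times> (real \<Rightarrow> real^'m^'m)" where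
  "iterates 0 = (\<lambda>_. 0, \<lambda>_. 0)"
| "iterates (Suc k) =
    (anticausal Gp (\<lambda>u. Bp ** fst (iterates k) u + Dpm ** snd (iterates k) u),
     causal Gm (\<lambda>u. Bm ** snd (iterates k) u + Dmp ** fst (iterates k) u))"

declare iterates.simps(2) [simp del]

abbreviation "F k \<equiv> fst (iterates k)"
abbreviation "G k \<equiv> snd (iterates k)"

text \<open>
  The nonnegative solutions of the system that the limit of the iterates satisfies; jumps within a sign
  have been absorbed into \<open>Cp\<close> and \<open>Cm\<close>.
\<close>

definition solution :: "(real \<Rightarrow> real^'p) \<Rightarrow> (real \<Rightarrow> real^'m) \<Rightarrow> bool" where
  "solution f g \<longleftrightarrow> (\<forall>u\<ge>0.
     (f has_vector_derivative - (Cp *v f u) - Dpm *v g u) (at u within {0..}) \<and>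
     (g has_vector_derivative Cm *v g u + Dmp *v f u) (at u within {0..}) \<and>
     f u \<in> dual_cone Zp \<and> g u \<in> dual_cone Zm)"

text \<open>
  The induction hypothesis on the iterates. The first two lines make the next iterate well defined. The last one
  is minimality, and applied to the constant solution it provides the boundedness of the next \<open>G\<close>.
\<close>

definition regular :: "nat \<Rightarrow> bool" where
  "regular k \<longleftrightarrow> continuous_on {0..} (F k) \<and> continuous_on {0..} (G k) \<and>
     bounded (F k ` {0..}) \<and> bounded (G k ` {0..}) \<and>
     (\<forall>u\<ge>0. cone_positive Zp Zm (F k u) \<and> cone_positive Zm Zm (G k u)) \<and>
     (\<forall>f g u. solution f g \<longrightarrow> 0 \<le> u \<longrightarrow>
        f u - F k u *v g 0 \<in> dual_cone Zp \<and> g u - G k u *v g 0 \<in> dual_cone Zm)"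

text \<open>
  This is conservation of mass: from either sign the process is somewhere after the next jump.
\<close>

lemma solution_one: "solution (\<lambda>_. 1) (\<lambda>_. 1)"
proof -
  have "- (Cp *v 1) - Dpm *v 1 = - (Cp *v 1 + Dpm *v 1)" by (simp add: algebra_simps)
  then have "- (Cp *v 1) - Dpm *v 1 = 0" "Cm *v 1 + Dmp *v 1 = 0" using p_one m_one by simp_all
  then show ?thesis by (simp add: solution_def)
qed

lemma iterate_derivs:
  assumes "regular k"
  shows F_deriv: "0 \<le> u \<Longrightarrow> (F (Suc k) has_vector_derivative
      - (Gp ** F (Suc k) u) - (Bp ** F k u + Dpm ** G k u)) (at u within {0..})"
    and G_deriv: "0 \<le> u \<Longrightarrow> (G (Suc k) has_vector_derivative
      Gm ** G (Suc k) u + (Bm ** G k u + Dmp ** F k u)) (at u within {0..})"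
    and F_bounded: "bounded (F (Suc k) ` {0..})"
proof -
  have c: "continuous_on {0..} (\<lambda>u. Bp ** F k u + Dpm ** G k u)" "continuous_on {0..} (\<lambda>u. Bm ** G k u + Dmp ** F k u)"
    using assms by (auto simp: regular_def intro!: continuous_intros mm.continuous_on)
  have "bounded ((\<lambda>u. Bp ** F k u + Dpm ** G k u) ` {0..})"
    using assms by (auto simp: regular_def intro!: bounded_plus_comp bounded_matrix_mult_image)
  then obtain H where H: "\<And>s. 0 \<le> s \<Longrightarrow> norm (Bp ** F k s + Dpm ** G k s) \<le> H" by (auto simp: bounded_iff)
  show "0 \<le> u \<Longrightarrow> (F (Suc k) has_vector_derivative
      - (Gp ** F (Suc k) u) - (Bp ** F k u + Dpm ** G k u)) (at u within {0..})"
    using anticausal_props(1)[OF Gp_decay c(1) H, of u] by (simp add: iterates.simps(2))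
  show "0 \<le> u \<Longrightarrow> (G (Suc k) has_vector_derivative
      Gm ** G (Suc k) u + (Bm ** G k u + Dmp ** F k u)) (at u within {0..})"
    using causal_deriv[OF c(2), of u Gm] by (simp add: iterates.simps(2))
  show "bounded (F (Suc k) ` {0..})"
    using anticausal_props(2)[OF Gp_decay c(1) H] by (auto simp: bounded_iff iterates.simps(2))
qed

lemma G_at_0 [simp]: "G (Suc k) 0 = mat 1" by (simp add: iterates.simps(2))

text \<open>
  The difference of a solution and the next iterate satisfies the equation of the iterate with nonnegative
  inhomogeneity, so the forward and backward positivity lemmas apply. The backward one needs the iterate \<open>F\<close>
  to be bounded, while nothing but nonnegativity is known of the solution.
\<close>

lemma regular: "regular k"
proof (induction k)
  case 0
  then show ?case
    by (auto simp: regular_def solution_def mv.zero_left intro: bounded_subset[OF bounded_insert[THEN iffD2, OF bounded_empty]])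
next
  case (Suc k)
  note D = F_deriv[OF Suc] G_deriv[OF Suc]
  have cp: "cone_positive Zp Zm (F k u)" "cone_positive Zm Zm (G k u)" if "0 \<le> u" for u
    using Suc that by (auto simp: regular_def)
  have pF: "cone_positive Zp Zm (F (Suc k) u)" if u: "0 \<le> u" for u
    unfolding cone_positive_def
  proof
    fix w assume w: "w \<in> dual_cone Zm"
    obtain K where K: "\<And>s. s \<in> {0..} \<Longrightarrow> F (Suc k) s *v w + K *\<^sub>R 1 \<in> dual_cone Zp"
      by (rule P.bounded_below_dual[OF bounded_matrix_vector_image[OF F_bounded[OF Suc]]]) (rule that)
    show "F (Suc k) u *v w \<in> dual_cone Zp"
    proof (rule P.exp_positive_backward[OF Gp_pos Gp_decay_one _ _ _ u])
      fix s :: real assume s: "0 \<le> s"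
      show "((\<lambda>u. F (Suc k) u *v w) has_vector_derivative
         - (Gp *v (F (Suc k) s *v w)) - (Bp *v (F k s *v w) + Dpm *v (G k s *v w))) (at s within {0..})"
        using mv_deriv[OF D(1)[OF s], of w]
        by (simp add: mv.diff_left mv.add_left mv.minus_left matrix_vector_mul_assoc)
      show "Bp *v (F k s *v w) + Dpm *v (G k s *v w) \<in> dual_cone Zp"
        by (intro dual_cone_add cone_positiveD[OF Bp_pos] cone_positiveD[OF Dpm_pos] cone_positiveD[OF cp(1)]
            cone_positiveD[OF cp(2)] w s)
      show "F (Suc k) s *v w + K *\<^sub>R 1 \<in> dual_cone Zp" using K s by auto
    qed
  qed
  have pG: "cone_positive Zm Zm (G (Suc k) u)" if u: "0 \<le> u" for u
    unfolding cone_positive_def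
  proof
    fix w assume w: "w \<in> dual_cone Zm"
    show "G (Suc k) u *v w \<in> dual_cone Zm"
    proof (rule N.exp_positive_forward[OF Gm_pos _ _ _ u])
      fix s :: real assume s: "0 \<le> s"
      show "((\<lambda>u. G (Suc k) u *v w) has_vector_derivative
         Gm *v (G (Suc k) s *v w) + (Bm *v (G k s *v w) + Dmp *v (F k s *v w))) (at s within {0..})"
        using mv_deriv[OF D(2)[OF s], of w]
        by (simp add: mv.diff_left mv.add_left mv.minus_left matrix_vector_mul_assoc)
      show "Bm *v (G k s *v w) + Dmp *v (F k s *v w) \<in> dual_cone Zm"
        by (intro dual_cone_add cone_positiveD[OF Bm_pos] cone_positiveD[OF Dmp_pos] cone_positiveD[OF cp(1)]
            cone_positiveD[OF cp(2)] w s)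
    qed (use w in simp)
  qed
  have cmp: "f u - F (Suc k) u *v g 0 \<in> dual_cone Zp \<and> g u - G (Suc k) u *v g 0 \<in> dual_cone Zm"
    if sol: "solution f g" and u: "0 \<le> u" for f g u
  proof
    have S: "(f has_vector_derivative - (Cp *v f u) - Dpm *v g u) (at u within {0..})"
       "(g has_vector_derivative Cm *v g u + Dmp *v f u) (at u within {0..})"
       "f u \<in> dual_cone Zp" if "0 \<le> u" for u using sol that by (auto simp: solution_def)
    have IH: "f u - F k u *v g 0 \<in> dual_cone Zp" "g u - G k u *v g 0 \<in> dual_cone Zm" if "0 \<le> u" for u
      using Suc sol that by (auto simp: regular_def)
    obtain K where K: "\<And>s. s \<in> {0..} \<Longrightarrow> - (F (Suc k) s *v g 0) + K *\<^sub>R 1 \<in> dual_cone Zp"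
    proof (rule P.bounded_below_dual[OF _ that])
      show "bounded ((\<lambda>s. - (F (Suc k) s *v g 0)) ` {0..})"
        using bounded_matrix_vector_image[OF F_bounded[OF Suc], of "g 0"]
        by (simp only: bounded_uminus[symmetric, of "(\<lambda>s. - (F (Suc k) s *v g 0)) ` {0..}"] image_image minus_minus)
    qed
    show "f u - F (Suc k) u *v g 0 \<in> dual_cone Zp"
    proof (rule P.exp_positive_backward[OF Gp_pos Gp_decay_one _ _ _ u])
      fix s :: real assume s: "0 \<le> s"
      have "((\<lambda>u. f u - F (Suc k) u *v g 0) has_vector_derivative
         (- (Cp *v f s) - Dpm *v g s) - (- (Gp ** F (Suc k) s) - (Bp ** F k s + Dpm ** G k s)) *v g 0) (at s within {0..})"
        by (intro has_vector_derivative_diff S mv_deriv D s)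
      then show "((\<lambda>u. f u - F (Suc k) u *v g 0) has_vector_derivative
         - (Gp *v (f s - F (Suc k) s *v g 0)) -
           (Bp *v (f s - F k s *v g 0) + Dpm *v (g s - G k s *v g 0))) (at s within {0..})"
        by (simp add: mv.diff_left mv.add_left mv.minus_left mv.diff_right matrix_vector_mul_assoc algebra_simps)
      show "Bp *v (f s - F k s *v g 0) + Dpm *v (g s - G k s *v g 0) \<in> dual_cone Zp"
        by (intro dual_cone_add cone_positiveD[OF Bp_pos] cone_positiveD[OF Dpm_pos] IH s)
      show "f s - F (Suc k) s *v g 0 + K *\<^sub>R 1 \<in> dual_cone Zp"
        using dual_cone_add[OF S(3)[OF s] K[of s]] s by (simp add: algebra_simps)
    qed
    show "g u - G (Suc k) u *v g 0 \<in> dual_cone Zm"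
    proof (rule N.exp_positive_forward[OF Gm_pos _ _ _ u])
      fix s :: real assume s: "0 \<le> s"
      have "((\<lambda>u. g u - G (Suc k) u *v g 0) has_vector_derivative
         (Cm *v g s + Dmp *v f s) - (Gm ** G (Suc k) s + (Bm ** G k s + Dmp ** F k s)) *v g 0) (at s within {0..})"
        by (intro has_vector_derivative_diff S mv_deriv D s)
      then show "((\<lambda>u. g u - G (Suc k) u *v g 0) has_vector_derivative
         Gm *v (g s - G (Suc k) s *v g 0) +
           (Bm *v (g s - G k s *v g 0) + Dmp *v (f s - F k s *v g 0))) (at s within {0..})"
        by (simp add: mv.diff_left mv.add_left mv.minus_left mv.diff_right matrix_vector_mul_assoc algebra_simps)
      show "Bm *v (g s - G k s *v g 0) + Dmp *v (f s - F k s *v g 0) \<in> dual_cone Zm"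
        by (intro dual_cone_add cone_positiveD[OF Bm_pos] cone_positiveD[OF Dmp_pos] IH s)
    qed (simp add: G_at_0)
  qed
  obtain K where K: "0 < K" "\<And>M. cone_positive Zm Zm M \<Longrightarrow> 1 - M *v 1 \<in> dual_cone Zm \<Longrightarrow> norm M \<le> K"
    by (rule substochastic_norm_bound[OF N.total_orbits_axioms N.total_orbits_axioms]) (rule that)
  have bG: "bounded (G (Suc k) ` {0..})"
    unfolding bounded_iff using pG cmp[OF solution_one] K(2) by (intro exI[of _ K]) auto
  have cont: "continuous_on {0..} (F (Suc k))" "continuous_on {0..} (G (Suc k))"
    using D by (auto intro!: continuous_on_vector_derivative)
  show ?case
    unfolding regular_def using cont bG F_bounded[OF Suc] pF pG cmp by simp
qed

end

section \<open>The first return matrix\<close>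

lemma cone_positive_lim:
  assumes "M \<longlonglongrightarrow> L" "\<And>k. cone_positive Z Z' (M k)" shows "cone_positive Z Z' L"
  unfolding cone_positive_def
proof
  fix w assume w: "w \<in> dual_cone Z'"
  show "L *v w \<in> dual_cone Z"
    by (rule dual_cone_lim[OF mv.tendsto[OF assms(1) tendsto_const] always_eventually trivial_limit_sequentially])
       (use w assms(2) in \<open>auto simp: cone_positive_def\<close>)
qed

lemma norm_matrix_mult_le:
  fixes A :: "real^'n^'m" and B :: "real^'k^'n"
  shows "norm (A ** B) \<le> onorm ((**) A :: real^'k^'n \<Rightarrow> _) * norm B"
  by (rule onorm[OF mm.bounded_linear_right])

lemma onorm_matrix_mult_mono:
  fixes A :: "real^'n^'m" and B :: "real^'k^'n"
  assumes "norm B \<le> b" shows "norm (A ** B) \<le> onorm ((**) A :: real^'k^'n \<Rightarrow> _) * b"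
  by (rule order_trans[OF norm_matrix_mult_le mult_left_mono[OF assms onorm_pos_le[OF mm.bounded_linear_right]]])

lemma (in total_orbits) convergent_matrix_monotone:
  fixes M :: "nat \<Rightarrow> real^'k^'n"
  assumes W: "total_orbits Z'" and mono: "\<And>k. cone_positive Z Z' (M (Suc k) - M k)"
    and ub: "\<And>k. cone_positive Z Z' (B - M k)"
  shows "convergent M"
proof (rule total_orbits.convergent_matrix_dual[OF W])
  fix w assume w: "w \<in> dual_cone Z'"
  show "convergent (\<lambda>k. M k *v w)"
  proof (rule convergent_monotone_cone)
    show "M (Suc k) *v w - M k *v w \<in> dual_cone Z" for k
      using cone_positiveD[OF mono w, of k] by (simp add: mv.diff_left)
    show "B *v w - M k *v w \<in> dual_cone Z" for k
      using cone_positiveD[OF ub w, of k] by (simp add: mv.diff_left)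
  qed
qed

context fluid_data
begin

lemma iterate_pos:
  assumes "0 \<le> u" shows F_pos: "cone_positive Zp Zm (F k u)" and G_pos: "cone_positive Zm Zm (G k u)"
  using regular[of k] assms by (auto simp: regular_def)

lemma comparison:
  assumes "solution f g" "0 \<le> u"
  shows "f u - F k u *v g 0 \<in> dual_cone Zp" and "g u - G k u *v g 0 \<in> dual_cone Zm"
  using regular[of k] assms by (auto simp: regular_def)

lemma iterates_mono:
  "0 \<le> u \<Longrightarrow> cone_positive Zp Zm (F (Suc k) u - F k u) \<and> cone_positive Zm Zm (G (Suc k) u - G k u)"
proof (induction k arbitrary: u)
  case 0
  then show ?case using iterate_pos[of u "Suc 0"] by (simp)
next
  case (Suc k)
  note D = F_deriv[OF regular[of k]] G_deriv[OF regular[of k]] F_deriv[OF regular[of "Suc k"]] G_deriv[OF regular[of "Suc k"]]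
  have IH: "F (Suc k) s *v w - F k s *v w \<in> dual_cone Zp" "G (Suc k) s *v w - G k s *v w \<in> dual_cone Zm"
    if "0 \<le> s" "w \<in> dual_cone Zm" for s w
    using Suc.IH[OF that(1)] that(2) by (auto simp: cone_positive_def mv.diff_left)
  show ?case unfolding cone_positive_def
  proof (intro conjI ballI)
    fix w assume w: "w \<in> dual_cone Zm"
    have "bounded ((\<lambda>s. F (Suc (Suc k)) s - F (Suc k) s) ` {0..})"
      by (rule bounded_minus_comp[OF F_bounded[OF regular[of "Suc k"]] F_bounded[OF regular[of k]]])
    from bounded_matrix_vector_image[OF this, of w]
    obtain K where K: "\<And>s. s \<in> {0..} \<Longrightarrow> (F (Suc (Suc k)) s - F (Suc k) s) *v w + K *\<^sub>R 1 \<in> dual_cone Zp"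
      by (rule P.bounded_below_dual) (rule that)
    show "(F (Suc (Suc k)) u - F (Suc k) u) *v w \<in> dual_cone Zp"
    proof (rule P.exp_positive_backward[OF Gp_pos Gp_decay_one _ _ _ Suc.prems])
      fix s :: real assume s: "0 \<le> s"
      show "((\<lambda>u. (F (Suc (Suc k)) u - F (Suc k) u) *v w) has_vector_derivative
         - (Gp *v ((F (Suc (Suc k)) s - F (Suc k) s) *v w)) -
           (Bp *v (F (Suc k) s *v w - F k s *v w) + Dpm *v (G (Suc k) s *v w - G k s *v w))) (at s within {0..})"
        using mv_deriv[OF has_vector_derivative_diff[OF D(3)[OF s] D(1)[OF s]], of w]
        by (simp add: mv.diff_left mv.add_left mv.minus_left mv.diff_right matrix_vector_mul_assoc algebra_simps)
      show "Bp *v (F (Suc k) s *v w - F k s *v w) + Dpm *v (G (Suc k) s *v w - G k s *v w) \<in> dual_cone Zp"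
        by (intro dual_cone_add cone_positiveD[OF Bp_pos] cone_positiveD[OF Dpm_pos] IH s w)
      show "(F (Suc (Suc k)) s - F (Suc k) s) *v w + K *\<^sub>R 1 \<in> dual_cone Zp" using K s by auto
    qed
    show "(G (Suc (Suc k)) u - G (Suc k) u) *v w \<in> dual_cone Zm"
    proof (rule N.exp_positive_forward[OF Gm_pos _ _ _ Suc.prems])
      fix s :: real assume s: "0 \<le> s"
      show "((\<lambda>u. (G (Suc (Suc k)) u - G (Suc k) u) *v w) has_vector_derivative
         Gm *v ((G (Suc (Suc k)) s - G (Suc k) s) *v w) +
           (Bm *v (G (Suc k) s *v w - G k s *v w) + Dmp *v (F (Suc k) s *v w - F k s *v w))) (at s within {0..})"
        using mv_deriv[OF has_vector_derivative_diff[OF D(4)[OF s] D(2)[OF s]], of w]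
        by (simp add: mv.diff_left mv.add_left mv.minus_left mv.diff_right matrix_vector_mul_assoc algebra_simps)
      show "Bm *v (G (Suc k) s *v w - G k s *v w) + Dmp *v (F (Suc k) s *v w - F k s *v w) \<in> dual_cone Zm"
        by (intro dual_cone_add cone_positiveD[OF Bm_pos] cone_positiveD[OF Dmp_pos] IH s w)
    qed (simp add: G_at_0)
  qed
qed

definition "F_lim u = lim (\<lambda>k. F k u)"
definition "G_lim u = lim (\<lambda>k. G k u)"

lemma iterate_upper:
  assumes "0 \<le> u" "w \<in> dual_cone Zm" "c *\<^sub>R 1 - w \<in> dual_cone Zm"
  shows "c *\<^sub>R 1 - F k u *v w \<in> dual_cone Zp" "c *\<^sub>R 1 - G k u *v w \<in> dual_cone Zm"
proof -
  obtain b where b: "b \<in> Zm" using N.nonempty by auto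
  have "0 \<le> c"
    using assms(2,3) b by (force simp: dual_cone_def inner_diff_right N.one)
  then have "c *\<^sub>R (1 - F k u *v 1) + F k u *v (c *\<^sub>R 1 - w) \<in> dual_cone Zp"
     "c *\<^sub>R (1 - G k u *v 1) + G k u *v (c *\<^sub>R 1 - w) \<in> dual_cone Zm"
    using comparison[OF solution_one assms(1)]
    by (intro dual_cone_add dual_cone_scaleR cone_positiveD[OF F_pos] cone_positiveD[OF G_pos] assms; simp)+
  then show "c *\<^sub>R 1 - F k u *v w \<in> dual_cone Zp" "c *\<^sub>R 1 - G k u *v w \<in> dual_cone Zm"
    by (simp_all add: mv.diff_right mv.scaleR_right scaleR_diff_right)
qed

lemma iterates_lim:
  assumes u: "0 \<le> u"
  shows F_tendsto: "(\<lambda>k. F k u) \<longlonglongrightarrow> F_lim u" and G_tendsto: "(\<lambda>k. G k u) \<longlonglongrightarrow> G_lim u"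
proof -
  have "convergent (\<lambda>k. F k u *v w) \<and> convergent (\<lambda>k. G k u *v w)" if w: "w \<in> dual_cone Zm" for w
  proof -
    obtain c where c: "0 \<le> c" "c *\<^sub>R 1 - w \<in> dual_cone Zm" by (rule N.dual_decompose) (rule that)
    have "F (Suc k) u *v w - F k u *v w \<in> dual_cone Zp" "G (Suc k) u *v w - G k u *v w \<in> dual_cone Zm" for k
      using iterates_mono[OF u, of k] w by (simp_all add: cone_positive_def flip: mv.diff_left)
    then show ?thesis
      using P.convergent_monotone_cone[of "\<lambda>k. F k u *v w", OF _ iterate_upper(1)[OF u w c(2)]]
        N.convergent_monotone_cone[of "\<lambda>k. G k u *v w", OF _ iterate_upper(2)[OF u w c(2)]] by blast
  qed
  then have "convergent (\<lambda>k. F k u)" "convergent (\<lambda>k. G k u)"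
    by (auto intro!: N.convergent_matrix_dual)
  then show "(\<lambda>k. F k u) \<longlonglongrightarrow> F_lim u" "(\<lambda>k. G k u) \<longlonglongrightarrow> G_lim u"
    by (simp_all add: F_lim_def G_lim_def convergent_LIMSEQ_iff)
qed

lemma limit_pos:
  assumes "0 \<le> u" shows F_lim_pos: "cone_positive Zp Zm (F_lim u)" and G_lim_pos: "cone_positive Zm Zm (G_lim u)"
  using cone_positive_lim[OF F_tendsto[OF assms]] cone_positive_lim[OF G_tendsto[OF assms]] iterate_pos[OF assms] by auto

lemma limit_le:
  assumes "solution f g" "0 \<le> u"
  shows "f u - F_lim u *v g 0 \<in> dual_cone Zp" and "g u - G_lim u *v g 0 \<in> dual_cone Zm"
proof -
  have 1: "(\<lambda>k. f u - F k u *v g 0) \<longlonglongrightarrow> f u - F_lim u *v g 0"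
    and 2: "(\<lambda>k. g u - G k u *v g 0) \<longlonglongrightarrow> g u - G_lim u *v g 0"
    by (intro tendsto_intros mv.tendsto F_tendsto G_tendsto assms)+
  show "f u - F_lim u *v g 0 \<in> dual_cone Zp" "g u - G_lim u *v g 0 \<in> dual_cone Zm"
    by (rule dual_cone_lim[OF 1 always_eventually trivial_limit_sequentially], use comparison[OF assms] in blast)
       (rule dual_cone_lim[OF 2 always_eventually trivial_limit_sequentially], use comparison[OF assms] in blast)
qed

lemma G_lim_0: "G_lim 0 = mat 1"
proof -
  have "(\<lambda>k. G (Suc k) 0) \<longlonglongrightarrow> G_lim 0" by (rule LIMSEQ_Suc[OF G_tendsto]) simp
  moreover have "(\<lambda>k. G (Suc k) 0) = (\<lambda>k. mat 1)" by (simp only: G_at_0)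
  ultimately show ?thesis by (simp add: LIMSEQ_const_iff)
qed

lemma limit_derivs:
  assumes u: "0 \<le> u"
  shows "(F_lim has_vector_derivative - (Cp ** F_lim u) - Dpm ** G_lim u) (at u within {0..})"
    and "(G_lim has_vector_derivative Cm ** G_lim u + Dmp ** F_lim u) (at u within {0..})"
proof -
  obtain KF where KF: "0 < KF" "\<And>M. cone_positive Zp Zm M \<Longrightarrow> 1 - M *v 1 \<in> dual_cone Zp \<Longrightarrow> norm M \<le> KF"
    by (rule substochastic_norm_bound[OF P.total_orbits_axioms N.total_orbits_axioms]) (rule that)
  obtain KG where KG: "0 < KG" "\<And>M. cone_positive Zm Zm M \<Longrightarrow> 1 - M *v 1 \<in> dual_cone Zm \<Longrightarrow> norm M \<le> KG"
    by (rule substochastic_norm_bound[OF N.total_orbits_axioms N.total_orbits_axioms]) (rule that)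
  have nF: "norm (F k u) \<le> KF" and nG: "norm (G k u) \<le> KG" if "0 \<le> u" for k u
    using KF(2)[OF F_pos[OF that] comparison(1)[OF solution_one that]]
      KG(2)[OF G_pos[OF that] comparison(2)[OF solution_one that]] by auto
  have cl: "continuous_on {0..} (\<lambda>u. - (Gp ** F_lim u) - (Bp ** F_lim u + Dpm ** G_lim u))"
    "continuous_on {0..} (\<lambda>u. Gm ** G_lim u + (Bm ** G_lim u + Dmp ** F_lim u))"
    if "continuous_on {0..} F_lim" "continuous_on {0..} G_lim"
    by (intro continuous_intros mm.continuous_on that)+
  define k1 where "k1 = onorm ((**) Gp :: real^'m^'p \<Rightarrow> _) * KF + (onorm ((**) Bp :: real^'m^'p \<Rightarrow> _) * KF + onorm ((**) Dpm :: real^'m^'m \<Rightarrow> _) * KG)"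
  define k2 where "k2 = onorm ((**) Gm :: real^'m^'m \<Rightarrow> _) * KG + (onorm ((**) Bm :: real^'m^'m \<Rightarrow> _) * KG + onorm ((**) Dmp :: real^'m^'p \<Rightarrow> _) * KF)"
  have b1: "norm (- (Gp ** F (Suc k) u) - (Bp ** F k u + Dpm ** G k u)) \<le> k1" if "0 \<le> u" for k u
    unfolding k1_def using nF[OF that] nG[OF that]
    by (intro order_trans[OF norm_triangle_ineq4] add_mono order_trans[OF norm_triangle_ineq]) 
       (auto intro!: onorm_matrix_mult_mono)
  have b2: "norm (Gm ** G (Suc k) u + (Bm ** G k u + Dmp ** F k u)) \<le> k2" if "0 \<le> u" for k u
    unfolding k2_def using nF[OF that] nG[OF that]
    by (intro order_trans[OF norm_triangle_ineq] add_mono) 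
       (auto intro!: onorm_matrix_mult_mono)
  have lip: "continuous_on {0..} F_lim" "continuous_on {0..} G_lim"
    by (rule continuous_on_limit_bounded_derivative[OF F_deriv[OF regular] b1 LIMSEQ_Suc[OF F_tendsto]]; assumption)
       (rule continuous_on_limit_bounded_derivative[OF G_deriv[OF regular] b2 LIMSEQ_Suc[OF G_tendsto]]; assumption)
  have "(F_lim has_vector_derivative - (Gp ** F_lim u) - (Bp ** F_lim u + Dpm ** G_lim u)) (at u within {0..})"
    by (rule has_vector_derivative_limit[OF F_deriv[OF regular] b1 _ _ cl(1)[OF lip] u])
       (auto intro!: LIMSEQ_Suc tendsto_intros mm.tendsto F_tendsto G_tendsto)
  then show "(F_lim has_vector_derivative - (Cp ** F_lim u) - Dpm ** G_lim u) (at u within {0..})"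
    by (simp only: mm.add_left diff_conv_add_uminus minus_add_distrib add_ac)
  have "(G_lim has_vector_derivative Gm ** G_lim u + (Bm ** G_lim u + Dmp ** F_lim u)) (at u within {0..})"
    by (rule has_vector_derivative_limit[OF G_deriv[OF regular] b2 _ _ cl(2)[OF lip] u])
       (auto intro!: LIMSEQ_Suc tendsto_intros mm.tendsto F_tendsto G_tendsto)
  then show "(G_lim has_vector_derivative Cm ** G_lim u + Dmp ** F_lim u) (at u within {0..})"
    by (simp add: mm.add_left algebra_simps)
qed

text \<open>
  The system is autonomous, and shifting changes the initial value \<open>g 0\<close> from \<open>w\<close> to \<open>G_lim v *v w\<close>.
\<close>

lemma limit_solution:
  assumes v: "0 \<le> v" and w: "w \<in> dual_cone Zm"
  shows "solution (\<lambda>u. F_lim (u + v) *v w) (\<lambda>u. G_lim (u + v) *v w)"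
  unfolding solution_def
proof safe
  fix u :: real assume u: "0 \<le> u"
  have shift: "((\<lambda>u. f (u + v)) has_vector_derivative d) (at u within {0..})"
    if "(f has_vector_derivative d) (at (u + v) within {0..})" for f :: "real \<Rightarrow> real^'a^'b" and d
  proof -
    have "(f has_vector_derivative d) (at (u + v) within (\<lambda>u. u + v) ` {0..})"
      by (rule has_vector_derivative_within_subset[OF that]) (use v in auto)
    moreover have "((\<lambda>u. u + v) has_vector_derivative 1) (at u within {0..})"
      by (auto intro!: derivative_eq_intros)
    ultimately show ?thesis
      using vector_diff_chain_within[of "\<lambda>u. u + v" 1 u "{0..}" f d] by (simp add: o_def)
  qed
  show "((\<lambda>u. F_lim (u + v) *v w) has_vector_derivative
      - (Cp *v (F_lim (u + v) *v w)) - Dpm *v (G_lim (u + v) *v w)) (at u within {0..})"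
    using mv_deriv[OF shift[OF limit_derivs(1)], of w] u v
    by (simp add: mv.diff_left mv.minus_left matrix_vector_mul_assoc)
  show "((\<lambda>u. G_lim (u + v) *v w) has_vector_derivative
      Cm *v (G_lim (u + v) *v w) + Dmp *v (F_lim (u + v) *v w)) (at u within {0..})"
    using mv_deriv[OF shift[OF limit_derivs(2)], of w] u v
    by (simp add: mv.add_left matrix_vector_mul_assoc)
  show "F_lim (u + v) *v w \<in> dual_cone Zp" "G_lim (u + v) *v w \<in> dual_cone Zm"
    using u v w by (auto intro!: cone_positiveD[OF F_lim_pos] cone_positiveD[OF G_lim_pos])
qed

definition "Phi = F_lim 0"

lemma Phi_pos: "cone_positive Zp Zm Phi"
  unfolding Phi_def by (rule F_lim_pos) simp

text \<open>
  Minimality, applied to the shifted solution, gives one half of the strong Markov property at the first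
  return: to descend by \<open>v\<close>, it suffices to return to the initial level and then to descend by \<open>v\<close>.
\<close>

lemma F_lim_ge:
  assumes "0 \<le> v" "w \<in> dual_cone Zm"
  shows "F_lim v *v w - Phi *v (G_lim v *v w) \<in> dual_cone Zp"
  using limit_le(1)[OF limit_solution[OF assms], of 0] by (simp add: Phi_def)

text \<open>
  The two sides of the preceding inequality agree at \<open>v = 0\<close>, so the derivative of their difference at \<open>0\<close> is
  nonnegative. That derivative is the negative of the Riccati expression.
\<close>

lemma Phi_supersolution:
  "cone_positive Zp Zm (- (Cp ** Phi + Phi ** Cm + Dpm + Phi ** Dmp ** Phi))"
  unfolding cone_positive_def
proof
  fix w assume w: "w \<in> dual_cone Zm"
  let ?e = "\<lambda>v. F_lim v *v w - Phi *v (G_lim v *v w)"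
  have "(?e has_vector_derivative (- (Cp ** F_lim 0) - Dpm ** G_lim 0) *v w -
      Phi *v ((Cm ** G_lim 0 + Dmp ** F_lim 0) *v w)) (at 0 within {0..})"
    by (intro has_vector_derivative_diff mv_deriv limit_derivs
        bounded_linear.has_vector_derivative[OF mv.bounded_linear_right]) simp_all
  moreover have "(- (Cp ** F_lim 0) - Dpm ** G_lim 0) *v w - Phi *v ((Cm ** G_lim 0 + Dmp ** F_lim 0) *v w) =
      - (Cp ** Phi + Phi ** Cm + Dpm + Phi ** Dmp ** Phi) *v w"
    by (simp only: G_lim_0 Phi_def[symmetric] mm.add_left mm.add_right mv.add_left mv.diff_left mv.minus_left mv.add_right
        matrix_vector_mul_assoc matrix_mul_assoc matrix_mul_rid diff_conv_add_uminus minus_add_distrib add_ac)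
  ultimately have "(?e has_vector_derivative - (Cp ** Phi + Phi ** Cm + Dpm + Phi ** Dmp ** Phi) *v w) (at 0 within {0..})"
    by simp
  then show "- (Cp ** Phi + Phi ** Cm + Dpm + Phi ** Dmp ** Phi) *v w \<in> dual_cone Zp"
    by (rule P.deriv_dual) (use w F_lim_ge in \<open>simp_all add: G_lim_0 flip: Phi_def\<close>)
qed

text \<open>
  \<open>mat_exp (y *\<^sub>R Cp) ** M ** mat_exp (y *\<^sub>R Cm)\<close> decreases in \<open>y\<close> and tends to zero.
\<close>

lemma sylvester_positive:
  assumes "cone_positive Zp Zm (- (Cp ** M + M ** Cm))"
  shows "cone_positive Zp Zm M"
  unfolding cone_positive_def
proof
  fix w assume w: "w \<in> dual_cone Zm"
  let ?q = "\<lambda>y. mat_exp (y *\<^sub>R Cp) ** M ** mat_exp (y *\<^sub>R Cm)"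
  let ?R = "- (Cp ** M + M ** Cm)"
  have D: "((\<lambda>y. - (?q y *v w)) has_vector_derivative (mat_exp (y *\<^sub>R Cp) ** ?R ** mat_exp (y *\<^sub>R Cm)) *v w) (at y within S)" for y S
  proof -
    have "(?q has_vector_derivative (mat_exp (y *\<^sub>R Cp) ** M) ** (Cm ** mat_exp (y *\<^sub>R Cm)) +
       (mat_exp (y *\<^sub>R Cp) ** 0 + (mat_exp (y *\<^sub>R Cp) ** Cp) ** M) ** mat_exp (y *\<^sub>R Cm)) (at y within S)"
      by (intro mm.has_vector_derivative mat_exp_deriv mat_exp_deriv_left has_vector_derivative_const)
    from has_vector_derivative_minus[OF mv_deriv[OF this, of w]] show ?thesis
      by (simp only: mm.add_left mm.add_right mm.zero_right mm.zero_left mm.minus_left mm.minus_right mv.add_left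
          mv.minus_left matrix_mul_assoc minus_add_distrib add_0_left add_0_right add_ac)
  qed
  have L: "M *v w - ?q L *v w \<in> dual_cone Zp" if "0 \<le> L" for L
  proof -
    have "- (?q L *v w) - - (?q 0 *v w) \<in> dual_cone Zp"
    proof (rule mean_value_dual_cone[OF D _ that])
      fix s :: real assume "0 \<le> s"
      then have "cone_positive Zp Zm (mat_exp (s *\<^sub>R Cp) ** ?R ** mat_exp (s *\<^sub>R Cm))"
        by (intro cone_positive_mult[where Z'=Zm] cone_positive_mult[where Z'=Zp] exp_positiveD[OF Cp_pos] exp_positiveD[OF Cm_pos] assms)
      then show "(mat_exp (s *\<^sub>R Cp) ** ?R ** mat_exp (s *\<^sub>R Cm)) *v w \<in> dual_cone Zp"
        using w by (rule cone_positiveD)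
    qed
    then show ?thesis by simp
  qed
  obtain B where B: "\<And>t. 0 \<le> t \<Longrightarrow> norm (mat_exp (t *\<^sub>R Cm)) \<le> B" by (rule Cm_bounded) (rule that)
  have "Zfun (\<lambda>L. mat_exp (L *\<^sub>R Cp) ** M) at_top"
    using mm.tendsto[OF Cp_decay tendsto_const, of M] by (simp add: tendsto_Zfun_iff mm.zero_left)
  moreover have "Bfun (\<lambda>L. mat_exp (L *\<^sub>R Cm)) at_top"
    by (rule BfunI[of _ B]) (use B in \<open>auto intro: eventually_at_top_linorderI[of 0]\<close>)
  ultimately have "(?q \<longlongrightarrow> 0) at_top"
    using mm.Zfun_prod_Bfun by (auto simp: tendsto_Zfun_iff)
  from tendsto_diff[OF tendsto_const mv.tendsto[OF this tendsto_const]]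
  have "((\<lambda>L. M *v w - ?q L *v w) \<longlongrightarrow> M *v w - 0 *v w) at_top" .
  from dual_cone_lim[OF this eventually_at_top_linorderI[OF L] trivial_limit_at_top_linorder]
  show "M *v w \<in> dual_cone Zp" by (simp add: mv.zero_left)
qed

primrec psi_iter :: "nat \<Rightarrow> real^'m^'p" where
  "psi_iter 0 = 0"
| "psi_iter (Suc n) =
     (LBINT y:{0..}. mat_exp (y *\<^sub>R Cp) ** (Dpm + psi_iter n ** Dmp ** psi_iter n) ** mat_exp (y *\<^sub>R Cm))"

lemma psi_iter_eq:
  "Cp ** psi_iter (Suc n) + psi_iter (Suc n) ** Cm + (Dpm + psi_iter n ** Dmp ** psi_iter n) = 0"
proof -
  obtain B where B: "\<And>t. 0 \<le> t \<Longrightarrow> norm (mat_exp (t *\<^sub>R Cm)) \<le> B" by (rule Cm_bounded) (rule that)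
  show ?thesis unfolding psi_iter.simps by (rule sylvester_integral[OF Cp_decay B])
qed

lemma psi_iter_eq': "- (Cp ** psi_iter (Suc n) + psi_iter (Suc n) ** Cm) = Dpm + psi_iter n ** Dmp ** psi_iter n"
  using psi_iter_eq[of n] by (rule minus_unique)

lemma quadratic_diff:
  "M ** Dmp ** M - N ** Dmp ** N = (M - N) ** Dmp ** M + N ** Dmp ** (M - N)"
  by (simp add: mm.diff_left mm.diff_right matrix_mul_assoc)

lemma psi_iter_pos: "cone_positive Zp Zm (psi_iter n)"
proof (induction n)
  case (Suc n)
  have "cone_positive Zp Zm (Dpm + psi_iter n ** Dmp ** psi_iter n)"
    by (intro cone_positive_add Dpm_pos cone_positive_mult[OF cone_positive_mult[OF Suc Dmp_pos] Suc])
  then have "cone_positive Zp Zm (- (Cp ** psi_iter (Suc n) + psi_iter (Suc n) ** Cm))"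
    by (subst psi_iter_eq')
  then show ?case by (rule sylvester_positive)
qed simp

lemma quadratic_mono:
  assumes "cone_positive Zp Zm N" "cone_positive Zp Zm M" "cone_positive Zp Zm (M - N)"
  shows "cone_positive Zp Zm (M ** Dmp ** M - N ** Dmp ** N)"
  unfolding quadratic_diff
  by (intro cone_positive_add cone_positive_mult[OF cone_positive_mult[OF _ Dmp_pos]] assms)

lemma sylvester_diff:
  "- (Cp ** (M - N) + (M - N) ** Cm) = - (Cp ** M + M ** Cm) - - (Cp ** N + N ** Cm)"
proof -
  have "- (a - b + (c - d)) = - (a + c) - - (b + d)" for a b c d :: "real^'m^'p" by simp
  then show ?thesis by (simp only: mm.diff_left mm.diff_right)
qed

text \<open>
  Monotonicity and the bound by \<open>Phi\<close> are both inherited along the iteration, because the quadratic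
  term is monotone on positive matrices and the solution of a Sylvester equation depends monotonically on its
  right-hand side.
\<close>

lemma psi_iter_mono: "cone_positive Zp Zm (psi_iter (Suc n) - psi_iter n)"
proof (induction n)
  case 0
  then show ?case using psi_iter_pos[of "Suc 0"] by (simp del: psi_iter.simps(2))
next
  case (Suc n)
  have "- (Cp ** (psi_iter (Suc (Suc n)) - psi_iter (Suc n)) + (psi_iter (Suc (Suc n)) - psi_iter (Suc n)) ** Cm) =
      - (Cp ** psi_iter (Suc (Suc n)) + psi_iter (Suc (Suc n)) ** Cm) - - (Cp ** psi_iter (Suc n) + psi_iter (Suc n) ** Cm)"
    by (rule sylvester_diff)
  also have "\<dots> = psi_iter (Suc n) ** Dmp ** psi_iter (Suc n) - psi_iter n ** Dmp ** psi_iter n"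
    by (simp only: psi_iter_eq' add_diff_cancel_left)
  finally have "- (Cp ** (psi_iter (Suc (Suc n)) - psi_iter (Suc n)) + (psi_iter (Suc (Suc n)) - psi_iter (Suc n)) ** Cm) = \<dots>" .
  with quadratic_mono[OF psi_iter_pos psi_iter_pos Suc] show ?case
    by (metis sylvester_positive)
qed

lemma psi_iter_le_Phi: "cone_positive Zp Zm (Phi - psi_iter n)"
proof (induction n)
  case (Suc n)
  have "- (Cp ** (Phi - psi_iter (Suc n)) + (Phi - psi_iter (Suc n)) ** Cm) =
      - (Cp ** Phi + Phi ** Cm) - - (Cp ** psi_iter (Suc n) + psi_iter (Suc n) ** Cm)"
    by (rule sylvester_diff)
  also have "\<dots> = - (Cp ** Phi + Phi ** Cm + Dpm + Phi ** Dmp ** Phi) + (Phi ** Dmp ** Phi - psi_iter n ** Dmp ** psi_iter n)"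
  proof -
    have "- a - (d + q) = - (a + d + p) + (p - q)" for a d p q :: "real^'m^'p" by simp
    then show ?thesis by (simp only: psi_iter_eq')
  qed
  finally have "- (Cp ** (Phi - psi_iter (Suc n)) + (Phi - psi_iter (Suc n)) ** Cm) = \<dots>" .
  with cone_positive_add[OF Phi_supersolution quadratic_mono[OF psi_iter_pos Phi_pos Suc]] show ?case
    by (metis sylvester_positive)
qed (simp add: Phi_pos)

definition "psi = lim psi_iter"

lemma psi_tendsto: "psi_iter \<longlonglongrightarrow> psi"
  using P.convergent_matrix_monotone[of Zm psi_iter Phi, OF N.total_orbits_axioms psi_iter_mono psi_iter_le_Phi]
  by (simp add: psi_def convergent_LIMSEQ_iff)

lemma psi_pos: "cone_positive Zp Zm psi"
  by (rule cone_positive_lim[OF psi_tendsto psi_iter_pos])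

lemma psi_riccati: "Cp ** psi + psi ** Cm + (Dpm + psi ** Dmp ** psi) = 0"
proof -
  have "(\<lambda>n. Cp ** psi_iter (Suc n) + psi_iter (Suc n) ** Cm + (Dpm + psi_iter n ** Dmp ** psi_iter n))
      \<longlonglongrightarrow> Cp ** psi + psi ** Cm + (Dpm + psi ** Dmp ** psi)"
    by (intro tendsto_intros mm.tendsto LIMSEQ_Suc[OF psi_tendsto] psi_tendsto)
  then show ?thesis by (simp only: psi_iter_eq LIMSEQ_const_iff)
qed

definition "U = Cm + Dmp ** psi"

lemma U_vec: "U *v x = Cm *v x + Dmp *v (psi *v x)"
  by (simp only: U_def mv.add_left matrix_vector_mul_assoc)

lemma U_pos: "exp_positive Zm U"
  unfolding U_def by (rule N.exp_positive_add[OF Cm_pos cone_positive_mult[OF Dmp_pos psi_pos]])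

text \<open>
  The Riccati equation is exactly what makes the invariant graph \<open>f = psi g\<close> consistent with the system.
\<close>

lemma psi_solution:
  assumes w: "w \<in> dual_cone Zm"
  shows "solution (\<lambda>u. psi *v (mat_exp (u *\<^sub>R U) *v w)) (\<lambda>u. mat_exp (u *\<^sub>R U) *v w)"
  unfolding solution_def
proof safe
  fix u :: real assume u: "0 \<le> u"
  let ?E = "mat_exp (u *\<^sub>R U) *v w"
  have d: "((\<lambda>u. mat_exp (u *\<^sub>R U) *v w) has_vector_derivative U *v ?E) (at u within {0..})"
    using mv_deriv[OF mat_exp_deriv, of U w] by (simp add: matrix_vector_mul_assoc)
  then show "((\<lambda>u. mat_exp (u *\<^sub>R U) *v w) has_vector_derivative Cm *v ?E + Dmp *v (psi *v ?E)) (at u within {0..})"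
    by (simp only: U_vec)
  have "psi ** U = - (Cp ** psi + Dpm)"
    using psi_riccati by (simp only: U_def mm.add_right matrix_mul_assoc eq_neg_iff_add_eq_0 add_ac)
  then have "psi *v (U *v ?E) = - (Cp *v (psi *v ?E)) - Dpm *v ?E"
    by (simp add: matrix_vector_mul_assoc mv.minus_left mv.add_left mv.diff_left matrix_mul_assoc mm.minus_left
        mm.add_left mm.diff_left)
  with bounded_linear.has_vector_derivative[OF mv.bounded_linear_right d, of psi]
  show "((\<lambda>u. psi *v (mat_exp (u *\<^sub>R U) *v w)) has_vector_derivative
       - (Cp *v (psi *v ?E)) - Dpm *v ?E) (at u within {0..})" by simp
  show "?E \<in> dual_cone Zm" by (rule cone_positiveD[OF exp_positiveD[OF U_pos u] w])
  then show "psi *v ?E \<in> dual_cone Zp" by (rule cone_positiveD[OF psi_pos])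
qed

lemma psi_eq_Phi: "psi = Phi"
proof (rule N.matrix_eqI_dual)
  fix w assume w: "w \<in> dual_cone Zm"
  have "(psi - Phi) *v w \<in> dual_cone Zp"
    using limit_le(1)[OF psi_solution[OF w], of 0] by (simp add: Phi_def mv.diff_left)
  moreover have "(Phi - psi) *v w \<in> dual_cone Zp"
    using cone_positive_lim[OF tendsto_diff[OF tendsto_const psi_tendsto] psi_iter_le_Phi] w by (rule cone_positiveD)
  moreover have "(Phi - psi) *v w = - ((psi - Phi) *v w)" by (simp add: mv.diff_left)
  ultimately have "(psi - Phi) *v w = 0" by (intro P.dual_antisym) simp_all
  then show "psi *v w = Phi *v w" by (simp add: mv.diff_left)
qed

text \<open>
  Let \<open>e\<close> and \<open>d\<close> be the differences of the two solutions. Minimality gives \<open>e, d \<ge> 0\<close>, and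
  \<open>F \<ge> Phi G\<close> with \<open>psi = Phi\<close> gives \<open>d \<le> psi e\<close>. Then \<open>e' = U e - Dmp (psi e - d)\<close> and \<open>e 0 = 0\<close> force
  \<open>e \<le> 0\<close>.
\<close>

theorem limit_eq:
  assumes u: "0 \<le> u"
  shows "G_lim u = mat_exp (u *\<^sub>R U)" "F_lim u = psi ** mat_exp (u *\<^sub>R U)"
proof -
  have "mat_exp (u *\<^sub>R U) *v w = G_lim u *v w \<and> (psi ** mat_exp (u *\<^sub>R U)) *v w = F_lim u *v w"
    if w: "w \<in> dual_cone Zm" for w
  proof -
    note S = psi_solution[OF w]
    define d where "d s = psi *v (mat_exp (s *\<^sub>R U) *v w) - F_lim s *v w" for s
    define e where "e s = mat_exp (s *\<^sub>R U) *v w - G_lim s *v w" for s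
    have d0: "d s \<in> dual_cone Zp" and e0: "e s \<in> dual_cone Zm" if "0 \<le> s" for s
      using limit_le[OF S that] by (simp_all add: d_def e_def)
    have r: "psi *v e s - d s \<in> dual_cone Zp" if "0 \<le> s" for s
      using F_lim_ge[OF that w] by (simp add: d_def e_def mv.diff_right psi_eq_Phi)
    have "- e u \<in> dual_cone Zm"
    proof (rule N.exp_positive_forward[OF U_pos _ _ _ u])
      fix s :: real assume s: "0 \<le> s"
      have "(e has_vector_derivative (Cm *v (mat_exp (s *\<^sub>R U) *v w) + Dmp *v (psi *v (mat_exp (s *\<^sub>R U) *v w)))
          - (Cm ** G_lim s + Dmp ** F_lim s) *v w) (at s within {0..})"
        unfolding e_def using S s by (intro has_vector_derivative_diff mv_deriv limit_derivs) (auto simp: solution_def)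
      moreover have "- ((Cm *v (mat_exp (s *\<^sub>R U) *v w) + Dmp *v (psi *v (mat_exp (s *\<^sub>R U) *v w)))
          - (Cm ** G_lim s + Dmp ** F_lim s) *v w) = U *v (- e s) + Dmp *v (psi *v e s - d s)"
        by (simp add: U_vec d_def e_def mv.add_left mv.diff_right mv.minus_right mm.add_left flip: matrix_vector_mul_assoc)
      ultimately show "((\<lambda>s. - e s) has_vector_derivative U *v (- e s) + Dmp *v (psi *v e s - d s)) (at s within {0..})"
        using has_vector_derivative_minus by fastforce
      show "Dmp *v (psi *v e s - d s) \<in> dual_cone Zm" by (intro cone_positiveD[OF Dmp_pos] r s)
    qed (simp add: e_def G_lim_0)
    with e0[OF u] have e: "e u = 0" by (rule N.dual_antisym)
    have "d u = 0"
      using r[OF u] d0[OF u] by (intro P.dual_antisym) (simp_all add: e mv.zero_right)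
    with e show ?thesis by (simp add: d_def e_def flip: matrix_vector_mul_assoc)
  qed
  then show "G_lim u = mat_exp (u *\<^sub>R U)" "F_lim u = psi ** mat_exp (u *\<^sub>R U)"
    by (auto intro!: N.matrix_eqI_dual)
qed

end

section \<open>Geometry of the orbit sets\<close>

lemma dim_supported: "dim {x::real^'n. \<forall>p. p \<notin> S \<longrightarrow> x $ p = 0} = card S"
  using dim_substandard_cart[of S, where 'a=real] by (simp add: dim_vec_eq)

lemma subspace_supported: "subspace {x::real^'n. \<forall>p. p \<notin> S \<longrightarrow> x $ p = 0}"
  by (rule subspaceI) auto

text \<open>
  A vector \<open>c\<close> orthogonal to \<open>V\<close> would confine \<open>V\<close> to the intersection \<open>T\<close> of two hyperplanes in the block. If
  \<open>T\<close> is nonempty, then it has exactly the dimension that minimality forbids. If \<open>T\<close> is empty, then so is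
  \<open>V\<close>, and any affine set of that dimension contradicts minimality.
\<close>

lemma minimal_block_total:
  fixes V :: "(real^'n) set"
  assumes V: "\<And>a. a \<in> V \<Longrightarrow> (\<forall>p. p \<notin> S \<longrightarrow> a $ p = 0) \<and> a \<bullet> 1 = 1"
    and min: "\<And>T. affine T \<Longrightarrow> aff_dim T = int (card S) - 2 \<Longrightarrow> \<not> V \<subseteq> T"
    and S: "S \<noteq> {}" and c: "\<And>p. p \<notin> S \<Longrightarrow> c $ p = 0" and orth: "\<And>a. a \<in> V \<Longrightarrow> a \<bullet> c = 0"
  shows "c = 0"
proof (rule ccontr)
  assume c0: "c \<noteq> 0"
  have card: "1 \<le> card S" using S by (simp add: Suc_leI card_gt_0_iff)
  define H where "H = {x::real^'n. \<forall>p. p \<notin> S \<longrightarrow> x $ p = 0}"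
  have H: "affine H" "aff_dim H = int (card S)"
    using subspace_supported[of S] aff_dim_subspace[OF subspace_supported[of S]]
    by (simp_all add: H_def subspace_imp_affine dim_supported)
  define H1 where "H1 = H \<inter> {x. c \<bullet> x = 0}"
  have "affine H1" unfolding H1_def by (intro affine_Int H affine_hyperplane)
  have "0 \<in> H1" by (simp add: H1_def H_def)
  moreover have "c \<in> H" using c by (simp add: H_def)
  then have "\<not> H \<subseteq> {x. c \<bullet> x = 0}" using c0 by auto
  ultimately have H1: "aff_dim H1 = int (card S) - 1"
    using aff_dim_affine_Int_hyperplane[OF H(1), of c 0] H(2) by (auto simp: H1_def)
  define T where "T = H1 \<inter> {x. 1 \<bullet> x = 1}"
  have T: "affine T" unfolding T_def by (intro affine_Int \<open>affine H1\<close> affine_hyperplane)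
  have VT: "V \<subseteq> T" using V orth by (auto simp: T_def H1_def H_def inner_commute)
  show False
  proof (cases "T = {}")
    case False
    have "\<not> H1 \<subseteq> {x. 1 \<bullet> x = 1}" using \<open>0 \<in> H1\<close> by auto
    then have "aff_dim T = int (card S) - 2"
      using aff_dim_affine_Int_hyperplane[OF \<open>affine H1\<close>, of 1 1] H1 False by (simp add: T_def)
    then show False using min[OF T] VT by blast
  next
    case True
    have "-1 \<le> int (card S) - 2" using card by simp
    moreover have "int (card S) - 2 \<le> aff_dim (UNIV :: (real^'n) set)"
      using card_mono[of UNIV S] by simp
    ultimately obtain T' :: "(real^'n) set" where "affine T'" "aff_dim T' = int (card S) - 2"
      using choose_affine_subset[OF affine_UNIV] by metis
    then show False using min VT True by auto
  qed
qed

lemma orbit_block: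
  assumes "valid_side s" "i \<in> {1..nblocks s}" "a \<in> orbit_set s i"
  shows "block s p \<noteq> i \<Longrightarrow> a $ p = 0" and "a \<bullet> 1 = 1"
  using assms unfolding valid_side_def by blast+

lemma total_orbits_side:
  assumes s: "valid_side s" shows "total_orbits (orbits s)"
proof
  show "bounded (orbits s)"
    unfolding orbits_def using s by (auto simp: valid_side_def)
  show "a \<bullet> 1 = 1" if "a \<in> orbits s" for a
    using that orbit_block(2)[OF s] by (auto simp: orbits_def)
  fix c assume c: "\<And>a. a \<in> orbits s \<Longrightarrow> a \<bullet> c = 0"
  have "(\<chi> p. if block s p = i then c $ p else 0) = 0" if i: "i \<in> {1..nblocks s}" for i
  proof (rule minimal_block_total[where S="{p. block s p = i}" and V="orbit_set s i"])
    show "(\<forall>p. p \<notin> {p. block s p = i} \<longrightarrow> a $ p = 0) \<and> a \<bullet> 1 = 1" if "a \<in> orbit_set s i" for a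
      using orbit_block[OF s i that] by auto
    show "\<not> orbit_set s i \<subseteq> T" if "affine T" "aff_dim T = int (card {p. block s p = i}) - 2" for T
      using s i that unfolding valid_side_def by blast
    have "i \<in> range (block s)" using s i by (simp add: valid_side_def)
    then show "{p. block s p = i} \<noteq> {}" by auto
    show "a \<bullet> (\<chi> p. if block s p = i then c $ p else 0) = 0" if a: "a \<in> orbit_set s i" for a
    proof -
      have "a \<bullet> (\<chi> p. if block s p = i then c $ p else 0) = a \<bullet> c"
        unfolding inner_vec_def using orbit_block(1)[OF s i a] by (intro sum.cong) auto
      moreover have "a \<in> orbits s" using a i by (auto simp: orbits_def)
      ultimately show ?thesis using c by simp
    qed
  qed simp
  then have "(if block s p = i then c $ p else 0) = 0" if "i \<in> {1..nblocks s}" for p i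
    using that by (metis (mono_tags, lifting) vec_lambda_beta zero_index)
  moreover have "block s p \<in> {1..nblocks s}" for p
    using s by (auto simp: valid_side_def)
  ultimately have "c $ p = 0" for p by metis
  then show "c = 0" by (simp add: vec_eq_iff)
qed

text \<open>
  The normalization of the flow never breaks down, because \<open>normalize_row\<close> would return \<open>0\<close>, which is not an
  orbit. So the mass has no zero, and by continuity it keeps the sign that it has at time \<open>0\<close>.
\<close>

lemma side_flow_mass_pos:
  assumes s: "valid_side s" and a: "a \<in> orbits s" and t: "0 \<le> t"
  shows "0 < (a v* mat_exp (t *\<^sub>R Gamma_mat s)) \<bullet> 1"
proof (rule ccontr)
  let ?m = "\<lambda>t. (a v* mat_exp (t *\<^sub>R Gamma_mat s)) \<bullet> 1"
  interpret total_orbits "orbits s" by (rule total_orbits_side[OF s])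
  have ne: "?m r \<noteq> 0" if "0 \<le> r" for r
  proof
    assume "?m r = 0"
    then have "side_flow s r a = 0" by (simp add: side_flow_def normalize_row_def)
    moreover have "side_flow s r a \<in> orbits s" using s a that by (simp add: valid_side_def)
    ultimately show False using one by force
  qed
  assume "\<not> 0 < ?m t"
  moreover have "?m 0 = 1" using one[OF a] by simp
  moreover have "continuous_on {0..t} ?m"
    by (intro continuous_intros vm.continuous_on)
  ultimately have "\<exists>r\<ge>0. r \<le> t \<and> ?m r = 0" using t by (intro IVT2') auto
  then show False using ne by blast
qed

lemma side_flow_scaleR:
  assumes s: "valid_side s" and a: "a \<in> orbits s" and t: "0 \<le> t"
  shows "a v* mat_exp (t *\<^sub>R Gamma_mat s) = ((a v* mat_exp (t *\<^sub>R Gamma_mat s)) \<bullet> 1) *\<^sub>R side_flow s t a"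
  using side_flow_mass_pos[OF assms] by (simp add: side_flow_def normalize_row_def)

lemma exp_positive_Gamma:
  assumes s: "valid_side s" shows "exp_positive (orbits s) (Gamma_mat s)"
  unfolding exp_positive_def cone_positive_def dual_cone_def
proof safe
  fix t :: real and w a assume t: "0 \<le> t" and w: "\<forall>a\<in>orbits s. 0 \<le> a \<bullet> w" and a: "a \<in> orbits s"
  have "side_flow s t a \<in> orbits s" using s a t by (simp add: valid_side_def)
  then have "0 \<le> ((a v* mat_exp (t *\<^sub>R Gamma_mat s)) \<bullet> 1) * (side_flow s t a \<bullet> w)"
    using side_flow_mass_pos[OF s a t] w by simp
  also have "\<dots> = (a v* mat_exp (t *\<^sub>R Gamma_mat s)) \<bullet> w"
    by (subst (2) side_flow_scaleR[OF s a t]) simp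
  finally show "0 \<le> a \<bullet> (mat_exp (t *\<^sub>R Gamma_mat s) *v w)" by (simp add: dot_lmul_matrix)
qed

lemma block_part_other:
  assumes "\<And>p. b p \<noteq> i0 \<Longrightarrow> a $ p = 0" "i \<noteq> i0" shows "a v* block_part b c M i j = 0"
  using assms by (auto simp: vec_eq_iff vector_matrix_mult_def block_part_def intro!: sum.neutral)

lemma sum_block_part:
  fixes M :: "real^'b^'a"
  assumes "finite I" "finite J" "\<And>p. b p \<in> I" "\<And>q. c q \<in> J"
  shows "(\<Sum>i\<in>I. \<Sum>j\<in>J. block_part b c M i j) = M"
proof -
  have "(\<Sum>i\<in>I. \<Sum>j\<in>J. if b p = i \<and> c q = j then M $ p $ q else 0) = M $ p $ q" for p q
  proof -
    have "(\<Sum>j\<in>J. if b p = i \<and> c q = j then M $ p $ q else 0) = (if b p = i then M $ p $ q else 0)" for i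
      using assms by (cases "b p = i") (auto simp: sum.delta')
    then show ?thesis using assms by (simp add: sum.delta')
  qed
  then show ?thesis by (simp add: vec_eq_iff block_part_def)
qed

text \<open>
  The part of \<open>Cmat\<close> that describes jumps between different blocks of the same sign.
\<close>

definition offdiag :: "('n::finite) side \<Rightarrow> real^'n^'n" where
  "offdiag s = Cmat s - Gamma_mat s"

lemma Gamma_offdiag: "Gamma_mat s + offdiag s = Cmat s"
  by (simp add: offdiag_def)

lemma sum_block_part_offdiag:
  assumes s: "valid_side s"
  shows "(\<Sum>i\<in>{1..nblocks s}. \<Sum>j\<in>{1..nblocks s} - {i}. block_part (block s) (block s) (Cmat s) i j) = offdiag s"
proof -
  let ?I = "{1..nblocks s}" and ?B = "block_part (block s) (block s) (Cmat s)"
  have r: "block s p \<in> ?I" for p using s by (auto simp: valid_side_def)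
  have "(\<Sum>i\<in>?I. \<Sum>j\<in>?I. ?B i j) = (\<Sum>i\<in>?I. ?B i i + (\<Sum>j\<in>?I - {i}. ?B i j))"
    by (intro sum.cong refl sum.remove) auto
  also have "\<dots> = (\<Sum>i\<in>?I. ?B i i) + (\<Sum>i\<in>?I. \<Sum>j\<in>?I - {i}. ?B i j)" by (rule sum.distrib)
  also have "(\<Sum>i\<in>?I. ?B i i) = Gamma_mat s"
  proof -
    have "(\<Sum>i\<in>?I. if block s p = i \<and> block s q = i then Cmat s $ p $ q else 0) =
       (if block s p = block s q then Cmat s $ p $ q else 0)" for p q
    proof -
      have "(if block s p = i \<and> block s q = i then Cmat s $ p $ q else 0) =
        (if block s p = i then (if block s p = block s q then Cmat s $ p $ q else 0) else 0)" for i by auto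
      then show ?thesis using r by (simp add: sum.delta')
    qed
    then show ?thesis by (simp add: vec_eq_iff block_part_def Gamma_mat_def)
  qed
  finally show ?thesis using sum_block_part[of ?I ?I "block s" "block s" "Cmat s"] r
    by (simp add: offdiag_def eq_diff_eq add.commute)
qed

section \<open>Linear flow and jump maps\<close>

definition mass :: "('p::finite, 'm::finite) state \<Rightarrow> real" where
  "mass z = fst z \<bullet> 1 + snd z \<bullet> 1"

definition normalize_state :: "('p::finite, 'm::finite) state \<Rightarrow> ('p, 'm) state" where
  "normalize_state z = (1 / mass z) *\<^sub>R z"

text \<open>
  The flow before normalization. Unlike \<open>flow\<close> it is linear in the state, and its mass is the probability that
  no jump has occurred.
\<close>

definition linear_flow :: "('p::finite, 'm::finite) rap \<Rightarrow> real \<Rightarrow> ('p, 'm) state \<Rightarrow> ('p, 'm) state" where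
  "linear_flow X u z = (fst z v* mat_exp (u *\<^sub>R Gamma_mat (plus X)), snd z v* mat_exp (u *\<^sub>R Gamma_mat (minus X)))"

text \<open>
  The index of a jump consists of the signs before and after the jump (\<open>True\<close> for plus) and of the blocks
  before and after it. The mass of the image is the intensity of the jump, its normalization is the destination.
\<close>

fun jump_map :: "('p::finite, 'm::finite) rap \<Rightarrow> bool \<times> bool \<times> nat \<times> nat \<Rightarrow> ('p, 'm) state \<Rightarrow> ('p, 'm) state" where
  "jump_map X (True, True, i, j) z = (fst z v* block_part (block (plus X)) (block (plus X)) (Cmat (plus X)) i j, 0)"
| "jump_map X (True, False, i, j) z = (0, fst z v* block_part (block (plus X)) (block (minus X)) (Dpm X) i j)"
| "jump_map X (False, False, i, j) z = (0, snd z v* block_part (block (minus X)) (block (minus X)) (Cmat (minus X)) i j)"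
| "jump_map X (False, True, i, j) z = (snd z v* block_part (block (minus X)) (block (plus X)) (Dmp X) i j, 0)"

definition jump_index :: "('p::finite, 'm::finite) rap \<Rightarrow> (bool \<times> bool \<times> nat \<times> nat) set" where
  "jump_index X =
     (\<lambda>(i, j). (True, True, i, j)) ` (SIGMA i:{1..nblocks (plus X)}. {1..nblocks (plus X)} - {i}) \<union>
     (\<lambda>(i, j). (True, False, i, j)) ` ({1..nblocks (plus X)} \<times> {1..nblocks (minus X)}) \<union>
     ((\<lambda>(i, j). (False, False, i, j)) ` (SIGMA i:{1..nblocks (minus X)}. {1..nblocks (minus X)} - {i}) \<union>
     (\<lambda>(i, j). (False, True, i, j)) ` ({1..nblocks (minus X)} \<times> {1..nblocks (plus X)}))"

lemma finite_jump_index [simp]: "finite (jump_index X)"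
  by (simp add: jump_index_def)

lemma jump_index_iff:
  "(k, l, i, j) \<in> jump_index X \<longleftrightarrow>
     i \<in> {1..if k then nblocks (plus X) else nblocks (minus X)} \<and>
     j \<in> {1..if l then nblocks (plus X) else nblocks (minus X)} \<and> (k = l \<longrightarrow> j \<noteq> i)"
  by (cases k; cases l) (auto simp: jump_index_def image_iff)

lemma sum_jump_index:
  fixes f :: "_ \<Rightarrow> 'a::comm_monoid_add"
  shows "(\<Sum>\<kappa>\<in>jump_index X. f \<kappa>) =
     (\<Sum>i\<in>{1..nblocks (plus X)}. \<Sum>j\<in>{1..nblocks (plus X)} - {i}. f (True, True, i, j)) +
     (\<Sum>i\<in>{1..nblocks (plus X)}. \<Sum>j\<in>{1..nblocks (minus X)}. f (True, False, i, j)) +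
     ((\<Sum>i\<in>{1..nblocks (minus X)}. \<Sum>j\<in>{1..nblocks (minus X)} - {i}. f (False, False, i, j)) +
     (\<Sum>i\<in>{1..nblocks (minus X)}. \<Sum>j\<in>{1..nblocks (plus X)}. f (False, True, i, j)))"
  unfolding jump_index_def
  by (subst sum.union_disjoint; (subst sum.union_disjoint)?; (subst sum.union_disjoint)?)
     (auto simp: sum.reindex inj_on_def o_def sum.Sigma split_def)

lemma mass_linear: "mass (c *\<^sub>R z) = c * mass z" "mass (z + y) = mass z + mass y"
  by (simp_all add: mass_def distrib_left inner_add_left)

lemma bounded_linear_mass: "bounded_linear mass"
  unfolding mass_def[abs_def]
  by (intro bounded_linear_add bounded_linear_compose[OF bounded_linear_inner_left] bounded_linear_fst bounded_linear_snd)

lemma jump_map_abs: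
  "jump_map X (True, True, i, j) = (\<lambda>z. (fst z v* block_part (block (plus X)) (block (plus X)) (Cmat (plus X)) i j, 0))"
  "jump_map X (True, False, i, j) = (\<lambda>z. (0, fst z v* block_part (block (plus X)) (block (minus X)) (Dpm X) i j))"
  "jump_map X (False, False, i, j) = (\<lambda>z. (0, snd z v* block_part (block (minus X)) (block (minus X)) (Cmat (minus X)) i j))"
  "jump_map X (False, True, i, j) = (\<lambda>z. (snd z v* block_part (block (minus X)) (block (plus X)) (Dmp X) i j, 0))"
  by (simp_all add: fun_eq_iff)

lemma bounded_linear_jump_map: "bounded_linear (jump_map X \<kappa>)"
proof -
  obtain k l i j where \<kappa>: "\<kappa> = (k, l, i, j)" by (cases \<kappa>)
  show ?thesis
    unfolding \<kappa> by (cases k; cases l; simp only: jump_map_abs)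
      (intro bounded_linear_Pair bounded_linear_compose[OF vm.bounded_linear_left] bounded_linear_fst
        bounded_linear_snd bounded_linear_zero)+
qed

lemmas jump_map_scaleR = linear_scale[OF bounded_linear.linear[OF bounded_linear_jump_map]]

lemma borel_measurable_vector_matrix_mult [measurable (raw)]:
  fixes f :: "'a \<Rightarrow> real^'n" and A :: "'a \<Rightarrow> real^'m^'n"
  assumes "f \<in> borel_measurable M" "A \<in> borel_measurable M"
  shows "(\<lambda>x. f x v* A x) \<in> borel_measurable M"
  by (rule borel_measurable_continuous_Pair[OF assms])
     (simp add: split_beta' vm.continuous_on continuous_on_fst continuous_on_snd)

lemma borel_measurable_mass [measurable]: "mass \<in> borel_measurable borel"
  by (intro borel_measurable_continuous_onI linear_continuous_on bounded_linear_mass)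

lemma borel_measurable_jump_map [measurable]: "jump_map X \<kappa> \<in> borel_measurable borel"
  by (intro borel_measurable_continuous_onI linear_continuous_on bounded_linear_jump_map)

lemma borel_measurable_normalize_state [measurable]: "normalize_state \<in> borel_measurable borel"
  unfolding normalize_state_def[abs_def] by measurable

lemma borel_measurable_linear_flow [measurable (raw)]:
  assumes f: "f \<in> borel_measurable M" and g: "g \<in> borel_measurable M"
  shows "(\<lambda>x. linear_flow X (f x) (g x)) \<in> borel_measurable M"
proof -
  have "(\<lambda>x. fst (g x)) \<in> borel_measurable M" "(\<lambda>x. snd (g x)) \<in> borel_measurable M"
    using g by (auto intro!: measurable_compose[OF g] borel_measurable_continuous_onI continuous_intros)
  then show ?thesis
    unfolding linear_flow_def
    by (intro borel_measurable_Pair borel_measurable_vector_matrix_mult borel_measurable_mat_exp f)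
qed

lemma linear_flow_0 [simp]: "linear_flow X 0 z = z"
  by (simp add: linear_flow_def)

lemma jump_intensity_eq:
  "jump_intensity X z B = (\<Sum>\<kappa>\<in>jump_index X. mass (jump_map X \<kappa> z) * indicator B (normalize_state (jump_map X \<kappa> z)))"
  by (simp add: sum_jump_index jump_intensity_def Let_def sum.distrib jump_rate_def mass_def normalize_state_def
      normalize_row_def indicator_def)

locale rap_data =
  fixes X :: "('p::{finite,linorder}, 'm::{finite,linorder}) rap"
  assumes valid: "valid_rap X"
begin

abbreviation "Gp \<equiv> Gamma_mat (plus X)"
abbreviation "Gm \<equiv> Gamma_mat (minus X)"
abbreviation "Bp \<equiv> offdiag (plus X)"
abbreviation "Bm \<equiv> offdiag (minus X)"
abbreviation "Zp \<equiv> orbits (plus X)"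
abbreviation "Zm \<equiv> orbits (minus X)"
abbreviation "S \<equiv> plus_states X \<union> minus_states X"

lemma valid_plus: "valid_side (plus X)" and valid_minus: "valid_side (minus X)"
  using valid by (auto simp: valid_rap_def)

sublocale P: total_orbits Zp by (rule total_orbits_side[OF valid_plus])
sublocale N: total_orbits Zm by (rule total_orbits_side[OF valid_minus])

lemma states_cases:
  assumes "z \<in> S"
  obtains a where "z = (a, 0)" "a \<in> Zp" | b where "z = (0, b)" "b \<in> Zm"
  using assms by (auto simp: plus_states_def minus_states_def)

lemma plus_iff: "z \<in> S \<Longrightarrow> z \<in> plus_states X \<longleftrightarrow> fst z \<bullet> 1 = 1"
  and minus_iff: "z \<in> S \<Longrightarrow> z \<in> minus_states X \<longleftrightarrow> snd z \<bullet> 1 = 1"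
  using P.one[of 0] N.one[of 0] by (auto simp: plus_states_def minus_states_def P.one N.one)

lemma mass_state: "z \<in> S \<Longrightarrow> mass z = 1"
  by (auto simp: mass_def plus_states_def minus_states_def P.one N.one)

text \<open>
  The cone over the states. It is preserved by the linear flow and by every single jump map. It is not
  convex, so sums over jumps must be treated termwise.
\<close>

definition state_cone :: "('p, 'm) state set" where
  "state_cone = {c *\<^sub>R z |c z. 0 \<le> c \<and> z \<in> S}"

lemma state_coneE:
  assumes "z \<in> state_cone" obtains c y where "z = c *\<^sub>R y" "0 \<le> c" "y \<in> S"
  using assms unfolding state_cone_def by blast

lemma state_coneI: "y \<in> S \<Longrightarrow> 0 \<le> c \<Longrightarrow> c *\<^sub>R y \<in> state_cone"
  unfolding state_cone_def by blast

lemma state_cone_scaleR: "z \<in> state_cone \<Longrightarrow> 0 \<le> c \<Longrightarrow> c *\<^sub>R z \<in> state_cone"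
  by (elim state_coneE) (simp only: scaleR_scaleR mult_nonneg_nonneg state_coneI)

lemma state_in_cone: "z \<in> S \<Longrightarrow> z \<in> state_cone"
  using state_coneI[of z 1] by simp

lemma zero_in_cone: "0 \<in> state_cone"
proof -
  obtain a where "a \<in> Zp" using P.nonempty by auto
  then have "0 *\<^sub>R (a, 0) \<in> state_cone" by (intro state_cone_scaleR state_in_cone) (auto simp: plus_states_def)
  then show ?thesis by (simp only: scaleR_zero_left)
qed

lemma cone_mass_nonneg: "z \<in> state_cone \<Longrightarrow> 0 \<le> mass z"
  by (elim state_coneE) (simp only: mass_linear mass_state mult_1_right)

lemma cone_normalize: "z \<in> state_cone \<Longrightarrow> mass z *\<^sub>R normalize_state z = z"
  by (elim state_coneE) (cases "mass z = 0"; simp only: mass_linear mass_state normalize_state_def scaleR_scaleR; simp)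

lemma normalize_state_scaleR: "0 < c \<Longrightarrow> normalize_state (c *\<^sub>R z) = normalize_state z"
  by (simp add: normalize_state_def mass_linear)

lemma plus_block_jump:
  assumes "a \<in> orbit_set (plus X) i0" "i0 \<in> {1..nblocks (plus X)}"
  shows "j \<in> {1..nblocks (plus X)} - {i0} \<Longrightarrow> admissible_jump a (block_part (block (plus X)) (block (plus X)) (Cmat (plus X)) i0 j) (orbit_set (plus X) j)"
    and "j \<in> {1..nblocks (minus X)} \<Longrightarrow> admissible_jump a (block_part (block (plus X)) (block (minus X)) (Dpm X) i0 j) (orbit_set (minus X) j)"
  using valid assms unfolding valid_rap_def admissible_jumps_def by blast+

lemma minus_block_jump:
  assumes "a \<in> orbit_set (minus X) i0" "i0 \<in> {1..nblocks (minus X)}"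
  shows "j \<in> {1..nblocks (minus X)} - {i0} \<Longrightarrow> admissible_jump a (block_part (block (minus X)) (block (minus X)) (Cmat (minus X)) i0 j) (orbit_set (minus X) j)"
    and "j \<in> {1..nblocks (plus X)} \<Longrightarrow> admissible_jump a (block_part (block (minus X)) (block (plus X)) (Dmp X) i0 j) (orbit_set (plus X) j)"
  using valid assms unfolding valid_rap_def admissible_jumps_def by blast+

lemma admissible_jump_cone:
  shows "admissible_jump a M (orbit_set (plus X) j) \<Longrightarrow> j \<in> {1..nblocks (plus X)} \<Longrightarrow> (a v* M, 0) \<in> state_cone"
    and "admissible_jump a' M' (orbit_set (minus X) j) \<Longrightarrow> j \<in> {1..nblocks (minus X)} \<Longrightarrow> (0, a' v* M') \<in> state_cone"
proof -
  assume A: "admissible_jump a M (orbit_set (plus X) j)" "j \<in> {1..nblocks (plus X)}"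
  show "(a v* M, 0) \<in> state_cone"
  proof (cases "(a v* M) \<bullet> 1 = 0")
    case True
    then have "(a v* M, 0) = (0 :: ('p, 'm) state)" using A by (simp add: admissible_jump_def zero_prod_def)
    then show ?thesis using zero_in_cone by simp
  next
    case False
    then have "(normalize_row (a v* M), 0) \<in> S" using A by (auto simp: admissible_jump_def plus_states_def orbits_def)
    from state_cone_scaleR[OF state_in_cone[OF this], of "(a v* M) \<bullet> 1"] A False
    show ?thesis by (simp add: admissible_jump_def normalize_row_def)
  qed
next
  assume A: "admissible_jump a' M' (orbit_set (minus X) j)" "j \<in> {1..nblocks (minus X)}"
  show "(0, a' v* M') \<in> state_cone"
  proof (cases "(a' v* M') \<bullet> 1 = 0")
    case True
    then have "(0, a' v* M') = (0 :: ('p, 'm) state)" using A by (simp add: admissible_jump_def zero_prod_def)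
    then show ?thesis using zero_in_cone by simp
  next
    case False
    then have "(0, normalize_row (a' v* M')) \<in> S" using A by (auto simp: admissible_jump_def minus_states_def orbits_def)
    from state_cone_scaleR[OF state_in_cone[OF this], of "(a' v* M') \<bullet> 1"] A False
    show ?thesis by (simp add: admissible_jump_def normalize_row_def)
  qed
qed

lemma jump_map_state:
  assumes z: "z \<in> S" and k: "\<kappa> \<in> jump_index X" shows "jump_map X \<kappa> z \<in> state_cone"
proof -
  obtain k l i j where \<kappa>: "\<kappa> = (k, l, i, j)" by (cases \<kappa>)
  show ?thesis
    using z
  proof (cases rule: states_cases)
  case (1 a)
  then obtain i0 where i0: "i0 \<in> {1..nblocks (plus X)}" "a \<in> orbit_set (plus X) i0" by (auto simp: orbits_def)
  have o: "a v* block_part (block (plus X)) c M i' j' = 0" if "i' \<noteq> i0" for c :: "'c::finite \<Rightarrow> nat" and M i' j'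
    using block_part_other[of "block (plus X)" i0 a i' c M j'] orbit_block(1)[OF valid_plus i0] that by blast
  show ?thesis
  proof (cases "k = True")
    case True
    show ?thesis
    proof (cases l)
      assume l
      with True show ?thesis
        using admissible_jump_cone(1)[OF plus_block_jump(1)[OF i0(2,1)], of j] k zero_in_cone \<open>z = (a, 0)\<close>
        by (cases "i = i0") (auto simp: o zero_prod_def \<kappa> jump_index_iff)
    next
      assume "\<not> l"
      with True show ?thesis
        using admissible_jump_cone(2)[OF plus_block_jump(2)[OF i0(2,1)], of j] k zero_in_cone \<open>z = (a, 0)\<close>
        by (cases "i = i0") (auto simp: o zero_prod_def \<kappa> jump_index_iff)
    qed
  next
    case False
    then show ?thesis using zero_in_cone \<open>z = (a, 0)\<close> by (cases l) (auto simp: zero_prod_def \<kappa>)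
  qed
next
  case (2 a)
  then obtain i0 where i0: "i0 \<in> {1..nblocks (minus X)}" "a \<in> orbit_set (minus X) i0" by (auto simp: orbits_def)
  have o: "a v* block_part (block (minus X)) c M i' j' = 0" if "i' \<noteq> i0" for c :: "'c::finite \<Rightarrow> nat" and M i' j'
    using block_part_other[of "block (minus X)" i0 a i' c M j'] orbit_block(1)[OF valid_minus i0] that by blast
  show ?thesis
  proof (cases "k = False")
    case True
    show ?thesis
    proof (cases l)
      assume l
      with True show ?thesis
        using admissible_jump_cone(1)[OF minus_block_jump(2)[OF i0(2,1)], of j] k zero_in_cone \<open>z = (0, a)\<close>
        by (cases "i = i0") (auto simp: o zero_prod_def \<kappa> jump_index_iff)
    next
      assume "\<not> l"
      with True show ?thesis
        using admissible_jump_cone(2)[OF minus_block_jump(1)[OF i0(2,1)], of j] k zero_in_cone \<open>z = (0, a)\<close>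
        by (cases "i = i0") (auto simp: o zero_prod_def \<kappa> jump_index_iff)
    qed
  next
    case False
    then show ?thesis using zero_in_cone \<open>z = (0, a)\<close> by (cases l) (auto simp: zero_prod_def \<kappa>)
  qed
qed
qed

lemma jump_map_cone:
  assumes "z \<in> state_cone" "\<kappa> \<in> jump_index X" shows "jump_map X \<kappa> z \<in> state_cone"
proof -
  obtain c y where "z = c *\<^sub>R y" "0 \<le> c" "y \<in> S" using assms(1) unfolding state_cone_def by blast
  then show ?thesis
    using state_cone_scaleR[OF jump_map_state[OF _ assms(2), of y], of c] by (simp add: jump_map_scaleR)
qed

end

section \<open>The jump kernel\<close>

context rap_data
begin

abbreviation "J \<equiv> jump_index X"

text \<open>
  The blocks add up to the full matrices, which is why linear functions of the destination have expectations
  that do not refer to blocks.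
\<close>

lemma sum_jump_map:
  "(\<Sum>\<kappa>\<in>J. jump_map X \<kappa> z) = (fst z v* Bp + snd z v* Dmp X, fst z v* Dpm X + snd z v* Bm)"
proof -
  have r: "block (plus X) p \<in> {1..nblocks (plus X)}" "block (minus X) q \<in> {1..nblocks (minus X)}" for p q
    using valid_plus valid_minus by (auto simp: valid_side_def)
  show ?thesis
    unfolding sum_jump_index
    by (rule prod_eqI) (simp_all only: jump_map.simps fst_add snd_add fst_sum snd_sum fst_conv snd_conv vm.sum_right[symmetric]
      sum_block_part_offdiag valid_plus valid_minus sum_block_part[OF finite_atLeastAtMost finite_atLeastAtMost r(1) r(1)]
      sum_block_part[OF finite_atLeastAtMost finite_atLeastAtMost r(1) r(2)]
      sum_block_part[OF finite_atLeastAtMost finite_atLeastAtMost r(2) r(1)] sum.neutral_const add_0_left add_0_right)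
qed

lemma cone_inner_nonneg:
  assumes z: "z \<in> state_cone"
  shows "w \<in> dual_cone Zp \<Longrightarrow> 0 \<le> fst z \<bullet> w" and "w' \<in> dual_cone Zm \<Longrightarrow> 0 \<le> snd z \<bullet> w'"
  using z by (elim state_coneE; elim states_cases; simp add: dual_cone_def)+

lemma jump_nonneg:
  assumes "z \<in> S" "w \<in> dual_cone Zp" "w' \<in> dual_cone Zm"
  shows "0 \<le> (fst z v* Bp + snd z v* Dmp X) \<bullet> w" "0 \<le> (fst z v* Dpm X + snd z v* Bm) \<bullet> w'"
proof -
  have "0 \<le> (\<Sum>\<kappa>\<in>J. fst (jump_map X \<kappa> z) \<bullet> w)" "0 \<le> (\<Sum>\<kappa>\<in>J. snd (jump_map X \<kappa> z) \<bullet> w')"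
    using assms by (auto intro!: sum_nonneg cone_inner_nonneg jump_map_state)
  then show "0 \<le> (fst z v* Bp + snd z v* Dmp X) \<bullet> w" "0 \<le> (fst z v* Dpm X + snd z v* Bm) \<bullet> w'"
    using sum_jump_map[of z] by (simp_all flip: inner_sum_left fst_sum snd_sum)
qed

lemma Bp_pos: "cone_positive Zp Zp Bp" and Dpm_pos: "cone_positive Zp Zm (Dpm X)"
proof -
  have a: "(a, 0) \<in> S" if "a \<in> Zp" for a using that by (simp add: plus_states_def)
  show "cone_positive Zp Zp Bp" unfolding cone_positive_def
  proof
    fix w assume w: "w \<in> dual_cone Zp"
    show "Bp *v w \<in> dual_cone Zp" unfolding dual_cone_def
    proof safe
      fix a assume "a \<in> Zp" from jump_nonneg(1)[OF a[OF this] w N.one_dual]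
      show "0 \<le> a \<bullet> (Bp *v w)" by (simp add: dot_lmul_matrix)
    qed
  qed
  show "cone_positive Zp Zm (Dpm X)" unfolding cone_positive_def
  proof
    fix w assume w: "w \<in> dual_cone Zm"
    show "Dpm X *v w \<in> dual_cone Zp" unfolding dual_cone_def
    proof safe
      fix a assume "a \<in> Zp" from jump_nonneg(2)[OF a[OF this] P.one_dual w]
      show "0 \<le> a \<bullet> (Dpm X *v w)" by (simp add: dot_lmul_matrix)
    qed
  qed
qed

lemma Bm_pos: "cone_positive Zm Zm Bm" and Dmp_pos: "cone_positive Zm Zp (Dmp X)"
proof -
  have a: "(0, a) \<in> S" if "a \<in> Zm" for a using that by (simp add: minus_states_def)
  show "cone_positive Zm Zm Bm" unfolding cone_positive_def
  proof
    fix w assume w: "w \<in> dual_cone Zm"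
    show "Bm *v w \<in> dual_cone Zm" unfolding dual_cone_def
    proof safe
      fix b assume "b \<in> Zm" from jump_nonneg(2)[OF a[OF this] P.one_dual w]
      show "0 \<le> b \<bullet> (Bm *v w)" by (simp add: dot_lmul_matrix)
    qed
  qed
  show "cone_positive Zm Zp (Dmp X)" unfolding cone_positive_def
  proof
    fix w assume w: "w \<in> dual_cone Zp"
    show "Dmp X *v w \<in> dual_cone Zm" unfolding dual_cone_def
    proof safe
      fix b assume "b \<in> Zm" from jump_nonneg(1)[OF a[OF this] w N.one_dual]
      show "0 \<le> b \<bullet> (Dmp X *v w)" by (simp add: dot_lmul_matrix)
    qed
  qed
qed

lemma rows_zero: "Gp *v 1 + Bp *v 1 + Dpm X *v 1 = 0" "Gm *v 1 + Bm *v 1 + Dmp X *v 1 = 0"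
  using valid by (simp_all add: valid_rap_def Gamma_offdiag flip: mv.add_left)

text \<open>
  As the full matrices have row sums zero, the total jump rate is the rate at which the linear flow loses mass.
\<close>

lemma total_rate:
  "(\<Sum>\<kappa>\<in>J. mass (jump_map X \<kappa> z)) = - (fst z \<bullet> (Gp *v 1)) - snd z \<bullet> (Gm *v 1)"
proof -
  have "(\<Sum>\<kappa>\<in>J. mass (jump_map X \<kappa> z)) = mass (\<Sum>\<kappa>\<in>J. jump_map X \<kappa> z)"
    by (rule linear_sum[OF bounded_linear.linear[OF bounded_linear_mass], symmetric])
  also have "\<dots> = fst z \<bullet> (Bp *v 1 + Dpm X *v 1) + snd z \<bullet> (Bm *v 1 + Dmp X *v 1)"
    by (simp add: sum_jump_map mass_def inner_add_left inner_add_right dot_lmul_matrix)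
  also have "\<dots> = - (fst z \<bullet> (Gp *v 1)) - snd z \<bullet> (Gm *v 1)"
  proof -
    have "Bp *v 1 + Dpm X *v 1 = - (Gp *v 1)" "Bm *v 1 + Dmp X *v 1 = - (Gm *v 1)"
      using rows_zero by (simp_all add: eq_neg_iff_add_eq_0 add_ac)
    then show ?thesis by simp
  qed
  finally show ?thesis .
qed

lemma linear_flow_state:
  assumes z: "z \<in> S" and u: "0 \<le> u"
  shows linear_flow_mass_pos: "0 < mass (linear_flow X u z)"
    and flow_eq_normalize: "flow X u z = normalize_state (linear_flow X u z)"
    and flow_in_states: "flow X u z \<in> S"
    and flow_fst: "fst (flow X u z) \<bullet> 1 = fst z \<bullet> 1"
    and flow_snd: "snd (flow X u z) \<bullet> 1 = snd z \<bullet> 1"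
proof -
  have "0 < mass (linear_flow X u z) \<and> flow X u z = normalize_state (linear_flow X u z) \<and> flow X u z \<in> S \<and>
      fst (flow X u z) \<bullet> 1 = fst z \<bullet> 1 \<and> snd (flow X u z) \<bullet> 1 = snd z \<bullet> 1"
    using z
  proof (cases rule: states_cases)
    case (1 a)
    have f: "side_flow (plus X) u a \<in> Zp" using valid_plus 1(2) u by (simp add: valid_side_def)
    show ?thesis using side_flow_mass_pos[OF valid_plus 1(2) u] f P.one[OF f] P.one[OF 1(2)] 1
      by (auto simp: linear_flow_def mass_def flow_def side_flow_def normalize_state_def normalize_row_def plus_states_def)
  next
    case (2 a)
    have f: "side_flow (minus X) u a \<in> Zm" using valid_minus 2(2) u by (simp add: valid_side_def)
    show ?thesis using side_flow_mass_pos[OF valid_minus 2(2) u] f N.one[OF f] N.one[OF 2(2)] 2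
      by (auto simp: linear_flow_def mass_def flow_def side_flow_def normalize_state_def normalize_row_def minus_states_def)
  qed
  then show "0 < mass (linear_flow X u z)" "flow X u z = normalize_state (linear_flow X u z)" "flow X u z \<in> S"
    "fst (flow X u z) \<bullet> 1 = fst z \<bullet> 1" "snd (flow X u z) \<bullet> 1 = snd z \<bullet> 1" by blast+
qed

lemma linear_flow_scaleR:
  "z \<in> S \<Longrightarrow> 0 \<le> u \<Longrightarrow> linear_flow X u z = mass (linear_flow X u z) *\<^sub>R flow X u z"
  using linear_flow_mass_pos[of z u] by (simp add: flow_eq_normalize normalize_state_def)

lemma linear_flow_cone: "z \<in> S \<Longrightarrow> 0 \<le> u \<Longrightarrow> linear_flow X u z \<in> state_cone"
  using state_coneI[OF flow_in_states, of z u "mass (linear_flow X u z)"] linear_flow_mass_pos[of z u]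
    linear_flow_scaleR[of z u] by simp

definition decay_rate :: "('p, 'm) state \<Rightarrow> real" where
  "decay_rate z = fst z \<bullet> (Gp *v 1) + snd z \<bullet> (Gm *v 1)"

lemma decay_rate_scaleR: "decay_rate (c *\<^sub>R z) = c * decay_rate z"
  by (simp add: decay_rate_def distrib_left)

lemma mass_linear_flow_deriv:
  "((\<lambda>u. mass (linear_flow X u z)) has_real_derivative decay_rate (linear_flow X u z)) (at u within T)"
proof -
  have 1: "((\<lambda>u. (a v* mat_exp (u *\<^sub>R G)) \<bullet> 1) has_vector_derivative (a v* mat_exp (u *\<^sub>R G)) \<bullet> (G *v 1)) (at u within T)"
    for a :: "real^'c" and G
    using bounded_linear.has_vector_derivative[OF bounded_linear_compose[OF bounded_linear_inner_right mv.bounded_linear_left]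
        mat_exp_deriv_left[of G u T], of a 1]
    by (simp add: dot_lmul_matrix matrix_vector_mul_assoc)
  show ?thesis
    unfolding has_real_derivative_iff_has_vector_derivative mass_def linear_flow_def fst_conv snd_conv decay_rate_def
    by (intro has_vector_derivative_add 1)
qed

lemma continuous_on_decay_rate [continuous_intros]: "continuous_on T (\<lambda>u. decay_rate (linear_flow X u z))"
  unfolding decay_rate_def linear_flow_def fst_conv snd_conv
  by (intro continuous_intros vm.continuous_on)

lemma continuous_on_mass_flow [continuous_intros]: "continuous_on T (\<lambda>u. mass (linear_flow X u z))"
  unfolding mass_def linear_flow_def fst_conv snd_conv
  by (intro continuous_intros vm.continuous_on)

lemma total_intensity_flow:
  assumes "z \<in> S" "0 \<le> u"
  shows "jump_intensity X (flow X u z) UNIV = - decay_rate (linear_flow X u z) / mass (linear_flow X u z)"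
proof -
  have "jump_intensity X (flow X u z) UNIV = - decay_rate (flow X u z)"
    by (simp add: jump_intensity_eq total_rate decay_rate_def)
  moreover have "decay_rate (linear_flow X u z) = mass (linear_flow X u z) * decay_rate (flow X u z)"
    by (subst linear_flow_scaleR[OF assms]) (rule decay_rate_scaleR)
  ultimately show ?thesis using linear_flow_mass_pos[OF assms] by simp
qed

text \<open>
  The total intensity along the flow is the logarithmic derivative, up to sign, of the mass of the linear flow.
\<close>

lemma survival_eq_mass:
  assumes z: "z \<in> S" and u: "0 \<le> u"
  shows "exp (- (LBINT r:{0..u}. jump_intensity X (flow X r z) UNIV)) = mass (linear_flow X u z)"
proof -
  let ?m = "\<lambda>r. mass (linear_flow X r z)"
  have pos: "0 < ?m r" if "0 \<le> r" for r by (rule linear_flow_mass_pos[OF z that])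
  have c: "continuous_on {0..u} (\<lambda>r. - decay_rate (linear_flow X r z) / ?m r)"
    using pos by (intro continuous_intros) (auto simp: less_imp_neq[THEN not_sym])
  have d: "((\<lambda>r. - ln (?m r)) has_vector_derivative - decay_rate (linear_flow X r z) / ?m r) (at r within {0..u})"
    if "0 \<le> r" "r \<le> u" for r
    unfolding has_real_derivative_iff_has_vector_derivative[symmetric]
    using pos[OF that(1)] by (auto intro!: derivative_eq_intros mass_linear_flow_deriv simp: field_simps)
  have "(LBINT r:{0..u}. jump_intensity X (flow X r z) UNIV) = (LBINT r:{0..u}. - decay_rate (linear_flow X r z) / ?m r)"
    by (rule set_lebesgue_integral_cong) (auto simp: total_intensity_flow[OF z])
  also have "\<dots> = - ln (?m u) - - ln (?m 0)"
    unfolding set_lebesgue_integral_def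
    by (rule integral_FTC_atLeastAtMost[OF u d c])
  finally show ?thesis using pos[OF u] mass_state[OF z] by simp
qed

definition jump_density :: "('p, 'm) state \<Rightarrow> ('p, 'm) state set \<Rightarrow> real \<Rightarrow> real" where
  "jump_density z B u = (\<Sum>\<kappa>\<in>J. mass (jump_map X \<kappa> (linear_flow X u z)) *
      indicator B (normalize_state (jump_map X \<kappa> (linear_flow X u z))))"

text \<open>
  The survival probability is the mass of the linear flow, and the intensities are homogeneous; so the kernel is
  obtained by applying the jump maps to the linear flow.
\<close>

lemma jump_kernel_eq:
  assumes z: "z \<in> S"
  shows "jump_kernel X z s B = (LBINT u:{0..s}. jump_density z B u)"
  unfolding jump_kernel_def
proof (rule set_lebesgue_integral_cong)
  show "\<forall>u. u \<in> {0..s} \<longrightarrow> exp (- (LBINT r:{0..u}. jump_intensity X (flow X r z) UNIV)) * jump_intensity X (flow X u z) B =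
      jump_density z B u"
  proof safe
    fix u assume "u \<in> {0..s}"
    then have u: "0 \<le> u" by simp
    let ?m = "mass (linear_flow X u z)"
    have m: "0 < ?m" by (rule linear_flow_mass_pos[OF z u])
    have "jump_map X \<kappa> (linear_flow X u z) = ?m *\<^sub>R jump_map X \<kappa> (flow X u z)" for \<kappa>
      by (subst linear_flow_scaleR[OF z u]) (rule jump_map_scaleR)
    then show "exp (- (LBINT r:{0..u}. jump_intensity X (flow X r z) UNIV)) * jump_intensity X (flow X u z) B =
      jump_density z B u"
      using m unfolding survival_eq_mass[OF z u] unfolding jump_intensity_eq jump_density_def
      by (simp del: sum_mult_indicator add: normalize_state_scaleR mass_linear sum_distrib_left mult.assoc)
  qed
qed simp

lemma jump_mass_nonneg:
  "z \<in> S \<Longrightarrow> 0 \<le> u \<Longrightarrow> \<kappa> \<in> J \<Longrightarrow> 0 \<le> mass (jump_map X \<kappa> (linear_flow X u z))"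
  by (intro cone_mass_nonneg jump_map_cone linear_flow_cone)

lemma jump_density_nonneg: "z \<in> S \<Longrightarrow> 0 \<le> u \<Longrightarrow> 0 \<le> jump_density z B u"
  unfolding jump_density_def by (intro sum_nonneg mult_nonneg_nonneg jump_mass_nonneg) auto

lemma jump_density_UNIV: "jump_density z UNIV u = - decay_rate (linear_flow X u z)"
  by (simp add: jump_density_def total_rate decay_rate_def)

lemma jump_density_le: "z \<in> S \<Longrightarrow> 0 \<le> u \<Longrightarrow> jump_density z B u \<le> jump_density z UNIV u"
  unfolding jump_density_def
  by (intro sum_mono) (auto intro: jump_mass_nonneg simp: indicator_def)

lemma jump_density_measurable [measurable]:
  assumes [measurable]: "B \<in> sets borel" shows "jump_density z B \<in> borel_measurable borel"
  unfolding jump_density_def[abs_def] by measurable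

lemma jump_density_integrable:
  assumes z: "z \<in> S" and B: "B \<in> sets borel"
  shows "set_integrable lborel {0..s} (jump_density z B)"
proof (rule set_integrable_bound)
  show "set_integrable lborel {0..s} (\<lambda>u. - decay_rate (linear_flow X u z))"
    by (intro borel_integrable_atLeastAtMost' continuous_intros)
  show "set_borel_measurable lborel {0..s} (jump_density z B)"
    using B unfolding set_borel_measurable_def by measurable
  show "AE x in lborel. x \<in> {0..s} \<longrightarrow> norm (jump_density z B x) \<le> norm (- decay_rate (linear_flow X x z))"
  proof (intro AE_I2 impI)
    fix x assume "x \<in> {0..s}"
    then show "norm (jump_density z B x) \<le> norm (- decay_rate (linear_flow X x z))"
      using jump_density_nonneg[OF z, of x B] jump_density_le[OF z, of x B] by (simp add: jump_density_UNIV)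
  qed
qed

lemma jump_kernel_nonneg: "z \<in> S \<Longrightarrow> 0 \<le> jump_kernel X z s B"
  unfolding jump_kernel_eq set_lebesgue_integral_def
  by (rule Bochner_Integration.integral_nonneg) (auto simp: indicator_def jump_density_nonneg)

lemma jump_kernel_nn_integral:
  assumes z: "z \<in> S" and B: "B \<in> sets borel"
  shows "ennreal (jump_kernel X z s B) = (\<integral>\<^sup>+u. (\<Sum>\<kappa>\<in>J. indicator {0..s} u *
    (ennreal (mass (jump_map X \<kappa> (linear_flow X u z))) *
      indicator B (normalize_state (jump_map X \<kappa> (linear_flow X u z))))) \<partial>lborel)"
proof -
  have "ennreal (jump_kernel X z s B) = (\<integral>\<^sup>+u. ennreal (indicator {0..s} u *\<^sub>R jump_density z B u) \<partial>lborel)"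
    unfolding jump_kernel_eq[OF z] set_lebesgue_integral_def
    by (rule nn_integral_eq_integral[OF jump_density_integrable[OF z B, unfolded set_integrable_def], symmetric])
       (auto simp: indicator_def jump_density_nonneg[OF z])
  also have "\<dots> = (\<integral>\<^sup>+u. (\<Sum>\<kappa>\<in>J. indicator {0..s} u *
    (ennreal (mass (jump_map X \<kappa> (linear_flow X u z))) *
      indicator B (normalize_state (jump_map X \<kappa> (linear_flow X u z))))) \<partial>lborel)"
  proof (rule nn_integral_cong)
    fix u
    show "ennreal (indicator {0..s} u *\<^sub>R jump_density z B u) = (\<Sum>\<kappa>\<in>J. indicator {0..s} u *
    (ennreal (mass (jump_map X \<kappa> (linear_flow X u z))) *
      indicator B (normalize_state (jump_map X \<kappa> (linear_flow X u z)))))"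
    proof (cases "u \<in> {0..s}")
      case True
      then have "ennreal (jump_density z B u) = (\<Sum>\<kappa>\<in>J. ennreal (mass (jump_map X \<kappa> (linear_flow X u z)) *
           indicator B (normalize_state (jump_map X \<kappa> (linear_flow X u z)))))"
        unfolding jump_density_def
        by (intro sum_ennreal[symmetric] mult_nonneg_nonneg jump_mass_nonneg z) auto
      with True show ?thesis by (simp del: sum_mult_indicator add: ennreal_mult'' flip: ennreal_indicator)
    qed simp
  qed
  finally show ?thesis .
qed

lemma jump_kernel_UNIV:
  assumes z: "z \<in> S" and s: "0 \<le> s"
  shows "jump_kernel X z s UNIV = 1 - mass (linear_flow X s z)"
proof -
  have "jump_kernel X z s UNIV = (LBINT u:{0..s}. - decay_rate (linear_flow X u z))"
    by (simp add: jump_kernel_eq[OF z] jump_density_UNIV)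
  also have "\<dots> = - mass (linear_flow X s z) - - mass (linear_flow X 0 z)"
    unfolding set_lebesgue_integral_def
    by (rule integral_FTC_atLeastAtMost[OF s])
       (auto intro!: has_vector_derivative_minus continuous_intros mass_linear_flow_deriv
         simp flip: has_real_derivative_iff_has_vector_derivative intro: derivative_eq_intros)
  finally show ?thesis using mass_state[OF z] by simp
qed

end

section \<open>The embedded jump chain\<close>

text \<open>
  A generator of the Borel sets, closed under intersection, on which the law of the next jump is prescribed by the
  conditional probabilities: an event of the past, a bound on the waiting time, a set of destinations.
\<close>

definition rectangles :: "('q::topological_space \<times> real \<times> 's::topological_space) set set" where
  "rectangles = {A \<times> {..s} \<times> B |A s B. A \<in> sets borel \<and> B \<in> sets borel}"

lemma sets_rectangles:
  "sets (borel :: ('q::second_countable_topology \<times> real \<times> 's::second_countable_topology) measure) =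
     sigma_sets UNIV rectangles"
proof -
  let ?E = "{a \<times> b |a b. a \<in> range atMost \<and> b \<in> sets borel} :: (real \<times> 's) set set"
  have "sets (borel \<Otimes>\<^sub>M borel :: (real \<times> 's) measure) = sets (sigma (space borel \<times> space borel) ?E)"
  proof (rule sets_pair_eq)
    show "sets borel = sigma_sets (space borel) (range atMost :: real set set)"
      by (subst borel_eq_atMost) simp
    show "countable (range (\<lambda>n. {..real n}))" by simp
    show "\<Union> (range (\<lambda>n. {..real n})) = space borel"
      by (auto simp: real_arch_simple)
    show "sets borel = sigma_sets (space borel) (sets (borel :: 's measure))"
      by (rule sets.sigma_sets_eq[symmetric])
    show "countable {UNIV :: 's set}" by simp
  qed auto
  then have inner: "sets (borel :: (real \<times> 's) measure) = sigma_sets UNIV ?E"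
    unfolding borel_prod by simp
  have "sets (borel \<Otimes>\<^sub>M borel :: ('q \<times> real \<times> 's) measure) =
      sets (sigma (space borel \<times> space borel) {a \<times> b |a b. a \<in> sets borel \<and> b \<in> ?E})"
  proof (rule sets_pair_eq)
    show "sets borel = sigma_sets (space borel) (sets (borel :: 'q measure))"
      by (rule sets.sigma_sets_eq[symmetric])
    show "countable {UNIV :: 'q set}" by simp
    show "sets borel = sigma_sets (space borel) ?E" using inner by simp
    show "countable (range (\<lambda>n. {..real n} \<times> (UNIV :: 's set)))" by simp
    show "\<Union> (range (\<lambda>n. {..real n} \<times> (UNIV :: 's set))) = space borel"
      by (auto simp: real_arch_simple)
    show "range (\<lambda>n. {..real n} \<times> (UNIV :: 's set)) \<subseteq> ?E"
      by (rule image_subsetI, rule CollectI, rule exI, rule exI, rule conjI, rule refl) auto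
  qed auto
  also have "{a \<times> b |a b. a \<in> sets (borel :: 'q measure) \<and> b \<in> ?E} = rectangles"
    unfolding rectangles_def by blast
  finally show ?thesis unfolding borel_prod by (simp add: rectangles_def)
qed

lemma Int_stable_rectangles: "Int_stable rectangles"
proof (rule Int_stableI)
  fix a b :: "('a \<times> real \<times> 'b) set" assume "a \<in> rectangles" "b \<in> rectangles"
  then obtain A s B A' s' B' where "a = A \<times> {..s} \<times> B" "b = A' \<times> {..s'} \<times> B'"
    "A \<in> sets borel" "B \<in> sets borel" "A' \<in> sets borel" "B' \<in> sets borel" by (auto simp: rectangles_def)
  moreover have "(A \<times> {..s} \<times> B) \<inter> (A' \<times> {..s'} \<times> B') = (A \<inter> A') \<times> {..min s s'} \<times> (B \<inter> B')" by auto
  ultimately show "a \<inter> b \<in> rectangles" unfolding rectangles_def by blast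
qed

lemma measure_eqI_rectangles:
  fixes M N :: "('q::second_countable_topology \<times> real \<times> 's::second_countable_topology) measure"
  assumes "sets M = sets borel" "sets N = sets borel" and fin: "emeasure M UNIV \<noteq> \<infinity>"
    and eq: "\<And>A s B. A \<in> sets borel \<Longrightarrow> B \<in> sets borel \<Longrightarrow>
      emeasure M (A \<times> {..s} \<times> B) = emeasure N (A \<times> {..s} \<times> B)"
  shows "M = N"
proof (rule measure_eqI_generator_eq[OF Int_stable_rectangles, where \<Omega>=UNIV and A="\<lambda>n. UNIV \<times> {..real n} \<times> UNIV"])
  show "emeasure M E = emeasure N E" if "E \<in> rectangles" for E
    using that eq by (auto simp: rectangles_def)
  show "sets M = sigma_sets UNIV rectangles" "sets N = sigma_sets UNIV rectangles"
    using assms by (simp_all add: sets_rectangles)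
  have "UNIV \<times> {..real n} \<times> UNIV \<in> rectangles" for n
    unfolding rectangles_def by (intro CollectI exI[of _ UNIV] exI[of _ "real n"] conjI) auto
  then show "range (\<lambda>n. UNIV \<times> {..real n} \<times> UNIV) \<subseteq> rectangles" by blast
  show "(\<Union>n. UNIV \<times> {..real n} \<times> UNIV) = UNIV" by (auto simp: real_arch_simple)
  show "emeasure M (UNIV \<times> {..real n} \<times> UNIV) \<noteq> \<infinity>" for n
    using fin emeasure_mono[of "UNIV \<times> {..real n} \<times> UNIV" UNIV M] assms(1)
    by (metis UNIV_I infinity_ennreal_def neq_top_trans sets.top sets_eq_imp_space_eq space_borel subset_UNIV)
qed simp

text \<open>
  A path space of the orbit process together with a choice of its jump times and post-jump states.
\<close>

locale pdmp_path = rap_data X for X :: "('p::{finite,linorder}, 'm::{finite,linorder}) rap" +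
  fixes M :: "'w measure" and A :: "real \<Rightarrow> 'w \<Rightarrow> ('p, 'm) state" and z0 :: "('p, 'm) state"
    and T :: "nat \<Rightarrow> 'w \<Rightarrow> ereal" and Y :: "nat \<Rightarrow> 'w \<Rightarrow> ('p, 'm) state"
  assumes prob: "prob_space M"
    and A_states: "\<And>\<omega> t. \<omega> \<in> space M \<Longrightarrow> 0 \<le> t \<Longrightarrow> A t \<omega> \<in> S"
    and start: "AE \<omega> in M. A 0 \<omega> = z0"
    and T_meas [measurable]: "\<And>n. T n \<in> borel_measurable M"
    and Y_meas [measurable]: "\<And>n. Y n \<in> borel_measurable M"
    and Y_eq: "\<And>n \<omega>. \<omega> \<in> space M \<Longrightarrow> Y n \<omega> = A (real_of_ereal (T n \<omega>)) \<omega>"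
    and T_0: "\<And>\<omega>. \<omega> \<in> space M \<Longrightarrow> T 0 \<omega> = 0"
    and T_step: "\<And>n \<omega>. \<omega> \<in> space M \<Longrightarrow> if T n \<omega> < \<infinity> then T n \<omega> < T (Suc n) \<omega> else T (Suc n) \<omega> = \<infinity>"
    and T_lim: "\<And>\<omega>. \<omega> \<in> space M \<Longrightarrow> (\<lambda>n. T n \<omega>) \<longlonglongrightarrow> \<infinity>"
    and A_flow: "\<And>n t \<omega>. \<omega> \<in> space M \<Longrightarrow> T n \<omega> \<le> ereal t \<Longrightarrow> ereal t < T (Suc n) \<omega> \<Longrightarrow>
        A t \<omega> = flow X (t - real_of_ereal (T n \<omega>)) (Y n \<omega>)"
    and cond: "\<And>n s B. 0 \<le> s \<Longrightarrow> B \<in> sets borel \<Longrightarrow> AE \<omega> in M. T n \<omega> < \<infinity> \<longrightarrow>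
        real_cond_exp M (jump_history M T Y n)
          (indicator {\<omega>\<in>space M. T (Suc n) \<omega> \<le> T n \<omega> + ereal s \<and> Y (Suc n) \<omega> \<in> B}) \<omega> =
        jump_kernel X (Y n \<omega>) s B"
begin

sublocale prob_space M by (rule prob)

abbreviation "t n \<omega> \<equiv> real_of_ereal (T n \<omega>)"
abbreviation "hist n \<equiv> jump_history M T Y n"

lemma T_Suc_ge: "\<omega> \<in> space M \<Longrightarrow> T n \<omega> \<le> T (Suc n) \<omega>"
  using T_step[of \<omega> n] by (auto split: if_splits)

lemma T_mono: assumes w: "\<omega> \<in> space M" and "m \<le> n" shows "T m \<omega> \<le> T n \<omega>"
  by (rule lift_Suc_mono_le[of "\<lambda>n. T n \<omega>", OF T_Suc_ge[OF w] \<open>m \<le> n\<close>])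

lemma T_nonneg: "\<omega> \<in> space M \<Longrightarrow> 0 \<le> T n \<omega>"
  using T_mono[of \<omega> 0 n] T_0[of \<omega>] by simp

lemma ereal_t: "\<omega> \<in> space M \<Longrightarrow> T n \<omega> < \<infinity> \<Longrightarrow> ereal (t n \<omega>) = T n \<omega>"
  using T_nonneg[of \<omega> n] by (cases "T n \<omega>") auto

lemma t_nonneg: "\<omega> \<in> space M \<Longrightarrow> 0 \<le> t n \<omega>"
  using T_nonneg[of \<omega> n] by (rule real_of_ereal_pos)

lemma Y_states: "\<omega> \<in> space M \<Longrightarrow> Y n \<omega> \<in> S"
  using A_states[OF _ t_nonneg] by (simp only: Y_eq)

lemma t_less: "\<omega> \<in> space M \<Longrightarrow> T (Suc n) \<omega> < \<infinity> \<Longrightarrow> T n \<omega> < \<infinity> \<and> t n \<omega> < t (Suc n) \<omega>"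
proof -
  assume w: "\<omega> \<in> space M" and f: "T (Suc n) \<omega> < \<infinity>"
  then have n: "T n \<omega> < \<infinity>" "T n \<omega> < T (Suc n) \<omega>" using T_step[OF w, of n] by (auto split: if_splits)
  then have "ereal (t n \<omega>) < ereal (t (Suc n) \<omega>)" using ereal_t[OF w] f by simp
  with n show ?thesis by simp
qed

lemma space_hist [simp]: "space (hist n) = space M"
  and sets_hist: "sets (hist n) = sigma_sets (space M) (\<Union>i\<in>{..n}. {T i -` E \<inter> space M |E. E \<in> sets borel} \<union>
        {Y i -` E \<inter> space M |E. E \<in> sets borel})"
  unfolding jump_history_def by (auto intro!: space_measure_of sets_measure_of)

lemma subalgebra_hist: "subalgebra M (hist n)"
  unfolding subalgebra_def sets_hist by (auto intro!: sets.sigma_sets_subset)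

lemma sets_hist_le: "H \<in> sets (hist n) \<Longrightarrow> H \<in> sets M"
  using subalgebra_hist[of n] by (auto simp: subalgebra_def)

lemma measurable_hist_le: "f \<in> measurable (hist n) N \<Longrightarrow> f \<in> measurable M N"
  using subalgebra_hist[of n] by (rule measurable_from_subalg)

lemma T_hist: "i \<le> n \<Longrightarrow> T i \<in> borel_measurable (hist n)"
  and Y_hist: "i \<le> n \<Longrightarrow> Y i \<in> borel_measurable (hist n)"
  by (rule measurableI; (simp; fail | unfold sets_hist space_hist; rule sigma_sets.Basic; blast))+

abbreviation gap :: "nat \<Rightarrow> 'w \<Rightarrow> real" where
  "gap n \<omega> \<equiv> t (Suc n) \<omega> - t n \<omega>"

abbreviation rate :: "nat \<Rightarrow> bool \<times> bool \<times> nat \<times> nat \<Rightarrow> real \<Rightarrow> 'w \<Rightarrow> real" where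
  "rate n \<kappa> u \<omega> \<equiv> mass (jump_map X \<kappa> (linear_flow X u (Y n \<omega>)))"

abbreviation dest :: "nat \<Rightarrow> bool \<times> bool \<times> nat \<times> nat \<Rightarrow> real \<Rightarrow> 'w \<Rightarrow> ('p, 'm) state" where
  "dest n \<kappa> u \<omega> \<equiv> normalize_state (jump_map X \<kappa> (linear_flow X u (Y n \<omega>)))"

text \<open>
  On \<open>H\<close> the jump time \<open>T n\<close> is finite. There the conditional probability is the kernel, and the event
  \<open>T (Suc n) \<le> T n + s\<close> is the event that the gap exists and is at most \<open>s\<close>.
\<close>

lemma emeasure_next_jump:
  assumes H: "H \<in> sets (hist n)" "\<And>\<omega>. \<omega> \<in> H \<Longrightarrow> T n \<omega> < \<infinity>" and B: "B \<in> sets borel"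
  shows "emeasure M (H \<inter> {\<omega>\<in>space M. T (Suc n) \<omega> < \<infinity> \<and> gap n \<omega> \<le> s \<and> Y (Suc n) \<omega> \<in> B}) =
    (\<integral>\<^sup>+\<omega>. indicator H \<omega> * ennreal (jump_kernel X (Y n \<omega>) s B) \<partial>M)"
proof (cases "0 \<le> s")
  case False
  have "H \<inter> {\<omega>\<in>space M. T (Suc n) \<omega> < \<infinity> \<and> gap n \<omega> \<le> s \<and> Y (Suc n) \<omega> \<in> B} = {}"
  proof -
    have "\<not> gap n \<omega> \<le> s" if "\<omega> \<in> space M" "T (Suc n) \<omega> < \<infinity>" for \<omega>
      using t_less[OF that] False by simp
    then show ?thesis by blast
  qed
  moreover have "jump_kernel X (Y n \<omega>) s B = 0" for \<omega>
    using False by (simp add: jump_kernel_def set_lebesgue_integral_def)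
  ultimately show ?thesis by simp
next
  case True
  interpret fs: finite_measure_subalgebra M "hist n"
    by unfold_locales (rule subalgebra_hist)
  let ?E = "{\<omega>\<in>space M. T (Suc n) \<omega> \<le> T n \<omega> + ereal s \<and> Y (Suc n) \<omega> \<in> B}"
  let ?c = "real_cond_exp M (hist n) (indicator ?E)"
  note [measurable] = B
  have HM [measurable]: "H \<in> sets M" by (rule sets_hist_le[OF H(1)])
  have Hsp: "H \<subseteq> space M" by (rule sets.sets_into_space[OF HM])
  have E [measurable]: "?E \<in> sets M" by measurable
  have int: "integrable M (indicator ?E :: _ \<Rightarrow> real)"
    by (rule integrable_real_indicator[OF E]) (simp add: emeasure_eq_measure)
  have eq: "H \<inter> {\<omega>\<in>space M. T (Suc n) \<omega> < \<infinity> \<and> gap n \<omega> \<le> s \<and> Y (Suc n) \<omega> \<in> B} = H \<inter> ?E"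
  proof -
    have "T (Suc n) \<omega> < \<infinity> \<and> gap n \<omega> \<le> s \<longleftrightarrow> T (Suc n) \<omega> \<le> T n \<omega> + ereal s" if h: "\<omega> \<in> H" for \<omega>
    proof -
      have w: "\<omega> \<in> space M" using h Hsp by auto
      obtain r where r: "T n \<omega> = ereal r" using ereal_t[OF w H(2)[OF h]] by metis
      show ?thesis
        using T_nonneg[OF w, of "Suc n"] by (cases "T (Suc n) \<omega>") (auto simp: r)
    qed
    then show ?thesis using Hsp by blast
  qed
  have ae: "AE \<omega> in M. \<omega> \<in> H \<longrightarrow> ?c \<omega> = jump_kernel X (Y n \<omega>) s B"
    using cond[OF True B, of n] by eventually_elim (use H(2) in blast)
  have ci: "integrable M (\<lambda>\<omega>. indicator H \<omega> * ?c \<omega>)"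
    using integrable_mult_indicator[OF HM fs.real_cond_exp_int(1)[OF int]] by simp
  have nn: "AE \<omega> in M. 0 \<le> indicator H \<omega> * ?c \<omega>"
  proof (use ae in eventually_elim)
    case (elim \<omega>)
    then show ?case using jump_kernel_nonneg[OF Y_states, of \<omega> n s B] Hsp by (auto simp: indicator_def)
  qed
  have "measure M (H \<inter> ?E) = (\<integral>\<omega>\<in>H. indicator ?E \<omega> \<partial>M)"
  proof -
    have "(\<integral>\<omega>\<in>H. indicator ?E \<omega> \<partial>M) = (\<integral>\<omega>. indicator (H \<inter> ?E) \<omega> \<partial>M)"
      unfolding set_lebesgue_integral_def by (intro Bochner_Integration.integral_cong) (auto simp: indicator_def)
    also have "\<dots> = measure M (H \<inter> ?E)" 
      by (simp only: Bochner_Integration.integral_indicator sets.Int_space_eq2[OF sets.Int[OF HM E]])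
    finally show ?thesis by simp
  qed
  also have "\<dots> = (\<integral>\<omega>. indicator H \<omega> * ?c \<omega> \<partial>M)"
    using fs.real_cond_exp_intA[OF int H(1)] by (simp add: set_lebesgue_integral_def)
  finally have "emeasure M (H \<inter> ?E) = ennreal (\<integral>\<omega>. indicator H \<omega> * ?c \<omega> \<partial>M)"
    by (simp add: emeasure_eq_measure)
  also have "\<dots> = (\<integral>\<^sup>+\<omega>. ennreal (indicator H \<omega> * ?c \<omega>) \<partial>M)"
    by (rule nn_integral_eq_integral[OF ci nn, symmetric])
  also have "\<dots> = (\<integral>\<^sup>+\<omega>. indicator H \<omega> * ennreal (jump_kernel X (Y n \<omega>) s B) \<partial>M)"
  proof (rule nn_integral_cong_AE, use ae in eventually_elim)
    case (elim \<omega>)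
    then show ?case by (cases "\<omega> \<in> H") auto
  qed
  finally show ?thesis unfolding eq .
qed

text \<open>
  Both sides are integrals of \<open>h\<close> with respect to finite measures, the first being the joint law of \<open>Q\<close>, the
  waiting time and the new state. The second is an image of a density on the product of \<open>M\<close>, the half-line of
  waiting times and the finite set of jumps. By the preceding lemma the two measures agree on rectangles.
\<close>

lemma next_jump:
  fixes Q :: "'w \<Rightarrow> 'q::second_countable_topology" and h :: "'q \<times> real \<times> ('p, 'm) state \<Rightarrow> ennreal"
  assumes H: "H \<in> sets (hist n)" "\<And>\<omega>. \<omega> \<in> H \<Longrightarrow> T n \<omega> < \<infinity>"
    and Q: "Q \<in> borel_measurable (hist n)" and h [measurable]: "h \<in> borel_measurable borel"
  shows "(\<integral>\<^sup>+\<omega>. indicator H \<omega> * indicator {\<omega>. T (Suc n) \<omega> < \<infinity>} \<omega> * h (Q \<omega>, gap n \<omega>, Y (Suc n) \<omega>) \<partial>M) =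
    (\<integral>\<^sup>+\<omega>. indicator H \<omega> * (\<integral>\<^sup>+u. (\<Sum>\<kappa>\<in>J. indicator {0..} u * (ennreal (rate n \<kappa> u \<omega>) * h (Q \<omega>, u, dest n \<kappa> u \<omega>))) \<partial>lborel) \<partial>M)"
proof -
  have HM [measurable]: "H \<in> sets M" by (rule sets_hist_le[OF H(1)])
  have Hsp: "H \<subseteq> space M" by (rule sets.sets_into_space[OF HM])
  have QM [measurable]: "Q \<in> borel_measurable M" by (rule measurable_hist_le[OF Q])
  interpret cs: sigma_finite_measure "count_space J" by (rule sigma_finite_measure_count_space_finite) simp
  interpret ps: pair_sigma_finite lborel "count_space J" ..
  let ?N = "lborel \<Otimes>\<^sub>M count_space J"
  let ?w = "\<lambda>\<omega>. indicator H \<omega> * indicator {\<omega>. T (Suc n) \<omega> < \<infinity>} \<omega> :: ennreal"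
  let ?f = "\<lambda>\<omega>. (Q \<omega>, gap n \<omega>, Y (Suc n) \<omega>)"
  let ?d = "\<lambda>(\<omega>, u, \<kappa>). indicator H \<omega> * (indicator {0..} u * ennreal (rate n \<kappa> u \<omega>))"
  let ?g = "\<lambda>(\<omega>, u, \<kappa>). (Q \<omega>, u, dest n \<kappa> u \<omega>)"
  define \<mu>1 where "\<mu>1 = distr (density M ?w) borel ?f"
  define \<mu>2 where "\<mu>2 = distr (density (M \<Otimes>\<^sub>M ?N) ?d) borel ?g"
  have jm [measurable]: "(\<lambda>x. jump_map X (snd (snd x)) (linear_flow X (fst (snd x)) (Y n (fst x)))) \<in> borel_measurable (M \<Otimes>\<^sub>M ?N)"
  proof (rule measurable_compose_countable'[where g="\<lambda>x. snd (snd x)" and I=J])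
    show "countable J" by (rule countable_finite) simp
  qed measurable
  have d_meas [measurable]: "?d \<in> borel_measurable (M \<Otimes>\<^sub>M ?N)" unfolding split_beta' by measurable
  have g_meas [measurable]: "?g \<in> borel_measurable (M \<Otimes>\<^sub>M ?N)" unfolding split_beta' by measurable
  have w_meas [measurable]: "?w \<in> borel_measurable M" by measurable
  have f_meas [measurable]: "?f \<in> borel_measurable M" by measurable
  have I1: "(\<integral>\<^sup>+y. k y \<partial>\<mu>1) = (\<integral>\<^sup>+\<omega>. ?w \<omega> * k (?f \<omega>) \<partial>M)" if [measurable]: "k \<in> borel_measurable borel" for k
    unfolding \<mu>1_def by (simp add: nn_integral_distr nn_integral_density)
  have I2: "(\<integral>\<^sup>+y. k y \<partial>\<mu>2) = (\<integral>\<^sup>+\<omega>. indicator H \<omega> * (\<integral>\<^sup>+u. (\<Sum>\<kappa>\<in>J. indicator {0..} u * (ennreal (rate n \<kappa> u \<omega>) * k (Q \<omega>, u, dest n \<kappa> u \<omega>))) \<partial>lborel) \<partial>M)"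
    if k [measurable]: "k \<in> borel_measurable borel" for k
  proof -
    have "(\<integral>\<^sup>+y. k y \<partial>\<mu>2) = (\<integral>\<^sup>+x. ?d x * k (?g x) \<partial>(M \<Otimes>\<^sub>M ?N))"
      unfolding \<mu>2_def by (simp add: nn_integral_distr nn_integral_density)
    also have "\<dots> = (\<integral>\<^sup>+\<omega>. \<integral>\<^sup>+y. ?d (\<omega>, y) * k (?g (\<omega>, y)) \<partial>?N \<partial>M)"
      by (rule ps.P.nn_integral_fst[symmetric]) measurable
    also have "\<dots> = (\<integral>\<^sup>+\<omega>. indicator H \<omega> * (\<integral>\<^sup>+u. (\<Sum>\<kappa>\<in>J. indicator {0..} u * (ennreal (rate n \<kappa> u \<omega>) * k (Q \<omega>, u, dest n \<kappa> u \<omega>))) \<partial>lborel) \<partial>M)"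
    proof (rule nn_integral_cong)
      fix \<omega> assume w: "\<omega> \<in> space M"
      have [measurable]: "(\<lambda>y. ?d (\<omega>, y) * k (?g (\<omega>, y))) \<in> borel_measurable ?N"
        using w by measurable
      have "(\<integral>\<^sup>+y. ?d (\<omega>, y) * k (?g (\<omega>, y)) \<partial>?N) = (\<integral>\<^sup>+u. \<integral>\<^sup>+\<kappa>. ?d (\<omega>, u, \<kappa>) * k (?g (\<omega>, u, \<kappa>)) \<partial>count_space J \<partial>lborel)"
        by (rule cs.nn_integral_fst[symmetric]) measurable
      also have "\<dots> = (\<integral>\<^sup>+u. indicator H \<omega> * (\<Sum>\<kappa>\<in>J. indicator {0..} u * (ennreal (rate n \<kappa> u \<omega>) * k (Q \<omega>, u, dest n \<kappa> u \<omega>))) \<partial>lborel)"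
        by (simp only: nn_integral_count_space_finite finite_jump_index prod.case sum_distrib_left mult.assoc)
      also have "\<dots> = indicator H \<omega> * (\<integral>\<^sup>+u. (\<Sum>\<kappa>\<in>J. indicator {0..} u * (ennreal (rate n \<kappa> u \<omega>) * k (Q \<omega>, u, dest n \<kappa> u \<omega>))) \<partial>lborel)"
        by (rule nn_integral_cmult) measurable
      finally show "(\<integral>\<^sup>+y. ?d (\<omega>, y) * k (?g (\<omega>, y)) \<partial>?N) = \<dots>" .
    qed
    finally show ?thesis .
  qed
  have "\<mu>1 = \<mu>2"
  proof (rule measure_eqI_rectangles)
    show "sets \<mu>1 = sets borel" "sets \<mu>2 = sets borel" by (simp_all add: \<mu>1_def \<mu>2_def)
    have "emeasure \<mu>1 UNIV = (\<integral>\<^sup>+\<omega>. ?w \<omega> \<partial>M)"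
      using I1[of "\<lambda>_. 1"] by (simp add: \<mu>1_def)
    also have "\<dots> \<le> (\<integral>\<^sup>+\<omega>. 1 \<partial>M)" by (intro nn_integral_mono) (auto simp: indicator_def)
    finally show "emeasure \<mu>1 UNIV \<noteq> \<infinity>" by (auto simp: emeasure_space_1 top_unique)
    fix C :: "'q set" and s :: real and B :: "('p, 'm) state set"
    assume [measurable]: "C \<in> sets borel" "B \<in> sets borel"
    let ?R = "C \<times> {..s} \<times> B"
    have R [measurable]: "?R \<in> sets borel"
    proof -
      have "?R \<in> sets (borel \<Otimes>\<^sub>M (borel \<Otimes>\<^sub>M borel))" by (intro pair_measureI) auto
      then show ?thesis unfolding borel_prod .
    qed
    let ?H = "H \<inter> (Q -` C \<inter> space M)"
    have H': "?H \<in> sets (hist n)"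
      using H(1) measurable_sets[OF Q, of C] by (auto simp del: space_hist simp: space_hist[of n, symmetric])
    have "emeasure \<mu>1 ?R = (\<integral>\<^sup>+\<omega>. ?w \<omega> * indicator ?R (?f \<omega>) \<partial>M)"
      using I1[of "indicator ?R"] by (simp add: \<mu>1_def)
    also have "\<dots> = (\<integral>\<^sup>+\<omega>. indicator (?H \<inter> {\<omega>\<in>space M. T (Suc n) \<omega> < \<infinity> \<and> gap n \<omega> \<le> s \<and> Y (Suc n) \<omega> \<in> B}) \<omega> \<partial>M)"
      by (rule nn_integral_cong) (auto simp: indicator_def)
    also have "\<dots> = emeasure M (?H \<inter> {\<omega>\<in>space M. T (Suc n) \<omega> < \<infinity> \<and> gap n \<omega> \<le> s \<and> Y (Suc n) \<omega> \<in> B})"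
      by (rule nn_integral_indicator) measurable
    also have "\<dots> = (\<integral>\<^sup>+\<omega>. indicator ?H \<omega> * ennreal (jump_kernel X (Y n \<omega>) s B) \<partial>M)"
      by (rule emeasure_next_jump[OF H']) (use H(2) in auto)
    also have "\<dots> = (\<integral>\<^sup>+\<omega>. indicator H \<omega> * (\<integral>\<^sup>+u. (\<Sum>\<kappa>\<in>J. indicator {0..} u *
        (ennreal (rate n \<kappa> u \<omega>) * indicator ?R (Q \<omega>, u, dest n \<kappa> u \<omega>))) \<partial>lborel) \<partial>M)"
    proof (rule nn_integral_cong)
      fix \<omega> assume w: "\<omega> \<in> space M"
      show "indicator ?H \<omega> * ennreal (jump_kernel X (Y n \<omega>) s B) = indicator H \<omega> * (\<integral>\<^sup>+u. (\<Sum>\<kappa>\<in>J. indicator {0..} u *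
        (ennreal (rate n \<kappa> u \<omega>) * indicator ?R (Q \<omega>, u, dest n \<kappa> u \<omega>))) \<partial>lborel)"
      proof (cases "\<omega> \<in> H \<and> Q \<omega> \<in> C")
        case True
        then have "indicator ?H \<omega> = (1::ennreal)" "indicator H \<omega> = (1::ennreal)" using w by auto
        moreover have "(\<integral>\<^sup>+u. (\<Sum>\<kappa>\<in>J. indicator {0..s} u * (ennreal (rate n \<kappa> u \<omega>) * indicator B (dest n \<kappa> u \<omega>))) \<partial>lborel) =
          (\<integral>\<^sup>+u. (\<Sum>\<kappa>\<in>J. indicator {0..} u * (ennreal (rate n \<kappa> u \<omega>) * indicator ?R (Q \<omega>, u, dest n \<kappa> u \<omega>))) \<partial>lborel)"
          using True by (intro nn_integral_cong sum.cong) (auto simp: indicator_def)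
        ultimately show ?thesis
          by (simp del: sum_mult_indicator add: jump_kernel_nn_integral[OF Y_states[OF w]])
      next
        case False
        then show ?thesis by (auto simp: indicator_def)
      qed
    qed
    also have "\<dots> = emeasure \<mu>2 ?R"
      using I2[of "indicator ?R"] by (simp del: sum_mult_indicator add: \<mu>2_def)
    finally show "emeasure \<mu>1 ?R = emeasure \<mu>2 ?R" .
  qed
  then show ?thesis using I1[OF h] I2[OF h] by simp
qed

text \<open>
  The complementary event that the next jump occurs in time is covered by \<open>next_jump\<close>, and the
  kernel up to time \<open>l\<close> has total mass \<open>1 - mass (linear_flow X l y)\<close>. The bound \<open>c\<close> makes the subtraction
  legitimate.
\<close>

lemma no_jump_before:
  fixes Q :: "'w \<Rightarrow> 'q::second_countable_topology" and v l :: "'q \<Rightarrow> real"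
  assumes H: "H \<in> sets (hist n)" "\<And>\<omega>. \<omega> \<in> H \<Longrightarrow> T n \<omega> < \<infinity>"
    and Q: "Q \<in> borel_measurable (hist n)" and [measurable]: "v \<in> borel_measurable borel" "l \<in> borel_measurable borel"
    and v: "\<And>\<omega>. \<omega> \<in> H \<Longrightarrow> 0 \<le> v (Q \<omega>)" "\<And>\<omega>. \<omega> \<in> H \<Longrightarrow> v (Q \<omega>) \<le> c" and l: "\<And>\<omega>. \<omega> \<in> H \<Longrightarrow> 0 \<le> l (Q \<omega>)"
  shows "(\<integral>\<^sup>+\<omega>. indicator H \<omega> * (ennreal (v (Q \<omega>)) * indicator {\<omega>. T n \<omega> + ereal (l (Q \<omega>)) < T (Suc n) \<omega>} \<omega>) \<partial>M) =
    (\<integral>\<^sup>+\<omega>. indicator H \<omega> * ennreal (v (Q \<omega>) * mass (linear_flow X (l (Q \<omega>)) (Y n \<omega>))) \<partial>M)"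
proof -
  have HM [measurable]: "H \<in> sets M" by (rule sets_hist_le[OF H(1)])
  have Hsp: "H \<subseteq> space M" by (rule sets.sets_into_space[OF HM])
  have QM [measurable]: "Q \<in> borel_measurable M" by (rule measurable_hist_le[OF Q])
  let ?m = "\<lambda>\<omega>. mass (linear_flow X (l (Q \<omega>)) (Y n \<omega>))"
  let ?I = "\<integral>\<^sup>+\<omega>. indicator H \<omega> * (ennreal (v (Q \<omega>)) * indicator {\<omega>. T n \<omega> + ereal (l (Q \<omega>)) < T (Suc n) \<omega>} \<omega>) \<partial>M"
  let ?K = "\<integral>\<^sup>+\<omega>. indicator H \<omega> * indicator {\<omega>. T (Suc n) \<omega> < \<infinity>} \<omega> * (ennreal (v (Q \<omega>)) * indicator {..l (Q \<omega>)} (gap n \<omega>)) \<partial>M"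
  have K: "?K = (\<integral>\<^sup>+\<omega>. indicator H \<omega> * ennreal (v (Q \<omega>) * (1 - ?m \<omega>)) \<partial>M)"
  proof -
    let ?h = "\<lambda>(q, s, y::('p,'m) state). ennreal (v q) * indicator {..l q} s"
    have [measurable]: "?h \<in> borel_measurable borel" unfolding split_beta' atMost_def borel_prod[symmetric] by measurable
    have "?K = (\<integral>\<^sup>+\<omega>. indicator H \<omega> * (\<integral>\<^sup>+u. (\<Sum>\<kappa>\<in>J. indicator {0..} u *
        (ennreal (rate n \<kappa> u \<omega>) * ?h (Q \<omega>, u, dest n \<kappa> u \<omega>))) \<partial>lborel) \<partial>M)"
      using next_jump[OF H Q, of ?h] by simp
    also have "\<dots> = (\<integral>\<^sup>+\<omega>. indicator H \<omega> * ennreal (v (Q \<omega>) * (1 - ?m \<omega>)) \<partial>M)"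
    proof (rule nn_integral_cong)
      fix \<omega> assume w: "\<omega> \<in> space M"
      show "indicator H \<omega> * (\<integral>\<^sup>+u. (\<Sum>\<kappa>\<in>J. indicator {0..} u *
        (ennreal (rate n \<kappa> u \<omega>) * ?h (Q \<omega>, u, dest n \<kappa> u \<omega>))) \<partial>lborel) = indicator H \<omega> * ennreal (v (Q \<omega>) * (1 - ?m \<omega>))"
      proof (cases "\<omega> \<in> H")
        case True
        have "(\<integral>\<^sup>+u. (\<Sum>\<kappa>\<in>J. indicator {0..} u * (ennreal (rate n \<kappa> u \<omega>) * ?h (Q \<omega>, u, dest n \<kappa> u \<omega>))) \<partial>lborel) =
          (\<integral>\<^sup>+u. ennreal (v (Q \<omega>)) * (\<Sum>\<kappa>\<in>J. indicator {0..l (Q \<omega>)} u * (ennreal (rate n \<kappa> u \<omega>) * indicator UNIV (dest n \<kappa> u \<omega>))) \<partial>lborel)"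
          by (intro nn_integral_cong) (auto simp: sum_distrib_left indicator_def mult_ac intro!: sum.cong)
        also have "\<dots> = ennreal (v (Q \<omega>)) * ennreal (jump_kernel X (Y n \<omega>) (l (Q \<omega>)) UNIV)"
          by (subst jump_kernel_nn_integral[OF Y_states[OF w]], simp, subst nn_integral_cmult) simp_all
        also have "\<dots> = ennreal (v (Q \<omega>) * (1 - ?m \<omega>))"
          using v(1)[OF True] by (simp add: jump_kernel_UNIV[OF Y_states[OF w] l[OF True]] ennreal_mult')
        finally show ?thesis by simp
      qed simp
    qed
    finally show ?thesis .
  qed
  have tot: "(\<integral>\<^sup>+\<omega>. indicator H \<omega> * ennreal (v (Q \<omega>)) \<partial>M) = ?K + ?I"
  proof -
    have "(\<integral>\<^sup>+\<omega>. indicator H \<omega> * ennreal (v (Q \<omega>)) \<partial>M) = (\<integral>\<^sup>+\<omega>. indicator H \<omega> * indicator {\<omega>. T (Suc n) \<omega> < \<infinity>} \<omega> * (ennreal (v (Q \<omega>)) * indicator {..l (Q \<omega>)} (gap n \<omega>)) +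
      indicator H \<omega> * (ennreal (v (Q \<omega>)) * indicator {\<omega>. T n \<omega> + ereal (l (Q \<omega>)) < T (Suc n) \<omega>} \<omega>) \<partial>M)"
    proof (rule nn_integral_cong)
      fix \<omega> assume w: "\<omega> \<in> space M"
      have "T (Suc n) \<omega> < \<infinity> \<and> gap n \<omega> \<le> l (Q \<omega>) \<longleftrightarrow> \<not> T n \<omega> + ereal (l (Q \<omega>)) < T (Suc n) \<omega>" if h: "\<omega> \<in> H"
      proof -
        obtain r where r: "T n \<omega> = ereal r" using ereal_t[OF w H(2)[OF h]] by metis
        show ?thesis
          using T_nonneg[OF w, of "Suc n"] by (cases "T (Suc n) \<omega>") (auto simp: r)
      qed
      then show "indicator H \<omega> * ennreal (v (Q \<omega>)) = indicator H \<omega> * indicator {\<omega>. T (Suc n) \<omega> < \<infinity>} \<omega> * (ennreal (v (Q \<omega>)) * indicator {..l (Q \<omega>)} (gap n \<omega>)) +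
      indicator H \<omega> * (ennreal (v (Q \<omega>)) * indicator {\<omega>. T n \<omega> + ereal (l (Q \<omega>)) < T (Suc n) \<omega>} \<omega>)"
        by (auto simp: indicator_def)
    qed
    also have "\<dots> = ?K + ?I"
      unfolding atMost_def by (intro nn_integral_add) measurable
    finally show ?thesis .
  qed
  have split: "(\<integral>\<^sup>+\<omega>. indicator H \<omega> * ennreal (v (Q \<omega>)) \<partial>M) =
     (\<integral>\<^sup>+\<omega>. indicator H \<omega> * ennreal (v (Q \<omega>) * (1 - ?m \<omega>)) \<partial>M) + (\<integral>\<^sup>+\<omega>. indicator H \<omega> * ennreal (v (Q \<omega>) * ?m \<omega>) \<partial>M)"
  proof -
    have "(\<integral>\<^sup>+\<omega>. indicator H \<omega> * ennreal (v (Q \<omega>)) \<partial>M) =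
      (\<integral>\<^sup>+\<omega>. indicator H \<omega> * ennreal (v (Q \<omega>) * (1 - ?m \<omega>)) + indicator H \<omega> * ennreal (v (Q \<omega>) * ?m \<omega>) \<partial>M)"
    proof (rule nn_integral_cong)
      fix \<omega> assume w: "\<omega> \<in> space M"
      show "indicator H \<omega> * ennreal (v (Q \<omega>)) = indicator H \<omega> * ennreal (v (Q \<omega>) * (1 - ?m \<omega>)) + indicator H \<omega> * ennreal (v (Q \<omega>) * ?m \<omega>)"
      proof (cases "\<omega> \<in> H")
        case True
        have "0 \<le> ?m \<omega>" using linear_flow_mass_pos[OF Y_states[OF w] l[OF True]] by (rule less_imp_le)
        moreover have "0 \<le> 1 - ?m \<omega>"
          using jump_kernel_nonneg[OF Y_states[OF w]] jump_kernel_UNIV[OF Y_states[OF w] l[OF True]] by metis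
        ultimately have "ennreal (v (Q \<omega>) * (1 - ?m \<omega>) + v (Q \<omega>) * ?m \<omega>) =
            ennreal (v (Q \<omega>) * (1 - ?m \<omega>)) + ennreal (v (Q \<omega>) * ?m \<omega>)"
          using v(1)[OF True] by (intro ennreal_plus mult_nonneg_nonneg)
        moreover have "v (Q \<omega>) * (1 - ?m \<omega>) + v (Q \<omega>) * ?m \<omega> = v (Q \<omega>)" by (simp add: algebra_simps)
        ultimately show ?thesis using True by simp
      qed simp
    qed
    also have "\<dots> = (\<integral>\<^sup>+\<omega>. indicator H \<omega> * ennreal (v (Q \<omega>) * (1 - ?m \<omega>)) \<partial>M) + (\<integral>\<^sup>+\<omega>. indicator H \<omega> * ennreal (v (Q \<omega>) * ?m \<omega>) \<partial>M)"
      by (intro nn_integral_add) measurable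
    finally show ?thesis .
  qed
  have "?K \<le> (\<integral>\<^sup>+\<omega>. ennreal c \<partial>M)"
    by (intro nn_integral_mono) (use v(2) in \<open>auto simp: indicator_def intro!: ennreal_leI\<close>)
  also have "\<dots> < \<infinity>" by (simp add: emeasure_space_1)
  finally have "?K \<noteq> \<infinity>" by simp
  moreover have "?K + ?I = ?K + (\<integral>\<^sup>+\<omega>. indicator H \<omega> * ennreal (v (Q \<omega>) * ?m \<omega>) \<partial>M)"
    using tot split K by metis
  ultimately show ?thesis unfolding ennreal_add_left_cancel by blast
qed

end

section \<open>Exponential decay of uninterrupted upward periods\<close>

text \<open>
  Versions of the fundamental theorem for one-sided derivatives at the end points; the iterates satisfy their
  differential equations only on the closed half-line.
\<close>

lemma nn_integral_FTC_Icc_within: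
  fixes f F :: "real \<Rightarrow> real"
  assumes ab: "a \<le> b" and F: "\<And>x. a \<le> x \<Longrightarrow> x \<le> b \<Longrightarrow> (F has_vector_derivative f x) (at x within {a..b})"
    and f: "continuous_on {a..b} f" and nonneg: "\<And>x. a \<le> x \<Longrightarrow> x \<le> b \<Longrightarrow> 0 \<le> f x"
  shows "(\<integral>\<^sup>+x. indicator {a..b} x * ennreal (f x) \<partial>lborel) = ennreal (F b - F a)"
proof -
  have "(\<integral>\<^sup>+x. indicator {a..b} x * ennreal (f x) \<partial>lborel) = (\<integral>\<^sup>+x. ennreal (indicator {a..b} x *\<^sub>R f x) \<partial>lborel)"
    by (intro nn_integral_cong) (auto simp: indicator_def)
  also have "\<dots> = ennreal (\<integral>x. indicator {a..b} x *\<^sub>R f x \<partial>lborel)"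
    by (rule nn_integral_eq_integral[OF borel_integrable_atLeastAtMost'[OF f, unfolded set_integrable_def]])
       (auto simp: indicator_def nonneg)
  also have "(\<integral>x. indicator {a..b} x *\<^sub>R f x \<partial>lborel) = F b - F a"
    by (rule integral_FTC_atLeastAtMost[OF ab F f])
  finally show ?thesis .
qed

lemma nn_integral_FTC_atLeast_within:
  fixes f F :: "real \<Rightarrow> real"
  assumes F: "\<And>x. 0 \<le> x \<Longrightarrow> (F has_vector_derivative f x) (at x within {0..})"
    and f: "continuous_on {0..} f" and nonneg: "\<And>x. 0 \<le> x \<Longrightarrow> 0 \<le> f x" and lim: "(F \<longlongrightarrow> l) at_top"
  shows "(\<integral>\<^sup>+x. indicator {0..} x * ennreal (f x) \<partial>lborel) = ennreal (l - F 0)"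
proof -
  have Icc: "(\<integral>\<^sup>+x. indicator {0..real n} x * ennreal (f x) \<partial>lborel) = ennreal (F (real n) - F 0)" for n
    by (rule nn_integral_FTC_Icc_within)
       (auto intro: has_vector_derivative_within_subset[OF F] continuous_on_subset[OF f] nonneg)
  have sup: "(SUP n. indicator {0..real n} x * ennreal (f x)) = indicator {0..} x * ennreal (f x)" for x
  proof (rule SUP_eqI)
    show "indicator {0..real n} x * ennreal (f x) \<le> indicator {0..} x * ennreal (f x)" for n by (auto simp: indicator_def)
    fix y assume y: "\<And>n. n \<in> UNIV \<Longrightarrow> indicator {0..real n} x * ennreal (f x) \<le> y"
    obtain n where "x \<le> real n" using real_arch_simple by blast
    then show "indicator {0..} x * ennreal (f x) \<le> y" using y[of n] by (auto simp: indicator_def split: if_splits)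
  qed
  have m: "(\<lambda>x. indicator {0..real n} x * ennreal (f x)) \<in> borel_measurable lborel" for n
  proof -
    have "(\<lambda>x. indicator {0..real n} x *\<^sub>R f x) \<in> borel_measurable borel"
      by (rule borel_measurable_continuous_on_indicator) (auto intro: continuous_on_subset[OF f])
    then have "(\<lambda>x. ennreal (indicator {0..real n} x *\<^sub>R f x)) \<in> borel_measurable lborel" by simp
    moreover have "ennreal (indicator {0..real n} x *\<^sub>R f x) = indicator {0..real n} x * ennreal (f x)" for x
      by (auto simp: indicator_def)
    ultimately show ?thesis by simp
  qed
  have inc: "incseq (\<lambda>n x. indicator {0..real n} x * ennreal (f x))"
    by (auto simp: incseq_def le_fun_def indicator_def)
  have "(\<integral>\<^sup>+x. indicator {0..} x * ennreal (f x) \<partial>lborel) = (\<integral>\<^sup>+x. (SUP n. indicator {0..real n} x * ennreal (f x)) \<partial>lborel)"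
    by (simp only: sup)
  also have "\<dots> = (SUP n. \<integral>\<^sup>+x. indicator {0..real n} x * ennreal (f x) \<partial>lborel)"
    by (rule nn_integral_monotone_convergence_SUP[OF inc m])
  finally have eq: "(\<integral>\<^sup>+x. indicator {0..} x * ennreal (f x) \<partial>lborel) = (SUP n. ennreal (F (real n) - F 0))"
    by (simp only: Icc)
  have "incseq (\<lambda>n. ennreal (F (real n) - F 0))"
    unfolding Icc[symmetric] by (intro incseq_SucI nn_integral_mono le_funD[OF incseq_SucD[OF inc]])
  then have "(\<lambda>n. ennreal (F (real n) - F 0)) \<longlonglongrightarrow> (SUP n. ennreal (F (real n) - F 0))" by (rule LIMSEQ_SUP)
  moreover have "(\<lambda>n. ennreal (F (real n) - F 0)) \<longlonglongrightarrow> ennreal (l - F 0)"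
    by (intro tendsto_ennrealI tendsto_diff tendsto_const filterlim_compose[OF lim filterlim_real_sequentially])
  ultimately show ?thesis unfolding eq by (rule LIMSEQ_unique)
qed

context rap_data
begin

text \<open>
  For a linear function of the destination the normalization cancels against the rate, and the sum over all
  jumps becomes an expression in the full matrices.
\<close>

lemma sum_jumps_linear:
  assumes z: "z \<in> state_cone" and w: "w \<in> dual_cone Zp" "w' \<in> dual_cone Zm"
  shows "(\<Sum>\<kappa>\<in>J. ennreal (mass (jump_map X \<kappa> z)) *
      ennreal (fst (normalize_state (jump_map X \<kappa> z)) \<bullet> w + snd (normalize_state (jump_map X \<kappa> z)) \<bullet> w')) =
    ennreal ((fst z v* Bp + snd z v* Dmp X) \<bullet> w + (fst z v* Dpm X + snd z v* Bm) \<bullet> w')"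
proof -
  let ?f = "\<lambda>\<kappa>. fst (jump_map X \<kappa> z) \<bullet> w + snd (jump_map X \<kappa> z) \<bullet> w'"
  have "ennreal (mass (jump_map X \<kappa> z)) *
      ennreal (fst (normalize_state (jump_map X \<kappa> z)) \<bullet> w + snd (normalize_state (jump_map X \<kappa> z)) \<bullet> w') = ennreal (?f \<kappa>) \<and> 0 \<le> ?f \<kappa>"
    if k: "\<kappa> \<in> J" for \<kappa>
  proof
    let ?N = "jump_map X \<kappa> z"
    have N: "?N \<in> state_cone" by (rule jump_map_cone[OF z k])
    have "ennreal (mass ?N) * ennreal (fst (normalize_state ?N) \<bullet> w + snd (normalize_state ?N) \<bullet> w') =
        ennreal (mass ?N * (fst (normalize_state ?N) \<bullet> w + snd (normalize_state ?N) \<bullet> w'))"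
      by (rule ennreal_mult'[OF cone_mass_nonneg[OF N], symmetric])
    also have "mass ?N * (fst (normalize_state ?N) \<bullet> w + snd (normalize_state ?N) \<bullet> w') =
        fst (mass ?N *\<^sub>R normalize_state ?N) \<bullet> w + snd (mass ?N *\<^sub>R normalize_state ?N) \<bullet> w'"
      by (simp add: distrib_left)
    also have "\<dots> = ?f \<kappa>" by (simp only: cone_normalize[OF N])
    finally show "ennreal (mass ?N) * ennreal (fst (normalize_state ?N) \<bullet> w + snd (normalize_state ?N) \<bullet> w') = ennreal (?f \<kappa>)" .
    show "0 \<le> ?f \<kappa>" by (intro add_nonneg_nonneg cone_inner_nonneg[OF N] w)
  qed
  then have "(\<Sum>\<kappa>\<in>J. ennreal (mass (jump_map X \<kappa> z)) *
      ennreal (fst (normalize_state (jump_map X \<kappa> z)) \<bullet> w + snd (normalize_state (jump_map X \<kappa> z)) \<bullet> w')) = ennreal (\<Sum>\<kappa>\<in>J. ?f \<kappa>)"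
    by (subst sum_ennreal[symmetric]) auto
  also have "(\<Sum>\<kappa>\<in>J. ?f \<kappa>) = fst (\<Sum>\<kappa>\<in>J. jump_map X \<kappa> z) \<bullet> w + snd (\<Sum>\<kappa>\<in>J. jump_map X \<kappa> z) \<bullet> w'"
    by (simp add: sum.distrib fst_sum snd_sum inner_sum_left)
  finally show ?thesis by (simp add: sum_jump_map)
qed

lemma Cp_exp_positive: "exp_positive Zp (Gp + Bp)"
  by (rule P.exp_positive_add[OF exp_positive_Gamma[OF valid_plus] Bp_pos])

lemma exp_Cp_one_le: "0 \<le> u \<Longrightarrow> 1 - mat_exp (u *\<^sub>R (Gp + Bp)) *v 1 \<in> dual_cone Zp"
proof (rule P.exp_one_le[OF Cp_exp_positive])
  have "- ((Gp + Bp) *v 1) = Dpm X *v 1"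
    using rows_zero(1) by (intro minus_unique) (simp add: mv.add_left)
  then show "- ((Gp + Bp) *v 1) \<in> dual_cone Zp"
    using cone_positiveD[OF Dpm_pos N.one_dual] by simp
qed

end

context pdmp_path
begin

lemma sgn_vals:
  assumes "\<omega> \<in> space M"
  shows "Y n \<omega> \<in> plus_states X \<Longrightarrow> fst (Y n \<omega>) \<bullet> 1 = 1 \<and> snd (Y n \<omega>) = 0"
    and "Y n \<omega> \<notin> plus_states X \<Longrightarrow> snd (Y n \<omega>) \<bullet> 1 = 1 \<and> fst (Y n \<omega>) = 0"
  using Y_states[OF assms, of n] by (auto simp: plus_states_def minus_states_def P.one N.one)

lemma measurable_fst_state [measurable (raw)]:
  "f \<in> borel_measurable N \<Longrightarrow> (\<lambda>x. fst (f x :: ('p,'m) state)) \<in> borel_measurable N"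
  and measurable_snd_state [measurable (raw)]:
  "f \<in> borel_measurable N \<Longrightarrow> (\<lambda>x. snd (f x :: ('p,'m) state)) \<in> borel_measurable N"
  by (erule measurable_compose; intro borel_measurable_continuous_onI continuous_intros)+

text \<open>
  On this event the process is still in the plus states after \<open>n\<close> jumps, all of them before time \<open>r\<close>. The orbit
  sets need not be Borel sets, so membership in \<open>plus_states X\<close> is expressed by \<open>fst z \<bullet> 1 = 1\<close>.
\<close>

definition staying :: "real \<Rightarrow> nat \<Rightarrow> 'w set" where
  "staying r n = {\<omega>\<in>space M. T n \<omega> \<le> ereal r \<and> (\<forall>i\<le>n. fst (Y i \<omega>) \<bullet> 1 = 1)}"

lemma staying_hist: "staying r n \<in> sets (hist n)"
proof -
  have eq1: "{\<omega>\<in>space (hist n). fst (Y i \<omega>) \<bullet> 1 = 1} \<in> sets (hist n)" if "i \<le> n" for i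
  proof -
    have [measurable]: "Y i \<in> borel_measurable (hist n)" by (rule Y_hist[OF that])
    show ?thesis by measurable
  qed
  have "{\<omega>\<in>space (hist n). T n \<omega> \<le> ereal r} \<in> sets (hist n)"
    using T_hist[of n n] by measurable
  moreover have "{\<omega>\<in>space (hist n). \<forall>i\<in>{..n}. fst (Y i \<omega>) \<bullet> 1 = 1} \<in> sets (hist n)"
    by (rule sets.sets_Collect_finite_All) (rule eq1, simp, simp)
  moreover have "staying r n = {\<omega>\<in>space (hist n). T n \<omega> \<le> ereal r} \<inter> {\<omega>\<in>space (hist n). \<forall>i\<in>{..n}. fst (Y i \<omega>) \<bullet> 1 = 1}"
    by (auto simp: staying_def)
  ultimately show ?thesis by auto
qed

abbreviation "survive u \<equiv> mat_exp (u *\<^sub>R (Gp + Bp)) *v 1"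

text \<open>
  The vector \<open>survive u\<close> satisfies \<open>a \<bullet> survive u = mass at u + contributions of the next jump\<close>, by variation
  of constants around \<open>Gp\<close>. Jumps to the minus states drop out, since \<open>fst\<close> of such states is zero.
\<close>

lemma staying_step:
  assumes r: "0 \<le> r"
  shows "(\<integral>\<^sup>+\<omega>. indicator (staying r n) \<omega> * ennreal (fst (Y n \<omega>) \<bullet> survive (r - t n \<omega>)) \<partial>M) =
    emeasure M {\<omega> \<in> staying r n. ereal r < T (Suc n) \<omega>} +
    (\<integral>\<^sup>+\<omega>. indicator (staying r (Suc n)) \<omega> * ennreal (fst (Y (Suc n) \<omega>) \<bullet> survive (r - t (Suc n) \<omega>)) \<partial>M)"
proof -
  let ?H = "staying r n" and ?Q = "\<lambda>\<omega>. (Y n \<omega>, r - t n \<omega>)"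
  have H: "?H \<in> sets (hist n)" "\<And>\<omega>. \<omega> \<in> ?H \<Longrightarrow> T n \<omega> < \<infinity>"
    using staying_hist by (auto simp: staying_def)
  have HM [measurable]: "?H \<in> sets M" by (rule sets_hist_le[OF H(1)])
  have H'M [measurable]: "staying r (Suc n) \<in> sets M" by (rule sets_hist_le[OF staying_hist])
  have Hsp: "?H \<subseteq> space M" by (auto simp: staying_def)
  have Q: "?Q \<in> borel_measurable (hist n)"
    using T_hist[of n n] Y_hist[of n n] by measurable
  have tr: "t n \<omega> \<le> r" if "\<omega> \<in> ?H" for \<omega>
    using that ereal_t[of \<omega> n] H(2)[OF that] by (auto simp: staying_def simp flip: ereal_less_eq(3))
  have pl: "Y n \<omega> \<in> plus_states X" if "\<omega> \<in> ?H" for \<omega>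
    using that plus_iff[OF Y_states, of \<omega> n] by (auto simp: staying_def)
  let ?m = "\<lambda>\<omega>. mass (linear_flow X (r - t n \<omega>) (Y n \<omega>))"
  have A: "(\<integral>\<^sup>+\<omega>. indicator ?H \<omega> * ennreal (?m \<omega>) \<partial>M) = emeasure M {\<omega> \<in> ?H. ereal r < T (Suc n) \<omega>}"
  proof -
    have "(\<integral>\<^sup>+\<omega>. indicator ?H \<omega> * ennreal (1 * ?m \<omega>) \<partial>M) =
      (\<integral>\<^sup>+\<omega>. indicator ?H \<omega> * (ennreal 1 * indicator {\<omega>. T n \<omega> + ereal (snd (?Q \<omega>)) < T (Suc n) \<omega>} \<omega>) \<partial>M)"
      using no_jump_before[OF H Q, of "\<lambda>_. 1" snd 1] tr by (simp add: borel_measurable_continuous_onI continuous_on_snd)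
    also have "\<dots> = (\<integral>\<^sup>+\<omega>. indicator {\<omega> \<in> ?H. ereal r < T (Suc n) \<omega>} \<omega> \<partial>M)"
    proof (rule nn_integral_cong)
      fix \<omega> assume w: "\<omega> \<in> space M"
      have "T n \<omega> + ereal (r - t n \<omega>) = ereal r" if h: "\<omega> \<in> ?H"
      proof -
        obtain q where "T n \<omega> = ereal q" using ereal_t[OF w H(2)[OF h]] by metis
        then show ?thesis by simp
      qed
      then show "indicator ?H \<omega> * (ennreal 1 * indicator {\<omega>. T n \<omega> + ereal (snd (?Q \<omega>)) < T (Suc n) \<omega>} \<omega>) =
        (indicator {\<omega> \<in> ?H. ereal r < T (Suc n) \<omega>} \<omega> :: ennreal)"
        by (auto simp: indicator_def)
    qed
    also have "\<dots> = emeasure M {\<omega> \<in> ?H. ereal r < T (Suc n) \<omega>}"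
    proof (rule nn_integral_indicator)
      have "{\<omega> \<in> ?H. ereal r < T (Suc n) \<omega>} = ?H \<inter> {\<omega> \<in> space M. ereal r < T (Suc n) \<omega>}" using Hsp by auto
      then show "{\<omega> \<in> ?H. ereal r < T (Suc n) \<omega>} \<in> sets M" by simp
    qed
    finally show ?thesis by simp
  qed
  let ?h = "\<lambda>(q :: ('p,'m) state \<times> real, s, y :: ('p,'m) state). indicator {..snd q} s * ennreal (fst y \<bullet> survive (snd q - s))"
  have hm: "?h \<in> borel_measurable borel"
  proof -
    let ?N = "(borel \<Otimes>\<^sub>M borel) \<Otimes>\<^sub>M (borel \<Otimes>\<^sub>M borel) :: ((('p,'m) state \<times> real) \<times> real \<times> ('p,'m) state) measure"
    have [measurable]: "(\<lambda>x. fst (snd (snd x))) \<in> borel_measurable ?N"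
      by (rule measurable_fst_state) measurable
    have [measurable]: "(\<lambda>x. survive (snd (fst x) - fst (snd x))) \<in> borel_measurable ?N"
      by (rule measurable_compose[where g=survive and N=borel])
        (measurable, intro borel_measurable_continuous_onI mv.continuous_on continuous_intros)
    have "?h \<in> borel_measurable ?N" unfolding split_beta' atMost_def by measurable
    then show ?thesis unfolding borel_prod .
  qed
  have B: "(\<integral>\<^sup>+\<omega>. indicator (staying r (Suc n)) \<omega> * ennreal (fst (Y (Suc n) \<omega>) \<bullet> survive (r - t (Suc n) \<omega>)) \<partial>M) =
     (\<integral>\<^sup>+\<omega>. indicator ?H \<omega> * ennreal (fst (Y n \<omega>) \<bullet> survive (r - t n \<omega>) - ?m \<omega>) \<partial>M)"
  proof -
    have "(\<integral>\<^sup>+\<omega>. indicator (staying r (Suc n)) \<omega> * ennreal (fst (Y (Suc n) \<omega>) \<bullet> survive (r - t (Suc n) \<omega>)) \<partial>M) =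
      (\<integral>\<^sup>+\<omega>. indicator ?H \<omega> * indicator {\<omega>. T (Suc n) \<omega> < \<infinity>} \<omega> * ?h (?Q \<omega>, gap n \<omega>, Y (Suc n) \<omega>) \<partial>M)"
    proof (rule nn_integral_cong)
      fix \<omega> assume w: "\<omega> \<in> space M"
      have "T n \<omega> \<le> ereal r \<and> T (Suc n) \<omega> < \<infinity> \<and> t (Suc n) \<omega> \<le> r \<longleftrightarrow> T (Suc n) \<omega> \<le> ereal r"
      proof
        assume "T n \<omega> \<le> ereal r \<and> T (Suc n) \<omega> < \<infinity> \<and> t (Suc n) \<omega> \<le> r"
        then show "T (Suc n) \<omega> \<le> ereal r" using ereal_t[OF w, of "Suc n"] by (metis ereal_less_eq(3))
      next
        assume le: "T (Suc n) \<omega> \<le> ereal r"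
        then have "T (Suc n) \<omega> < \<infinity>" by (rule le_less_trans) simp
        then show "T n \<omega> \<le> ereal r \<and> T (Suc n) \<omega> < \<infinity> \<and> t (Suc n) \<omega> \<le> r"
          using ereal_t[OF w, of "Suc n"] le order_trans[OF T_Suc_ge[OF w] le] by (metis ereal_less_eq(3))
      qed
      then have st: "\<omega> \<in> staying r (Suc n) \<longleftrightarrow> \<omega> \<in> ?H \<and> T (Suc n) \<omega> < \<infinity> \<and> gap n \<omega> \<le> r - t n \<omega> \<and> fst (Y (Suc n) \<omega>) \<bullet> 1 = 1"
        by (auto simp: staying_def le_Suc_eq)
      show "indicator (staying r (Suc n)) \<omega> * ennreal (fst (Y (Suc n) \<omega>) \<bullet> survive (r - t (Suc n) \<omega>)) =
        indicator ?H \<omega> * indicator {\<omega>. T (Suc n) \<omega> < \<infinity>} \<omega> * ?h (?Q \<omega>, gap n \<omega>, Y (Suc n) \<omega>)"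
      proof (cases "Y (Suc n) \<omega> \<in> plus_states X")
        case True
        then show ?thesis using sgn_vals(1)[OF w True] by (auto simp: indicator_def st)
      next
        case False
        then show ?thesis using sgn_vals(2)[OF w False] by (auto simp: indicator_def)
      qed
    qed
    also have "\<dots> = (\<integral>\<^sup>+\<omega>. indicator ?H \<omega> * (\<integral>\<^sup>+u. (\<Sum>\<kappa>\<in>J. indicator {0..} u *
        (ennreal (rate n \<kappa> u \<omega>) * ?h (?Q \<omega>, u, dest n \<kappa> u \<omega>))) \<partial>lborel) \<partial>M)"
      by (rule next_jump[OF H Q hm])
    also have "\<dots> = (\<integral>\<^sup>+\<omega>. indicator ?H \<omega> * ennreal (fst (Y n \<omega>) \<bullet> survive (r - t n \<omega>) - ?m \<omega>) \<partial>M)"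
    proof (rule nn_integral_cong)
      fix \<omega> assume w: "\<omega> \<in> space M"
      show "indicator ?H \<omega> * (\<integral>\<^sup>+u. (\<Sum>\<kappa>\<in>J. indicator {0..} u *
        (ennreal (rate n \<kappa> u \<omega>) * ?h (?Q \<omega>, u, dest n \<kappa> u \<omega>))) \<partial>lborel) =
        indicator ?H \<omega> * ennreal (fst (Y n \<omega>) \<bullet> survive (r - t n \<omega>) - ?m \<omega>)"
      proof (cases "\<omega> \<in> ?H")
        case True
        define a where "a = fst (Y n \<omega>)"
        define l where "l = r - t n \<omega>"
        have l: "0 \<le> l" using tr[OF True] by (simp add: l_def)
        have s0: "snd (Y n \<omega>) = 0" using sgn_vals(1)[OF w pl[OF True]] by simp
        let ?k = "\<lambda>u. a \<bullet> ((mat_exp (u *\<^sub>R Gp) ** Bp) *v survive (l - u))"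
        have sum: "(\<Sum>\<kappa>\<in>J. indicator {0..} u * (ennreal (rate n \<kappa> u \<omega>) * ?h (?Q \<omega>, u, dest n \<kappa> u \<omega>))) =
           indicator {0..l} u * ennreal (?k u)" and k0: "u \<in> {0..l} \<Longrightarrow> 0 \<le> ?k u" for u
        proof -
          have E: "linear_flow X u (Y n \<omega>) \<in> state_cone" "survive (l - u) \<in> dual_cone Zp" if "u \<in> {0..l}"
            using that linear_flow_cone[OF Y_states[OF w], of u] cone_positiveD[OF exp_positiveD[OF Cp_exp_positive] P.one_dual, of "l - u"]
            by auto
          have eq: "(fst (linear_flow X u (Y n \<omega>)) v* Bp + snd (linear_flow X u (Y n \<omega>)) v* Dmp X) \<bullet> survive (l - u) = ?k u"
            by (simp add: linear_flow_def s0 a_def dot_lmul_matrix matrix_vector_mul_assoc matrix_mul_assoc)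
          show "(\<Sum>\<kappa>\<in>J. indicator {0..} u * (ennreal (rate n \<kappa> u \<omega>) * ?h (?Q \<omega>, u, dest n \<kappa> u \<omega>))) =
             indicator {0..l} u * ennreal (?k u)"
          proof (cases "u \<in> {0..l}")
            case u: True
            have "(\<Sum>\<kappa>\<in>J. indicator {0..} u * (ennreal (rate n \<kappa> u \<omega>) * ?h (?Q \<omega>, u, dest n \<kappa> u \<omega>))) =
              (\<Sum>\<kappa>\<in>J. ennreal (rate n \<kappa> u \<omega>) * ennreal (fst (dest n \<kappa> u \<omega>) \<bullet> survive (l - u) + snd (dest n \<kappa> u \<omega>) \<bullet> 0))"
              using u by (intro sum.cong) (auto simp: l_def)
            also have "\<dots> = ennreal (?k u)"
              using sum_jumps_linear[OF E(1)[OF u] E(2)[OF u] dual_cone_0] by (simp add: eq)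
            finally show ?thesis using u by simp
          next
            case False
            then show ?thesis by (auto simp: indicator_def l_def intro!: sum.neutral)
          qed
          show "0 \<le> ?k u" if u: "u \<in> {0..l}"
          proof -
            have "(mat_exp (u *\<^sub>R Gp) ** Bp) *v survive (l - u) \<in> dual_cone Zp"
              using u by (intro cone_positiveD[OF cone_positive_mult[OF exp_positiveD[OF exp_positive_Gamma[OF valid_plus]] Bp_pos]] E) auto
            then show ?thesis using pl[OF True] by (auto simp: dual_cone_def a_def plus_states_def)
          qed
        qed
        have D: "((\<lambda>u. - (a \<bullet> (mat_exp (u *\<^sub>R Gp) *v survive (l - u)))) has_vector_derivative ?k u) (at u within {0..l})" for u
        proof -
          have 1: "((\<lambda>u. mat_exp (u *\<^sub>R Gp) ** mat_exp ((l - u) *\<^sub>R (Gp + Bp))) has_vector_derivative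
            mat_exp (u *\<^sub>R Gp) ** - (mat_exp ((l - u) *\<^sub>R (Gp + Bp)) ** (Gp + Bp)) +
            (mat_exp (u *\<^sub>R Gp) ** Gp) ** mat_exp ((l - u) *\<^sub>R (Gp + Bp))) (at u within {0..l})"
            by (intro mm.has_vector_derivative mat_exp_deriv_affine mat_exp_deriv_left)
          have 2: "mat_exp (u *\<^sub>R Gp) ** - (mat_exp ((l - u) *\<^sub>R (Gp + Bp)) ** (Gp + Bp)) +
            (mat_exp (u *\<^sub>R Gp) ** Gp) ** mat_exp ((l - u) *\<^sub>R (Gp + Bp)) =
            - ((mat_exp (u *\<^sub>R Gp) ** Bp) ** mat_exp ((l - u) *\<^sub>R (Gp + Bp)))"
          proof -
            have "mat_exp ((l - u) *\<^sub>R (Gp + Bp)) ** (Gp + Bp) = (Gp + Bp) ** mat_exp ((l - u) *\<^sub>R (Gp + Bp))"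
              by (rule mat_exp_commute[symmetric])
            then show ?thesis
              by (simp add: mm.add_left mm.add_right mm.minus_right mm.diff_right matrix_mul_assoc)
          qed
          from bounded_linear.has_vector_derivative[OF bounded_linear_compose[OF bounded_linear_inner_right mv.bounded_linear_left] 1, of a 1]
          have "((\<lambda>u. a \<bullet> (mat_exp (u *\<^sub>R Gp) *v survive (l - u))) has_vector_derivative - ?k u) (at u within {0..l})"
            unfolding 2 by (simp add: matrix_vector_mul_assoc mv.minus_left)
          from has_vector_derivative_minus[OF this] show ?thesis by simp
        qed
        have "(\<integral>\<^sup>+u. (\<Sum>\<kappa>\<in>J. indicator {0..} u * (ennreal (rate n \<kappa> u \<omega>) * ?h (?Q \<omega>, u, dest n \<kappa> u \<omega>))) \<partial>lborel) =
          (\<integral>\<^sup>+u. indicator {0..l} u * ennreal (?k u) \<partial>lborel)"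
          by (intro nn_integral_cong sum)
        also have "\<dots> = ennreal (- (a \<bullet> (mat_exp (l *\<^sub>R Gp) *v survive (l - l))) - - (a \<bullet> (mat_exp (0 *\<^sub>R Gp) *v survive (l - 0))))"
          by (rule nn_integral_FTC_Icc_within[OF l D])
             (auto intro!: continuous_intros mm.continuous_on mv.continuous_on k0)
        also have "\<dots> = ennreal (fst (Y n \<omega>) \<bullet> survive (r - t n \<omega>) - ?m \<omega>)"
          by (simp add: a_def l_def mass_def linear_flow_def s0 dot_lmul_matrix)
        finally show ?thesis by simp
      qed simp
    qed
    finally show ?thesis .
  qed
  have [measurable]: "(\<lambda>\<omega>. fst (Y n \<omega>)) \<in> borel_measurable M"
    by (rule measurable_fst_state) simp
  have [measurable]: "(\<lambda>\<omega>. survive (r - t n \<omega>)) \<in> borel_measurable M"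
    by (rule measurable_compose[where g=survive and N=borel])
      (measurable, intro borel_measurable_continuous_onI mv.continuous_on continuous_intros)
  have [measurable]: "?m \<in> borel_measurable M"
    by (intro measurable_compose[OF _ borel_measurable_mass] borel_measurable_linear_flow) measurable
  have "(\<integral>\<^sup>+\<omega>. indicator ?H \<omega> * ennreal (fst (Y n \<omega>) \<bullet> survive (r - t n \<omega>)) \<partial>M) =
    (\<integral>\<^sup>+\<omega>. indicator ?H \<omega> * ennreal (?m \<omega>) + indicator ?H \<omega> * ennreal (fst (Y n \<omega>) \<bullet> survive (r - t n \<omega>) - ?m \<omega>) \<partial>M)"
  proof (rule nn_integral_cong)
    fix \<omega> assume w: "\<omega> \<in> space M"
    show "indicator ?H \<omega> * ennreal (fst (Y n \<omega>) \<bullet> survive (r - t n \<omega>)) =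
       indicator ?H \<omega> * ennreal (?m \<omega>) + indicator ?H \<omega> * ennreal (fst (Y n \<omega>) \<bullet> survive (r - t n \<omega>) - ?m \<omega>)"
    proof (cases "\<omega> \<in> ?H")
      case True
      have m: "0 < ?m \<omega>" using tr[OF True] by (intro linear_flow_mass_pos Y_states w) auto
      have "?m \<omega> \<le> fst (Y n \<omega>) \<bullet> survive (r - t n \<omega>)"
        using P.exp_one_mono[OF exp_positive_Gamma[OF valid_plus] Bp_pos, of "r - t n \<omega>"] tr[OF True] pl[OF True]
          sgn_vals(1)[OF w pl[OF True]]
        by (auto simp: dual_cone_def plus_states_def mass_def linear_flow_def dot_lmul_matrix inner_diff_right)
      then show ?thesis using m True by (simp add: ennreal_plus[symmetric] del: ennreal_plus)
    qed simp
  qed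
  also have "\<dots> = (\<integral>\<^sup>+\<omega>. indicator ?H \<omega> * ennreal (?m \<omega>) \<partial>M) + (\<integral>\<^sup>+\<omega>. indicator ?H \<omega> * ennreal (fst (Y n \<omega>) \<bullet> survive (r - t n \<omega>) - ?m \<omega>) \<partial>M)"
    by (intro nn_integral_add) measurable
  finally show ?thesis using A B by simp
qed

lemma find_interval:
  assumes w: "\<omega> \<in> space M" and r: "0 \<le> r"
  obtains n where "T n \<omega> \<le> ereal r" "ereal r < T (Suc n) \<omega>"
proof -
  have "\<forall>\<^sub>F n in sequentially. ereal r < T n \<omega>"
    using T_lim[OF w] by (rule order_tendstoD) simp
  then obtain n0 where n0: "ereal r < T n0 \<omega>" by (auto simp: eventually_sequentially)
  \<comment> \<open>the interval ends at the first jump after \<open>r\<close>\<close>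
  define n where "n = (LEAST n. ereal r < T n \<omega>)"
  have n: "ereal r < T n \<omega>" unfolding n_def by (rule LeastI[of _ n0]) (rule n0)
  have "n \<noteq> 0" using n T_0[OF w] r by (intro notI) simp
  then obtain m where m: "n = Suc m" by (cases n) auto
  then have "\<not> ereal r < T m \<omega>" unfolding n_def by (intro not_less_Least) (simp add: n_def)
  with n m show thesis by (intro that[of m]) auto
qed

lemma A_on_interval:
  assumes w: "\<omega> \<in> space M" and i: "T n \<omega> \<le> ereal r" "ereal r < T (Suc n) \<omega>"
  shows "A r \<omega> = flow X (r - t n \<omega>) (Y n \<omega>)" "t n \<omega> \<le> r" "T n \<omega> < \<infinity>"
    "A r \<omega> \<in> plus_states X \<longleftrightarrow> fst (Y n \<omega>) \<bullet> 1 = 1" "A r \<omega> \<in> minus_states X \<longleftrightarrow> snd (Y n \<omega>) \<bullet> 1 = 1"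
    "A r \<omega> \<in> S"
proof -
  show a: "A r \<omega> = flow X (r - t n \<omega>) (Y n \<omega>)" by (rule A_flow[OF w i])
  show f: "T n \<omega> < \<infinity>" using i(1) by (rule le_less_trans) simp
  show r: "t n \<omega> \<le> r" using ereal_t[OF w f] i(1) by (metis ereal_less_eq(3))
  then have u: "0 \<le> r - t n \<omega>" by simp
  show S: "A r \<omega> \<in> S" unfolding a by (rule flow_in_states[OF Y_states[OF w] u])
  show "A r \<omega> \<in> plus_states X \<longleftrightarrow> fst (Y n \<omega>) \<bullet> 1 = 1"
    using plus_iff[OF S] flow_fst[OF Y_states[OF w] u] by (simp only: a)
  show "A r \<omega> \<in> minus_states X \<longleftrightarrow> snd (Y n \<omega>) \<bullet> 1 = 1"
    using minus_iff[OF S] flow_snd[OF Y_states[OF w] u] by (simp only: a)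
qed

lemma staying_path:
  assumes r: "0 \<le> r"
  shows "{\<omega>\<in>space M. \<forall>s\<in>{0..r}. A s \<omega> \<in> plus_states X} = (\<Union>n. {\<omega> \<in> staying r n. ereal r < T (Suc n) \<omega>})"
proof safe
  fix \<omega> assume w: "\<omega> \<in> space M" and all: "\<forall>s\<in>{0..r}. A s \<omega> \<in> plus_states X"
  obtain n where n: "T n \<omega> \<le> ereal r" "ereal r < T (Suc n) \<omega>" by (rule find_interval[OF w r])
  have "fst (Y i \<omega>) \<bullet> 1 = 1" if "i \<le> n" for i
  proof -
    have le: "T i \<omega> \<le> ereal r" using T_mono[OF w that] n(1) by (rule order_trans)
    then have f: "T i \<omega> < \<infinity>" by (rule le_less_trans) simp
    have tr: "t i \<omega> \<le> r" using ereal_t[OF w f] le by (metis ereal_less_eq(3))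
    then have "A (t i \<omega>) \<omega> \<in> plus_states X" using all t_nonneg[OF w] by auto
    then show ?thesis using plus_iff[OF Y_states[OF w]] by (simp add: Y_eq[OF w])
  qed
  with n w show "\<omega> \<in> (\<Union>n. {\<omega> \<in> staying r n. ereal r < T (Suc n) \<omega>})" by (auto simp: staying_def)
next
  fix \<omega> n s assume st: "\<omega> \<in> staying r n" and lt: "ereal r < T (Suc n) \<omega>" and s: "s \<in> {0..r}"
  then have w: "\<omega> \<in> space M" by (simp add: staying_def)
  obtain i where i: "T i \<omega> \<le> ereal s" "ereal s < T (Suc i) \<omega>" by (rule find_interval[OF w, of s]) (use s in auto)
  have "i \<le> n"
  proof (rule ccontr)
    assume "\<not> i \<le> n"
    then have "T (Suc n) \<omega> \<le> T i \<omega>" by (intro T_mono[OF w]) auto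
    also have "\<dots> \<le> ereal r" using i(1) s by (auto intro: order_trans)
    finally show False using lt by simp
  qed
  then show "A s \<omega> \<in> plus_states X" using A_on_interval(4)[OF w i] st by (auto simp: staying_def)
qed (auto simp: staying_def)

lemma T_tail: "(\<lambda>n. emeasure M {\<omega>\<in>space M. T n \<omega> \<le> ereal r}) \<longlonglongrightarrow> 0"
proof -
  let ?E = "\<lambda>n. {\<omega>\<in>space M. T n \<omega> \<le> ereal r}"
  have "(\<lambda>n. emeasure M (?E n)) \<longlonglongrightarrow> emeasure M (\<Inter>n. ?E n)"
  proof (rule Lim_emeasure_decseq)
    show "range ?E \<subseteq> sets M" by auto
    show "decseq ?E" by (rule decseq_SucI) (auto intro: order_trans[OF T_Suc_ge])
  qed simp
  moreover have "(\<Inter>n. ?E n) = {}"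
  proof (rule equals0I)
    fix \<omega> assume e: "\<omega> \<in> (\<Inter>n. ?E n)"
    then have w: "\<omega> \<in> space M" by auto
    have "\<forall>\<^sub>F n in sequentially. ereal r < T n \<omega>" using T_lim[OF w] by (rule order_tendstoD) simp
    then obtain n where "ereal r < T n \<omega>" by (auto simp: eventually_sequentially)
    moreover have "T n \<omega> \<le> ereal r" using e by auto
    ultimately show False by simp
  qed
  ultimately show ?thesis by simp
qed

text \<open>
  Iterating \<open>staying_step\<close> leaves a remainder of at most the probability that \<open>n\<close> jumps occur before \<open>r\<close>, which
  vanishes since jumps do not accumulate.
\<close>

lemma staying_probability:
  assumes z0: "z0 = (\<alpha>, 0)" "\<alpha> \<in> Zp" and r: "0 \<le> r"
  shows "\<alpha> \<bullet> survive r \<le> measure M {\<omega>\<in>space M. \<forall>s\<in>{0..r}. A s \<omega> \<in> plus_states X}"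
proof -
  let ?S = "\<lambda>n. {\<omega> \<in> staying r n. ereal r < T (Suc n) \<omega>}"
  let ?R = "\<lambda>n. \<integral>\<^sup>+\<omega>. indicator (staying r n) \<omega> * ennreal (fst (Y n \<omega>) \<bullet> survive (r - t n \<omega>)) \<partial>M"
  have SM: "?S n \<in> sets M" for n
  proof -
    have [measurable]: "staying r n \<in> sets M" by (rule sets_hist_le[OF staying_hist])
    have "?S n = staying r n \<inter> {\<omega>\<in>space M. ereal r < T (Suc n) \<omega>}" by (auto simp: staying_def)
    then show ?thesis by simp
  qed
  have "?S m \<inter> ?S n = {}" if "m < n" for m n :: nat
  proof (rule equals0I)
    fix \<omega> assume "\<omega> \<in> ?S m \<inter> ?S n"
    then have a: "ereal r < T (Suc m) \<omega>" "T n \<omega> \<le> ereal r" "\<omega> \<in> space M" by (auto simp: staying_def)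
    have "T (Suc m) \<omega> \<le> T n \<omega>" using a(3) that by (intro T_mono) auto
    then show False using less_le_trans[OF a(1) order_trans[OF _ a(2)]] by simp
  qed
  note key = this
  have disj: "disjoint_family ?S"
    unfolding disjoint_family_on_def
  proof (intro ballI impI)
    fix m n :: nat assume "m \<noteq> n"
    then show "?S m \<inter> ?S n = {}" using key[of m n] key[of n m] by (cases "m < n") (simp, simp add: Int_commute)
  qed
  have R: "?R 0 = (\<Sum>i<n. emeasure M (?S i)) + ?R n" for n
  proof (induction n)
    case (Suc n)
    also have "(\<Sum>i<n. emeasure M (?S i)) + ?R n = (\<Sum>i<n. emeasure M (?S i)) + (emeasure M (?S n) + ?R (Suc n))"
      by (simp only: staying_step[OF r, of n])
    also have "\<dots> = (\<Sum>i<Suc n. emeasure M (?S i)) + ?R (Suc n)" by (simp only: sum.lessThan_Suc add.assoc)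
    finally show ?case .
  qed simp
  have R0: "?R 0 = ennreal (\<alpha> \<bullet> survive r)"
  proof -
    have "?R 0 = (\<integral>\<^sup>+\<omega>. ennreal (\<alpha> \<bullet> survive r) \<partial>M)"
    proof (rule nn_integral_cong_AE, use start AE_space in eventually_elim)
      case (elim \<omega>)
      have "Y 0 \<omega> = z0" using Y_eq[OF elim(2), of 0] T_0[OF elim(2)] elim(1) by simp
      moreover have "\<omega> \<in> staying r 0"
        using calculation T_0[OF elim(2)] r z0 elim(2) P.one[OF z0(2)] by (simp add: staying_def)
      ultimately show ?case using T_0[OF elim(2)] z0 by simp
    qed
    then show ?thesis by (simp add: emeasure_space_1)
  qed
  have Rn: "?R n \<le> emeasure M {\<omega>\<in>space M. T n \<omega> \<le> ereal r}" for n
  proof -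
    have "?R n \<le> (\<integral>\<^sup>+\<omega>. indicator {\<omega>\<in>space M. T n \<omega> \<le> ereal r} \<omega> \<partial>M)"
    proof (rule nn_integral_mono)
      fix \<omega> assume w: "\<omega> \<in> space M"
      have "fst (Y n \<omega>) \<bullet> survive (r - t n \<omega>) \<le> 1" if st: "\<omega> \<in> staying r n"
      proof -
        have le: "T n \<omega> \<le> ereal r" using st by (simp add: staying_def)
        then have "T n \<omega> < \<infinity>" by (rule le_less_trans) simp
        then have "t n \<omega> \<le> r" using ereal_t[OF w, of n] le by (metis ereal_less_eq(3))
        moreover have "fst (Y n \<omega>) \<in> Zp" "fst (Y n \<omega>) \<bullet> 1 = 1"
          using plus_iff[OF Y_states[OF w], of n] st by (auto simp: staying_def plus_states_def)
        ultimately show ?thesis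
          using exp_Cp_one_le[of "r - t n \<omega>"] by (auto simp: dual_cone_def inner_diff_right)
      qed
      then show "indicator (staying r n) \<omega> * ennreal (fst (Y n \<omega>) \<bullet> survive (r - t n \<omega>)) \<le> indicator {\<omega>\<in>space M. T n \<omega> \<le> ereal r} \<omega>"
        by (auto simp: indicator_def staying_def ennreal_le_1)
    qed
    also have "\<dots> = emeasure M {\<omega>\<in>space M. T n \<omega> \<le> ereal r}" by (rule nn_integral_indicator) measurable
    finally show ?thesis .
  qed
  have Sn: "(\<Sum>i<n. emeasure M (?S i)) \<le> emeasure M (\<Union>n. ?S n)" for n
  proof -
    have "(\<Sum>i<n. emeasure M (?S i)) \<le> (\<Sum>i. emeasure M (?S i))" by (rule sum_le_suminf) auto
    also have "\<dots> = emeasure M (\<Union>n. ?S n)" using SM by (intro suminf_emeasure disj) auto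
    finally show ?thesis .
  qed
  have le: "ennreal (\<alpha> \<bullet> survive r) \<le> emeasure M (\<Union>n. ?S n) + emeasure M {\<omega>\<in>space M. T n \<omega> \<le> ereal r}" for n
    unfolding R0[symmetric] by (subst R[of n]) (rule add_mono[OF Sn Rn])
  have "(\<lambda>n. emeasure M (\<Union>n. ?S n) + emeasure M {\<omega>\<in>space M. T n \<omega> \<le> ereal r}) \<longlonglongrightarrow> emeasure M (\<Union>n. ?S n) + 0"
    by (intro tendsto_add tendsto_const T_tail)
  then have "ennreal (\<alpha> \<bullet> survive r) \<le> emeasure M (\<Union>n. ?S n) + 0"
    by (rule LIMSEQ_le_const) (use le in auto)
  then show ?thesis
    unfolding staying_path[OF r] by (simp add: emeasure_eq_measure)
qed

end

section \<open>Downward records\<close>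

text \<open>
  The number \<open>x\<close> is the depth of the downward record.
\<close>

locale pdmp_hitting = pdmp_path X M A z0 T Y +
  fl: fluid_data "orbits (plus X)" "orbits (minus X)" "Gamma_mat (plus X)" "offdiag (plus X)"
    "Gamma_mat (minus X)" "offdiag (minus X)" "Dpm X" "Dmp X"
  for X :: "('p::{finite,linorder}, 'm::{finite,linorder}) rap" and M :: "'w measure" and A z0 T Y +
  fixes x :: real
  assumes x: "0 \<le> x"
begin

definition drift :: "('p, 'm) state \<Rightarrow> real" where
  "drift z = fst z \<bullet> 1 - snd z \<bullet> 1"

lemma drift_measurable [measurable]: "drift \<in> borel_measurable borel"
  unfolding drift_def[abs_def] by (intro borel_measurable_continuous_onI continuous_intros)

text \<open>
  The distance of the level from its target \<open>- x\<close> at the jump times. After a finite last jump the value of the gap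
  is meaningless; it is used only together with \<open>T n \<omega> < \<infinity>\<close>.
\<close>

primrec height :: "nat \<Rightarrow> 'w \<Rightarrow> real" where
  "height 0 \<omega> = x"
| "height (Suc n) \<omega> = height n \<omega> + gap n \<omega> * drift (Y n \<omega>)"

text \<open>
  The target has not been passed before the \<open>n\<close>-th jump. It may be reached exactly at this jump: an upward
  state at height zero continues, a downward state at height zero hits at once.
\<close>

definition alive :: "nat \<Rightarrow> 'w set" where
  "alive n = {\<omega>\<in>space M. T n \<omega> < \<infinity> \<and> (\<forall>i\<le>n. 0 \<le> height i \<omega>)}"

definition hit :: "nat \<Rightarrow> 'w set" where
  "hit n = {\<omega>\<in>alive n. snd (Y n \<omega>) \<bullet> 1 = 1 \<and> T n \<omega> + ereal (height n \<omega>) < T (Suc n) \<omega>}"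

definition position :: "nat \<Rightarrow> 'w \<Rightarrow> (real, 'm) vec" where
  "position n \<omega> = snd (normalize_state (linear_flow X (height n \<omega>) (Y n \<omega>)))"

lemma height_hist: "i \<le> n \<Longrightarrow> height i \<in> borel_measurable (hist n)"
proof (induction i)
  case 0
  have "height 0 = (\<lambda>_. x)" by (simp add: fun_eq_iff)
  then show ?case by simp
next
  case (Suc i)
  have [measurable]: "T i \<in> borel_measurable (hist n)" "T (Suc i) \<in> borel_measurable (hist n)"
    "Y i \<in> borel_measurable (hist n)" "height i \<in> borel_measurable (hist n)"
    using Suc T_hist[of _ n] Y_hist[of _ n] by auto
  show ?case unfolding height.simps(2)[abs_def] by measurable
qed

lemma height_measurable [measurable]: "height n \<in> borel_measurable M"
  by (rule measurable_hist_le[OF height_hist[of n n]]) simp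

lemma alive_hist: "alive n \<in> sets (hist n)"
proof -
  have ge: "{\<omega>\<in>space (hist n). 0 \<le> height i \<omega>} \<in> sets (hist n)" if "i \<le> n" for i
  proof -
    have [measurable]: "height i \<in> borel_measurable (hist n)" by (rule height_hist[OF that])
    show ?thesis by measurable
  qed
  have "{\<omega>\<in>space (hist n). T n \<omega> < \<infinity>} \<in> sets (hist n)" using T_hist[of n n] by measurable
  moreover have "{\<omega>\<in>space (hist n). \<forall>i\<in>{..n}. 0 \<le> height i \<omega>} \<in> sets (hist n)"
    by (rule sets.sets_Collect_finite_All) (rule ge, simp, simp)
  moreover have "alive n = {\<omega>\<in>space (hist n). T n \<omega> < \<infinity>} \<inter> {\<omega>\<in>space (hist n). \<forall>i\<in>{..n}. 0 \<le> height i \<omega>}"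
    by (auto simp: alive_def)
  ultimately show ?thesis by auto
qed

lemma alive_sets [measurable]: "alive n \<in> sets M"
  by (rule sets_hist_le[OF alive_hist])

lemma snd_Y_measurable [measurable]: "(\<lambda>\<omega>. snd (Y n \<omega>)) \<in> borel_measurable M"
  and fst_Y_measurable [measurable]: "(\<lambda>\<omega>. fst (Y n \<omega>)) \<in> borel_measurable M"
  by (rule measurable_snd_state measurable_fst_state; simp)+

lemma hit_sets [measurable]: "hit n \<in> sets M"
proof -
  have "hit n = alive n \<inter> {\<omega>\<in>space M. snd (Y n \<omega>) \<bullet> 1 = 1 \<and> T n \<omega> + ereal (height n \<omega>) < T (Suc n) \<omega>}"
    by (auto simp: hit_def alive_def)
  then show ?thesis by simp
qed

lemma position_measurable [measurable]: "position n \<in> borel_measurable M"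
  unfolding position_def[abs_def]
  by (intro measurable_snd_state measurable_compose[OF _ borel_measurable_normalize_state] borel_measurable_linear_flow) measurable

abbreviation expected :: "nat \<Rightarrow> (real, 'm) vec \<Rightarrow> ('p, 'm) state \<Rightarrow> real \<Rightarrow> real" where
  "expected k w y u \<equiv> fst y \<bullet> (fl.F k u *v w) + snd y \<bullet> (fl.G k u *v w)"

lemma iterate_continuous: "continuous_on {0..} (fl.F k)" "continuous_on {0..} (fl.G k)"
  using fl.regular[of k] by (auto simp: fl.regular_def)

text \<open>
  The integrand is the derivative of \<open>- (a \<bullet> (mat_exp (u *\<^sub>R Gp) *v (F (Suc k) (l + u) *v w)))\<close>, by the equation
  that defines the next iterate. The boundary term at infinity vanishes because \<open>F (Suc k)\<close> is bounded.
\<close>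

lemma jumps_from_plus:
  assumes y: "y \<in> S" "snd y = 0" and l: "0 \<le> l" and w: "w \<in> dual_cone Zm"
  shows "(\<integral>\<^sup>+u. indicator {0..} u * (\<Sum>\<kappa>\<in>J. ennreal (mass (jump_map X \<kappa> (linear_flow X u y))) *
      ennreal (expected k w (normalize_state (jump_map X \<kappa> (linear_flow X u y))) (l + u))) \<partial>lborel) =
    ennreal (fst y \<bullet> (fl.F (Suc k) l *v w))"
proof -
  define a where "a = fst y"
  let ?f = "\<lambda>u. Bp *v (fl.F k (l + u) *v w) + Dpm X *v (fl.G k (l + u) *v w)"
  let ?k = "\<lambda>u. a \<bullet> (mat_exp (u *\<^sub>R Gp) *v ?f u)"
  let ?P = "\<lambda>u. - (a \<bullet> (mat_exp (u *\<^sub>R Gp) *v (fl.F (Suc k) (l + u) *v w)))"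
  have pos: "fl.F k (l + u) *v w \<in> dual_cone Zp" "fl.G k (l + u) *v w \<in> dual_cone Zm" if "0 \<le> u" for u
    using l that w by (auto intro!: cone_positiveD[OF fl.F_pos] cone_positiveD[OF fl.G_pos])
  have ca: "(a, 0) = y" using y(2) by (simp add: a_def prod_eq_iff)
  have sum: "(\<Sum>\<kappa>\<in>J. ennreal (mass (jump_map X \<kappa> (linear_flow X u y))) *
      ennreal (expected k w (normalize_state (jump_map X \<kappa> (linear_flow X u y))) (l + u))) = ennreal (?k u)"
    if u: "0 \<le> u" for u
    using sum_jumps_linear[OF linear_flow_cone[OF y(1) u] pos[OF u]]
    by (simp add: linear_flow_def y(2) a_def dot_lmul_matrix mv.add_right inner_add_right)
  have k0: "0 \<le> ?k u" if u: "0 \<le> u" for u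
  proof -
    have "mat_exp (u *\<^sub>R Gp) *v ?f u \<in> dual_cone Zp"
      by (intro cone_positiveD[OF exp_positiveD[OF exp_positive_Gamma[OF valid_plus]]] dual_cone_add
          cone_positiveD[OF Bp_pos] cone_positiveD[OF Dpm_pos] pos u)
    from cone_inner_nonneg(1)[OF state_in_cone[OF y(1)] this] show ?thesis by (simp add: a_def)
  qed
  have shift: "((\<lambda>u. fl.F (Suc k) (l + u)) has_vector_derivative
      - (Gp ** fl.F (Suc k) (l + u)) - (Bp ** fl.F k (l + u) + Dpm X ** fl.G k (l + u))) (at u within {0..})" if u: "0 \<le> u" for u
  proof -
    let ?D = "- (Gp ** fl.F (Suc k) (l + u)) - (Bp ** fl.F k (l + u) + Dpm X ** fl.G k (l + u))"
    have "(fl.F (Suc k) has_vector_derivative ?D) (at (l + u) within (\<lambda>u. l + u) ` {0..})"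
      by (rule has_vector_derivative_within_subset[OF fl.F_deriv[OF fl.regular]]) (use l u in auto)
    moreover have "((\<lambda>u. l + u) has_vector_derivative 1) (at u within {0..})" by (auto intro!: derivative_eq_intros)
    ultimately show ?thesis
      using vector_diff_chain_within[of "\<lambda>u. l + u" 1 u "{0..}" "fl.F (Suc k)" ?D] by (simp add: o_def)
  qed
  have D: "(?P has_vector_derivative ?k u) (at u within {0..})" if u: "0 \<le> u" for u
  proof -
    have "((\<lambda>u. mat_exp (u *\<^sub>R Gp) *v (fl.F (Suc k) (l + u) *v w)) has_vector_derivative
      mat_exp (u *\<^sub>R Gp) *v ((- (Gp ** fl.F (Suc k) (l + u)) - (Bp ** fl.F k (l + u) + Dpm X ** fl.G k (l + u))) *v w) +
      (mat_exp (u *\<^sub>R Gp) ** Gp) *v (fl.F (Suc k) (l + u) *v w)) (at u within {0..})"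
      by (intro mv.has_vector_derivative mat_exp_deriv_left fl.mv_deriv shift u)
    moreover have "mat_exp (u *\<^sub>R Gp) *v ((- (Gp ** fl.F (Suc k) (l + u)) - (Bp ** fl.F k (l + u) + Dpm X ** fl.G k (l + u))) *v w) +
      (mat_exp (u *\<^sub>R Gp) ** Gp) *v (fl.F (Suc k) (l + u) *v w) = - (mat_exp (u *\<^sub>R Gp) *v ?f u)"
      by (simp add: mv.diff_left mv.add_left mv.minus_left mv.diff_right mv.add_right mv.minus_right
          flip: matrix_vector_mul_assoc)
    ultimately have "((\<lambda>u. mat_exp (u *\<^sub>R Gp) *v (fl.F (Suc k) (l + u) *v w)) has_vector_derivative
      - (mat_exp (u *\<^sub>R Gp) *v ?f u)) (at u within {0..})" by simp
    from has_vector_derivative_minus[OF bounded_linear.has_vector_derivative[OF bounded_linear_inner_right this, of a]]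
    show ?thesis by simp
  qed
  have ck: "continuous_on {0..} ?k"
    by (intro continuous_intros mv.continuous_on continuous_on_compose2[OF iterate_continuous(1)]
        continuous_on_compose2[OF iterate_continuous(2)]) (use l in auto)
  have lim: "(?P \<longlongrightarrow> 0) at_top"
  proof -
    obtain B where B: "\<And>s. 0 \<le> s \<Longrightarrow> norm (fl.F (Suc k) s) \<le> B"
      using fl.F_bounded[OF fl.regular, of k] by (auto simp: bounded_iff)
    have "Zfun (\<lambda>u. mat_exp (u *\<^sub>R Gp)) at_top"
      using fl.Gp_decay by (simp add: tendsto_Zfun_iff)
    moreover have "Bfun (\<lambda>u. fl.F (Suc k) (l + u)) at_top"
      by (rule BfunI[of _ B]) (use B l in \<open>auto intro!: eventually_at_top_linorderI[of 0]\<close>)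
    ultimately have "((\<lambda>u. mat_exp (u *\<^sub>R Gp) ** fl.F (Suc k) (l + u)) \<longlongrightarrow> 0) at_top"
      using mm.Zfun_prod_Bfun by (auto simp: tendsto_Zfun_iff)
    from tendsto_minus[OF tendsto_inner[OF tendsto_const mv.tendsto[OF this tendsto_const]], of a w]
    show ?thesis by (simp add: mv.zero_left flip: matrix_vector_mul_assoc)
  qed
  have "(\<integral>\<^sup>+u. indicator {0..} u * (\<Sum>\<kappa>\<in>J. ennreal (mass (jump_map X \<kappa> (linear_flow X u y))) *
      ennreal (expected k w (normalize_state (jump_map X \<kappa> (linear_flow X u y))) (l + u))) \<partial>lborel) =
    (\<integral>\<^sup>+u. indicator {0..} u * ennreal (?k u) \<partial>lborel)"
    by (intro nn_integral_cong) (simp add: sum indicator_def)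
  also have "\<dots> = ennreal (0 - ?P 0)"
    by (rule nn_integral_FTC_atLeast_within[OF D ck k0 lim])
  finally show ?thesis by (simp add: a_def)
qed

text \<open>
  In the same way, on the interval up to the time \<open>l\<close> at which the target is reached without a jump; the
  boundary term there is the contribution of this event.
\<close>

lemma jumps_from_minus:
  assumes y: "y \<in> S" "fst y = 0" and l: "0 \<le> l" and w: "w \<in> dual_cone Zm"
  shows "(\<integral>\<^sup>+u. indicator {0..l} u * (\<Sum>\<kappa>\<in>J. ennreal (mass (jump_map X \<kappa> (linear_flow X u y))) *
      ennreal (expected k w (normalize_state (jump_map X \<kappa> (linear_flow X u y))) (l - u))) \<partial>lborel) =
    ennreal (snd y \<bullet> (fl.G (Suc k) l *v w) - snd y \<bullet> (mat_exp (l *\<^sub>R Gm) *v w))"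
proof -
  define b where "b = snd y"
  let ?f = "\<lambda>u. Bm *v (fl.G k (l - u) *v w) + Dmp X *v (fl.F k (l - u) *v w)"
  let ?k = "\<lambda>u. b \<bullet> (mat_exp (u *\<^sub>R Gm) *v ?f u)"
  let ?P = "\<lambda>u. - (b \<bullet> (mat_exp (u *\<^sub>R Gm) *v (fl.G (Suc k) (l - u) *v w)))"
  have pos: "fl.F k (l - u) *v w \<in> dual_cone Zp" "fl.G k (l - u) *v w \<in> dual_cone Zm" if "u \<le> l" for u
    using that w by (auto intro!: cone_positiveD[OF fl.F_pos] cone_positiveD[OF fl.G_pos])
  have sum: "(\<Sum>\<kappa>\<in>J. ennreal (mass (jump_map X \<kappa> (linear_flow X u y))) *
      ennreal (expected k w (normalize_state (jump_map X \<kappa> (linear_flow X u y))) (l - u))) = ennreal (?k u)"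
    if u: "0 \<le> u" "u \<le> l" for u
    using sum_jumps_linear[OF linear_flow_cone[OF y(1) u(1)] pos[OF u(2)]]
    by (simp add: linear_flow_def y(2) b_def dot_lmul_matrix mv.add_right inner_add_right add.commute)
  have k0: "0 \<le> ?k u" if u: "0 \<le> u" "u \<le> l" for u
  proof -
    have "mat_exp (u *\<^sub>R Gm) *v ?f u \<in> dual_cone Zm"
      by (intro cone_positiveD[OF exp_positiveD[OF exp_positive_Gamma[OF valid_minus]]] dual_cone_add
          cone_positiveD[OF Bm_pos] cone_positiveD[OF Dmp_pos] pos u)
    from cone_inner_nonneg(2)[OF state_in_cone[OF y(1)] this] show ?thesis by (simp add: b_def)
  qed
  have shift: "((\<lambda>u. fl.G (Suc k) (l - u)) has_vector_derivative
      - (Gm ** fl.G (Suc k) (l - u) + (Bm ** fl.G k (l - u) + Dmp X ** fl.F k (l - u)))) (at u within {0..l})"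
    if u: "0 \<le> u" "u \<le> l" for u
  proof -
    let ?D = "Gm ** fl.G (Suc k) (l - u) + (Bm ** fl.G k (l - u) + Dmp X ** fl.F k (l - u))"
    have "(fl.G (Suc k) has_vector_derivative ?D) (at (l - u) within (\<lambda>u. l - u) ` {0..l})"
      by (rule has_vector_derivative_within_subset[OF fl.G_deriv[OF fl.regular]]) (use l u in auto)
    moreover have "((\<lambda>u. l - u) has_vector_derivative - 1) (at u within {0..l})" by (auto intro!: derivative_eq_intros)
    ultimately show ?thesis
      using vector_diff_chain_within[of "\<lambda>u. l - u" "- 1" u "{0..l}" "fl.G (Suc k)" ?D] by (simp add: o_def)
  qed
  have D: "(?P has_vector_derivative ?k u) (at u within {0..l})" if u: "0 \<le> u" "u \<le> l" for u
  proof -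
    have "((\<lambda>u. mat_exp (u *\<^sub>R Gm) *v (fl.G (Suc k) (l - u) *v w)) has_vector_derivative
      mat_exp (u *\<^sub>R Gm) *v (- (Gm ** fl.G (Suc k) (l - u) + (Bm ** fl.G k (l - u) + Dmp X ** fl.F k (l - u))) *v w) +
      (mat_exp (u *\<^sub>R Gm) ** Gm) *v (fl.G (Suc k) (l - u) *v w)) (at u within {0..l})"
      by (intro mv.has_vector_derivative mat_exp_deriv_left fl.mv_deriv shift u)
    moreover have "mat_exp (u *\<^sub>R Gm) *v (- (Gm ** fl.G (Suc k) (l - u) + (Bm ** fl.G k (l - u) + Dmp X ** fl.F k (l - u))) *v w) +
      (mat_exp (u *\<^sub>R Gm) ** Gm) *v (fl.G (Suc k) (l - u) *v w) = - (mat_exp (u *\<^sub>R Gm) *v ?f u)"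
      by (simp add: mv.diff_left mv.add_left mv.minus_left mv.diff_right mv.add_right mv.minus_right
          flip: matrix_vector_mul_assoc)
    ultimately have "((\<lambda>u. mat_exp (u *\<^sub>R Gm) *v (fl.G (Suc k) (l - u) *v w)) has_vector_derivative
      - (mat_exp (u *\<^sub>R Gm) *v ?f u)) (at u within {0..l})" by simp
    from has_vector_derivative_minus[OF bounded_linear.has_vector_derivative[OF bounded_linear_inner_right this, of b]]
    show ?thesis by simp
  qed
  have ck: "continuous_on {0..l} ?k"
    by (intro continuous_intros mv.continuous_on continuous_on_compose2[OF iterate_continuous(1)]
        continuous_on_compose2[OF iterate_continuous(2)]) auto
  have "(\<integral>\<^sup>+u. indicator {0..l} u * (\<Sum>\<kappa>\<in>J. ennreal (mass (jump_map X \<kappa> (linear_flow X u y))) *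
      ennreal (expected k w (normalize_state (jump_map X \<kappa> (linear_flow X u y))) (l - u))) \<partial>lborel) =
    (\<integral>\<^sup>+u. indicator {0..l} u * ennreal (?k u) \<partial>lborel)"
    by (intro nn_integral_cong) (simp add: sum indicator_def)
  also have "\<dots> = ennreal (?P l - ?P 0)"
    by (rule nn_integral_FTC_Icc_within[OF l D ck k0])
  finally show ?thesis by (simp add: b_def fl.G_at_0)
qed

lemma drift_states:
  assumes "\<omega> \<in> space M"
  shows "Y n \<omega> \<in> plus_states X \<Longrightarrow> drift (Y n \<omega>) = 1" and "Y n \<omega> \<notin> plus_states X \<Longrightarrow> drift (Y n \<omega>) = - 1"
  using sgn_vals[OF assms, of n] by (auto simp: drift_def)

lemma alive_Suc:
  assumes w: "\<omega> \<in> space M"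
  shows "\<omega> \<in> alive (Suc n) \<longleftrightarrow> \<omega> \<in> alive n \<and> T (Suc n) \<omega> < \<infinity> \<and> 0 \<le> height n \<omega> + gap n \<omega> * drift (Y n \<omega>)"
  using t_less[OF w, of n] by (auto simp: alive_def le_Suc_eq)

lemma survive_minus:
  assumes y: "y \<in> S" "fst y = 0" and l: "0 \<le> l"
  shows "snd (normalize_state (linear_flow X l y)) \<bullet> w * mass (linear_flow X l y) = snd y \<bullet> (mat_exp (l *\<^sub>R Gm) *v w)"
proof -
  have "snd (normalize_state (linear_flow X l y)) \<bullet> w * mass (linear_flow X l y) =
      snd (mass (linear_flow X l y) *\<^sub>R normalize_state (linear_flow X l y)) \<bullet> w" by simp
  also have "\<dots> = snd (linear_flow X l y) \<bullet> w"
    by (simp only: cone_normalize[OF linear_flow_cone[OF y(1) l]])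
  also have "\<dots> = snd y \<bullet> (mat_exp (l *\<^sub>R Gm) *v w)" by (simp add: linear_flow_def dot_lmul_matrix)
  finally show ?thesis .
qed

lemma G_ge_exp:
  assumes l: "0 \<le> l" and w: "w \<in> dual_cone Zm"
  shows "fl.G (Suc k) l *v w - mat_exp (l *\<^sub>R Gm) *v w \<in> dual_cone Zm"
proof (rule N.exp_positive_forward[OF exp_positive_Gamma[OF valid_minus] _ _ _ l])
  fix s :: real assume s: "0 \<le> s"
  have "((\<lambda>s. fl.G (Suc k) s *v w - mat_exp (s *\<^sub>R Gm) *v w) has_vector_derivative
    (Gm ** fl.G (Suc k) s + (Bm ** fl.G k s + Dmp X ** fl.F k s)) *v w - (Gm ** mat_exp (s *\<^sub>R Gm)) *v w) (at s within {0..})"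
    by (intro has_vector_derivative_diff fl.mv_deriv mat_exp_deriv fl.G_deriv[OF fl.regular] s)
  then show "((\<lambda>s. fl.G (Suc k) s *v w - mat_exp (s *\<^sub>R Gm) *v w) has_vector_derivative
    Gm *v (fl.G (Suc k) s *v w - mat_exp (s *\<^sub>R Gm) *v w) + (Bm *v (fl.G k s *v w) + Dmp X *v (fl.F k s *v w))) (at s within {0..})"
    by (simp add: mv.diff_right mv.add_left diff_add_eq add_diff_eq add_ac flip: matrix_vector_mul_assoc)
  show "Bm *v (fl.G k s *v w) + Dmp X *v (fl.F k s *v w) \<in> dual_cone Zm"
    by (intro dual_cone_add cone_positiveD[OF Bm_pos] cone_positiveD[OF Dmp_pos] cone_positiveD[OF fl.F_pos[OF s]]
        cone_positiveD[OF fl.G_pos[OF s]] w)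
qed (simp add: fl.G_at_0)

text \<open>
  The recursion of the iterates, read along the path: from an upward state the next jump determines the
  outcome, from a downward state either the target is reached before the next jump or this jump determines the
  outcome.
\<close>

lemma hit_step:
  assumes w: "w \<in> dual_cone Zm"
  shows "(\<integral>\<^sup>+\<omega>. indicator (alive n) \<omega> * ennreal (expected (Suc k) w (Y n \<omega>) (height n \<omega>)) \<partial>M) =
    (\<integral>\<^sup>+\<omega>. indicator (hit n) \<omega> * ennreal (position n \<omega> \<bullet> w) \<partial>M) +
    (\<integral>\<^sup>+\<omega>. indicator (alive (Suc n)) \<omega> * ennreal (expected k w (Y (Suc n) \<omega>) (height (Suc n) \<omega>)) \<partial>M)"
proof -
  let ?H = "alive n" and ?Q = "\<lambda>\<omega>. (Y n \<omega>, height n \<omega>)"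
  let ?Hm = "alive n \<inter> {\<omega>\<in>space M. snd (Y n \<omega>) \<bullet> 1 = 1}"
  have H: "?H \<in> sets (hist n)" "\<And>\<omega>. \<omega> \<in> ?H \<Longrightarrow> T n \<omega> < \<infinity>"
    using alive_hist by (auto simp: alive_def)
  have Q: "?Q \<in> borel_measurable (hist n)"
    using height_hist[of n n] Y_hist[of n n] by measurable
  have Hm: "?Hm \<in> sets (hist n)"
  proof -
    have [measurable]: "Y n \<in> borel_measurable (hist n)" by (rule Y_hist) simp
    have "{\<omega>\<in>space (hist n). snd (Y n \<omega>) \<bullet> 1 = 1} \<in> sets (hist n)" by measurable
    then show ?thesis using H(1) by auto
  qed
  have HmM [measurable]: "?Hm \<in> sets M" by (rule sets_hist_le[OF Hm])
  have Hsp: "\<omega> \<in> space M" "0 \<le> height n \<omega>" if "\<omega> \<in> ?H" for \<omega> using that by (auto simp: alive_def)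
  have mi: "Y n \<omega> \<notin> plus_states X" "fst (Y n \<omega>) = 0" if "\<omega> \<in> ?Hm" for \<omega>
  proof -
    have sp: "\<omega> \<in> space M" using that by auto
    show "Y n \<omega> \<notin> plus_states X" using sgn_vals(1)[OF sp, of n] that by auto
    then show "fst (Y n \<omega>) = 0" using sgn_vals(2)[OF sp] by auto
  qed
  let ?e = "\<lambda>\<omega>. snd (Y n \<omega>) \<bullet> (mat_exp (height n \<omega> *\<^sub>R Gm) *v w)"
  have A: "(\<integral>\<^sup>+\<omega>. indicator (hit n) \<omega> * ennreal (position n \<omega> \<bullet> w) \<partial>M) = (\<integral>\<^sup>+\<omega>. indicator ?Hm \<omega> * ennreal (?e \<omega>) \<partial>M)"
  proof -
    let ?v = "\<lambda>q. snd (normalize_state (linear_flow X (snd q) (fst q))) \<bullet> w"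
    have vm: "?v \<in> borel_measurable borel"
    proof -
      have "(\<lambda>q::('p,'m) state \<times> real. snd (normalize_state (linear_flow X (snd q) (fst q)))) \<in> borel_measurable borel"
        by (intro measurable_snd_state measurable_compose[OF _ borel_measurable_normalize_state] borel_measurable_linear_flow
            borel_measurable_continuous_onI continuous_intros)
      then show ?thesis by (rule borel_measurable_inner) simp
    qed
    have sm: "snd \<in> borel_measurable (borel :: (('p,'m) state \<times> real) measure)"
      by (intro borel_measurable_continuous_onI continuous_intros)
    obtain c where c: "0 \<le> c" "c *\<^sub>R 1 - w \<in> dual_cone Zm" by (rule N.dual_decompose) (rule that)
    have vS: "normalize_state (linear_flow X (height n \<omega>) (Y n \<omega>)) \<in> S" if "\<omega> \<in> ?Hm" for \<omega>
    proof -
      have h: "\<omega> \<in> ?H" using that by blast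
      show ?thesis
        using flow_in_states[OF Y_states[OF Hsp(1)[OF h]] Hsp(2)[OF h]]
        by (simp only: flow_eq_normalize[OF Y_states[OF Hsp(1)[OF h]] Hsp(2)[OF h]])
    qed
    have v0: "0 \<le> ?v (?Q \<omega>)" "?v (?Q \<omega>) \<le> c" if h: "\<omega> \<in> ?Hm" for \<omega>
    proof -
      let ?y = "normalize_state (linear_flow X (height n \<omega>) (Y n \<omega>))"
      show "0 \<le> ?v (?Q \<omega>)" using cone_inner_nonneg(2)[OF state_in_cone[OF vS[OF h]] w] by simp
      have "0 \<le> snd ?y \<bullet> (c *\<^sub>R 1 - w)" by (rule cone_inner_nonneg(2)[OF state_in_cone[OF vS[OF h]] c(2)])
      moreover have "snd ?y \<bullet> 1 \<le> 1"
        using mass_state[OF vS[OF h]] cone_inner_nonneg(1)[OF state_in_cone[OF vS[OF h]] P.one_dual] by (simp add: mass_def)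
      ultimately show "?v (?Q \<omega>) \<le> c"
        using mult_left_mono[of "snd ?y \<bullet> 1" 1 c] c(1) by (simp add: inner_diff_right)
    qed
    have "(\<integral>\<^sup>+\<omega>. indicator (hit n) \<omega> * ennreal (position n \<omega> \<bullet> w) \<partial>M) =
      (\<integral>\<^sup>+\<omega>. indicator ?Hm \<omega> * (ennreal (?v (?Q \<omega>)) * indicator {\<omega>. T n \<omega> + ereal (snd (?Q \<omega>)) < T (Suc n) \<omega>} \<omega>) \<partial>M)"
      by (rule nn_integral_cong) (auto simp: indicator_def hit_def position_def)
    also have "\<dots> = (\<integral>\<^sup>+\<omega>. indicator ?Hm \<omega> * ennreal (?v (?Q \<omega>) * mass (linear_flow X (snd (?Q \<omega>)) (Y n \<omega>))) \<partial>M)"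
      by (rule no_jump_before[OF Hm _ Q vm sm v0]) (use H(2) Hsp in auto)
    also have "\<dots> = (\<integral>\<^sup>+\<omega>. indicator ?Hm \<omega> * ennreal (?e \<omega>) \<partial>M)"
    proof (rule nn_integral_cong)
      fix \<omega> assume sp: "\<omega> \<in> space M"
      show "indicator ?Hm \<omega> * ennreal (?v (?Q \<omega>) * mass (linear_flow X (snd (?Q \<omega>)) (Y n \<omega>))) = indicator ?Hm \<omega> * ennreal (?e \<omega>)"
      proof (cases "\<omega> \<in> ?Hm")
        case True
        then have "\<omega> \<in> ?H" by blast
        then show ?thesis using survive_minus[OF Y_states[OF sp] mi(2)[OF True] Hsp(2)[OF \<open>\<omega> \<in> ?H\<close>], of w] by simp
      next
        case False
        then show ?thesis by (auto simp: indicator_def)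
      qed
    qed
    finally show ?thesis .
  qed
  let ?u = "\<lambda>q s. snd q + s * drift (fst q)"
  let ?h = "\<lambda>(q :: ('p,'m) state \<times> real, s, y :: ('p,'m) state). indicator {0..} (?u q s) *
    ennreal (expected k w y (max 0 (?u q s)))"
  have hm: "?h \<in> borel_measurable borel"
  proof -
    let ?N = "(borel \<Otimes>\<^sub>M borel) \<Otimes>\<^sub>M (borel \<Otimes>\<^sub>M borel) :: ((('p,'m) state \<times> real) \<times> real \<times> ('p,'m) state) measure"
    have [measurable]: "(\<lambda>x. fst (snd (snd x))) \<in> borel_measurable ?N" "(\<lambda>x. snd (snd (snd x))) \<in> borel_measurable ?N"
      by (rule measurable_fst_state measurable_snd_state; measurable)+
    have um [measurable]: "(\<lambda>x. ?u (fst x) (fst (snd x))) \<in> borel_measurable ?N" by measurable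
    have c: "continuous_on UNIV (\<lambda>u. fl.F k (max 0 u) *v w)" "continuous_on UNIV (\<lambda>u. fl.G k (max 0 u) *v w)"
      by (intro mv.continuous_on continuous_on_compose2[OF iterate_continuous(1)]
          continuous_on_compose2[OF iterate_continuous(2)] continuous_intros; auto)+
    have [measurable]: "(\<lambda>x. fl.F k (max 0 (?u (fst x) (fst (snd x)))) *v w) \<in> borel_measurable ?N"
      "(\<lambda>x. fl.G k (max 0 (?u (fst x) (fst (snd x)))) *v w) \<in> borel_measurable ?N"
      by (rule measurable_compose[OF um borel_measurable_continuous_onI[OF c(1)]]
          measurable_compose[OF um borel_measurable_continuous_onI[OF c(2)]])+
    have "?h \<in> borel_measurable ?N" unfolding split_beta' by measurable
    then show ?thesis unfolding borel_prod .
  qed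
  let ?r = "\<lambda>\<omega>. if Y n \<omega> \<in> plus_states X then fst (Y n \<omega>) \<bullet> (fl.F (Suc k) (height n \<omega>) *v w)
      else snd (Y n \<omega>) \<bullet> (fl.G (Suc k) (height n \<omega>) *v w) - ?e \<omega>"
  have B: "(\<integral>\<^sup>+\<omega>. indicator (alive (Suc n)) \<omega> * ennreal (expected k w (Y (Suc n) \<omega>) (height (Suc n) \<omega>)) \<partial>M) =
     (\<integral>\<^sup>+\<omega>. indicator ?H \<omega> * ennreal (?r \<omega>) \<partial>M)"
  proof -
    have "(\<integral>\<^sup>+\<omega>. indicator (alive (Suc n)) \<omega> * ennreal (expected k w (Y (Suc n) \<omega>) (height (Suc n) \<omega>)) \<partial>M) =
      (\<integral>\<^sup>+\<omega>. indicator ?H \<omega> * indicator {\<omega>. T (Suc n) \<omega> < \<infinity>} \<omega> * ?h (?Q \<omega>, gap n \<omega>, Y (Suc n) \<omega>) \<partial>M)"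
      by (rule nn_integral_cong) (auto simp: indicator_def alive_Suc)
    also have "\<dots> = (\<integral>\<^sup>+\<omega>. indicator ?H \<omega> * (\<integral>\<^sup>+u. (\<Sum>\<kappa>\<in>J. indicator {0..} u *
        (ennreal (rate n \<kappa> u \<omega>) * ?h (?Q \<omega>, u, dest n \<kappa> u \<omega>))) \<partial>lborel) \<partial>M)"
      by (rule next_jump[OF H Q hm])
    also have "\<dots> = (\<integral>\<^sup>+\<omega>. indicator ?H \<omega> * ennreal (?r \<omega>) \<partial>M)"
    proof (rule nn_integral_cong)
      fix \<omega> assume sp: "\<omega> \<in> space M"
      show "indicator ?H \<omega> * (\<integral>\<^sup>+u. (\<Sum>\<kappa>\<in>J. indicator {0..} u *
        (ennreal (rate n \<kappa> u \<omega>) * ?h (?Q \<omega>, u, dest n \<kappa> u \<omega>))) \<partial>lborel) = indicator ?H \<omega> * ennreal (?r \<omega>)"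
      proof (cases "\<omega> \<in> ?H")
        case True
        note l = Hsp(2)[OF True]
        show ?thesis
        proof (cases "Y n \<omega> \<in> plus_states X")
          case pl: True
          have "(\<integral>\<^sup>+u. (\<Sum>\<kappa>\<in>J. indicator {0..} u * (ennreal (rate n \<kappa> u \<omega>) * ?h (?Q \<omega>, u, dest n \<kappa> u \<omega>))) \<partial>lborel) =
            (\<integral>\<^sup>+u. indicator {0..} u * (\<Sum>\<kappa>\<in>J. ennreal (rate n \<kappa> u \<omega>) * ennreal (expected k w (dest n \<kappa> u \<omega>) (height n \<omega> + u))) \<partial>lborel)"
            using l drift_states(1)[OF sp pl] by (intro nn_integral_cong) (auto simp: indicator_def)
          also have "\<dots> = ennreal (?r \<omega>)"
            using jumps_from_plus[OF Y_states[OF sp] _ l w, of n k] sgn_vals(1)[OF sp pl] pl by simp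
          finally show ?thesis by simp
        next
          case mn: False
          have "(\<integral>\<^sup>+u. (\<Sum>\<kappa>\<in>J. indicator {0..} u * (ennreal (rate n \<kappa> u \<omega>) * ?h (?Q \<omega>, u, dest n \<kappa> u \<omega>))) \<partial>lborel) =
            (\<integral>\<^sup>+u. indicator {0..height n \<omega>} u * (\<Sum>\<kappa>\<in>J. ennreal (rate n \<kappa> u \<omega>) * ennreal (expected k w (dest n \<kappa> u \<omega>) (height n \<omega> - u))) \<partial>lborel)"
            using l drift_states(2)[OF sp mn] by (intro nn_integral_cong) (auto simp: indicator_def)
          also have "\<dots> = ennreal (?r \<omega>)"
            using jumps_from_minus[OF Y_states[OF sp] _ l w, of n k] sgn_vals(2)[OF sp mn] mn by simp
          finally show ?thesis by simp
        qed
      qed simp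
    qed
    finally show ?thesis .
  qed
  have [measurable]: "(\<lambda>\<omega>. mat_exp (height n \<omega> *\<^sub>R Gm) *v w) \<in> borel_measurable M"
    by (rule measurable_compose[OF height_measurable])
       (intro borel_measurable_continuous_onI mv.continuous_on continuous_intros)
  have FG [measurable]: "(\<lambda>\<omega>. fl.F (Suc k) (max 0 (height n \<omega>)) *v w) \<in> borel_measurable M"
    "(\<lambda>\<omega>. fl.G (Suc k) (max 0 (height n \<omega>)) *v w) \<in> borel_measurable M"
  proof -
    have c: "continuous_on UNIV (\<lambda>u. fl.F (Suc k) (max 0 u) *v w)" "continuous_on UNIV (\<lambda>u. fl.G (Suc k) (max 0 u) *v w)"
      by (intro mv.continuous_on continuous_on_compose2[OF iterate_continuous(1)]
          continuous_on_compose2[OF iterate_continuous(2)] continuous_intros; auto)+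
    show "(\<lambda>\<omega>. fl.F (Suc k) (max 0 (height n \<omega>)) *v w) \<in> borel_measurable M"
      by (rule measurable_compose[OF height_measurable borel_measurable_continuous_onI[OF c(1)]])
    show "(\<lambda>\<omega>. fl.G (Suc k) (max 0 (height n \<omega>)) *v w) \<in> borel_measurable M"
      by (rule measurable_compose[OF height_measurable borel_measurable_continuous_onI[OF c(2)]])
  qed
  let ?r' = "\<lambda>\<omega>. if fst (Y n \<omega>) \<bullet> 1 = 1 then fst (Y n \<omega>) \<bullet> (fl.F (Suc k) (max 0 (height n \<omega>)) *v w)
      else snd (Y n \<omega>) \<bullet> (fl.G (Suc k) (max 0 (height n \<omega>)) *v w) - ?e \<omega>"
  have "(\<integral>\<^sup>+\<omega>. indicator ?H \<omega> * ennreal (expected (Suc k) w (Y n \<omega>) (height n \<omega>)) \<partial>M) =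
    (\<integral>\<^sup>+\<omega>. indicator ?Hm \<omega> * ennreal (?e \<omega>) + indicator ?H \<omega> * ennreal (?r' \<omega>) \<partial>M)"
  proof (rule nn_integral_cong)
    fix \<omega> assume sp: "\<omega> \<in> space M"
    show "indicator ?H \<omega> * ennreal (expected (Suc k) w (Y n \<omega>) (height n \<omega>)) = indicator ?Hm \<omega> * ennreal (?e \<omega>) + indicator ?H \<omega> * ennreal (?r' \<omega>)"
    proof (cases "\<omega> \<in> ?H")
      case True
      note l = Hsp(2)[OF True]
      show ?thesis
      proof (cases "Y n \<omega> \<in> plus_states X")
        case pl: True
        then show ?thesis using True sgn_vals(1)[OF sp pl] l by simp
      next
        case mn: False
        have e0: "0 \<le> ?e \<omega>"
          by (intro cone_inner_nonneg[OF state_in_cone[OF Y_states[OF sp]]]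
              cone_positiveD[OF exp_positiveD[OF exp_positive_Gamma[OF valid_minus]]] w l)
        have g0: "0 \<le> snd (Y n \<omega>) \<bullet> (fl.G (Suc k) (height n \<omega>) *v w) - ?e \<omega>"
          using cone_inner_nonneg(2)[OF state_in_cone[OF Y_states[OF sp]] G_ge_exp[OF l w]]
          by (simp add: inner_diff_right)
        show ?thesis using True sgn_vals(2)[OF sp mn] l e0 g0 sp
          by (simp del: ennreal_plus add: ennreal_plus[symmetric])
      qed
    qed simp
  qed
  also have "\<dots> = (\<integral>\<^sup>+\<omega>. indicator ?Hm \<omega> * ennreal (?e \<omega>) \<partial>M) + (\<integral>\<^sup>+\<omega>. indicator ?H \<omega> * ennreal (?r' \<omega>) \<partial>M)"
    by (intro nn_integral_add) measurable
  also have "(\<integral>\<^sup>+\<omega>. indicator ?H \<omega> * ennreal (?r' \<omega>) \<partial>M) = (\<integral>\<^sup>+\<omega>. indicator ?H \<omega> * ennreal (?r \<omega>) \<partial>M)"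
    by (rule nn_integral_cong)
       (use plus_iff[OF Y_states] Hsp in \<open>auto simp: indicator_def max_absorb2\<close>)
  finally show ?thesis using A B by simp
qed

text \<open>
  Between jumps the sign of the state is constant, so the level is affine with slope \<open>drift (Y n \<omega>)\<close>. The single
  end point \<open>r\<close>, where the next jump may already have happened, does not matter.
\<close>

lemma level_on_interval:
  assumes sp: "\<omega> \<in> space M"
  shows "T n \<omega> < \<infinity> \<Longrightarrow> t n \<omega> \<le> r \<Longrightarrow> ereal r \<le> T (Suc n) \<omega> \<Longrightarrow>
    has_bochner_integral lborel (\<lambda>s. indicator {0..r} s *\<^sub>R (indicator (plus_states X) (A s \<omega>) - indicator (minus_states X) (A s \<omega>) :: real))
      (height n \<omega> - x + (r - t n \<omega>) * drift (Y n \<omega>))"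
proof (induction n arbitrary: r)
  let ?g = "\<lambda>s. indicator (plus_states X) (A s \<omega>) - indicator (minus_states X) (A s \<omega>) :: real"
  have extend: "has_bochner_integral lborel (\<lambda>s. indicator {0..r} s *\<^sub>R ?g s) (I + (r - t n \<omega>) * drift (Y n \<omega>))"
    if I: "has_bochner_integral lborel (\<lambda>s. indicator {0..t n \<omega>} s *\<^sub>R ?g s) I" and f: "T n \<omega> < \<infinity>" "t n \<omega> \<le> r" "ereal r \<le> T (Suc n) \<omega>"
    for n r I
  proof -
    have g: "?g s = drift (Y n \<omega>)" if s: "t n \<omega> < s" "s < r" for s
    proof -
      have i: "T n \<omega> \<le> ereal s" "ereal s < T (Suc n) \<omega>"
        using s f(3) ereal_t[OF sp f(1)] by (metis ereal_less_eq(3) less_imp_le, metis ereal_less(2) less_ereal.simps(1) less_le_trans)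
      show ?thesis
        using A_on_interval(4,5)[OF sp i] sgn_vals[OF sp, of n] by (cases "Y n \<omega> \<in> plus_states X") (auto simp: drift_def)
    qed
    have eq: "indicator {0..r} s *\<^sub>R ?g s = indicator {0..t n \<omega>} s *\<^sub>R ?g s + drift (Y n \<omega>) * indicator {t n \<omega><..<r} s +
        (if t n \<omega> < r then ?g r else 0) * indicator {r} s" for s
      using g[of s] t_nonneg[OF sp, of n] f(2) by (cases "s < r"; cases "t n \<omega> < s"; cases "s = r") (auto simp: indicator_def)
    have 1: "has_bochner_integral lborel (\<lambda>s. drift (Y n \<omega>) * indicator {t n \<omega><..<r} s) (drift (Y n \<omega>) * (r - t n \<omega>))"
      using has_bochner_integral_real_indicator[of "{t n \<omega><..<r}" lborel] f(2)
      by (intro has_bochner_integral_mult_right) simp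
    have 2: "has_bochner_integral lborel (\<lambda>s. (if t n \<omega> < r then ?g r else 0) * indicator {r} s) ((if t n \<omega> < r then ?g r else 0) * 0)"
      using has_bochner_integral_real_indicator[of "{r}" lborel]
      by (intro has_bochner_integral_mult_right) simp
    show ?thesis unfolding eq
      using has_bochner_integral_add[OF has_bochner_integral_add[OF I 1] 2] by (simp add: mult.commute)
  qed
  {
    case 0
    have "has_bochner_integral lborel (\<lambda>s. ?g 0 * indicator {0::real} s) (?g 0 * 0)"
      using has_bochner_integral_real_indicator[of "{0::real}" lborel]
      by (intro has_bochner_integral_mult_right) simp
    then have "has_bochner_integral lborel (\<lambda>s. indicator {0..t 0 \<omega>} s *\<^sub>R ?g s) 0"
      by (rule has_bochner_integral_cong[THEN iffD1, rotated -1]) (auto simp: indicator_def T_0[OF sp])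
    from extend[OF this 0] show ?case by simp
  next
    case (Suc n)
    have f: "T n \<omega> < \<infinity>" "t n \<omega> \<le> t (Suc n) \<omega>" using t_less[OF sp Suc.prems(1)] by auto
    have "ereal (t (Suc n) \<omega>) \<le> T (Suc n) \<omega>" using ereal_t[OF sp Suc.prems(1)] by simp
    from extend[OF Suc.IH[OF f this] Suc.prems] show ?case by (simp add: algebra_simps)
  }
qed

end

section \<open>First passage along a path\<close>

context pdmp_hitting
begin

lemma level_at:
  assumes sp: "\<omega> \<in> space M" and i: "T n \<omega> \<le> ereal r" "ereal r < T (Suc n) \<omega>"
  shows "level X (\<lambda>s. A s \<omega>) r = height n \<omega> - x + (r - t n \<omega>) * drift (Y n \<omega>)"
  unfolding level_def set_lebesgue_integral_def
  by (rule has_bochner_integral_integral_eq[OF level_on_interval[OF sp]])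
     (use A_on_interval(2,3)[OF sp i] i in auto)

lemma hitD:
  assumes "\<omega> \<in> hit n"
  shows "\<omega> \<in> space M" "T n \<omega> < \<infinity>" "i \<le> n \<Longrightarrow> 0 \<le> height i \<omega>" "snd (Y n \<omega>) \<bullet> 1 = 1" "drift (Y n \<omega>) = - 1"
    "T n \<omega> \<le> ereal (t n \<omega> + height n \<omega>)" "ereal (t n \<omega> + height n \<omega>) < T (Suc n) \<omega>" "fst (Y n \<omega>) = 0"
proof -
  show sp: "\<omega> \<in> space M" and f: "T n \<omega> < \<infinity>" using assms by (auto simp: hit_def alive_def)
  show h: "0 \<le> height i \<omega>" if "i \<le> n" for i using assms that by (auto simp: hit_def alive_def)
  show s: "snd (Y n \<omega>) \<bullet> 1 = 1" using assms by (simp add: hit_def)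
  have mn: "Y n \<omega> \<notin> plus_states X" using sgn_vals(1)[OF sp, of n] s by auto
  show "drift (Y n \<omega>) = - 1" "fst (Y n \<omega>) = 0" using drift_states(2)[OF sp mn] sgn_vals(2)[OF sp mn] by auto
  have e: "ereal (t n \<omega> + height n \<omega>) = T n \<omega> + ereal (height n \<omega>)"
    using ereal_t[OF sp f] by (metis plus_ereal.simps(1))
  show "ereal (t n \<omega> + height n \<omega>) < T (Suc n) \<omega>" using assms unfolding e by (simp add: hit_def)
  have "ereal (t n \<omega>) \<le> ereal (t n \<omega> + height n \<omega>)" using h[OF order_refl] by simp
  then show "T n \<omega> \<le> ereal (t n \<omega> + height n \<omega>)" using ereal_t[OF sp f] by simp
qed

abbreviation "trajectory \<omega> \<equiv> \<lambda>s. A s \<omega>"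

definition hitting_times :: "'w \<Rightarrow> real set" where
  "hitting_times \<omega> = {r. 0 \<le> r \<and> level X (trajectory \<omega>) r = - x \<and> trajectory \<omega> r \<in> minus_states X}"

lemma hitting_time_interval:
  assumes sp: "\<omega> \<in> space M" and r: "r \<in> hitting_times \<omega>"
  obtains n where "T n \<omega> \<le> ereal r" "ereal r < T (Suc n) \<omega>" "snd (Y n \<omega>) \<bullet> 1 = 1" "height n \<omega> = r - t n \<omega>"
proof -
  obtain n where n: "T n \<omega> \<le> ereal r" "ereal r < T (Suc n) \<omega>"
    by (rule find_interval[OF sp, of r]) (use r in \<open>auto simp: hitting_times_def\<close>)
  have s: "snd (Y n \<omega>) \<bullet> 1 = 1" using A_on_interval(5)[OF sp n] r by (simp add: hitting_times_def)
  then have "Y n \<omega> \<notin> plus_states X" using sgn_vals(1)[OF sp, of n] by auto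
  then have "height n \<omega> = r - t n \<omega>"
    using level_at[OF sp n] r drift_states(2)[OF sp, of n] by (simp add: hitting_times_def)
  with n s show thesis by (rule that)
qed

text \<open>
  If the target were reached before, in the interval after the \<open>i\<close>-th jump with \<open>i < n\<close>, then the downward motion
  would have continued below the target until the next jump, and that height would be negative.
\<close>

lemma hit_tau:
  assumes h: "\<omega> \<in> hit n" shows "tau_minus X (trajectory \<omega>) x = ereal (t n \<omega> + height n \<omega>)"
proof -
  note D = hitD[OF h]
  let ?r = "t n \<omega> + height n \<omega>"
  have in_set: "?r \<in> hitting_times \<omega>"
    using level_at[OF D(1) D(6,7)] A_on_interval(5)[OF D(1) D(6,7)] D(3)[of n] D(4,5) t_nonneg[OF D(1), of n]
    by (simp add: hitting_times_def)
  have least: "?r \<le> r" if r: "r \<in> hitting_times \<omega>" for r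
  proof (rule ccontr)
    assume lt: "\<not> ?r \<le> r"
    obtain i where i: "T i \<omega> \<le> ereal r" "ereal r < T (Suc i) \<omega>" "snd (Y i \<omega>) \<bullet> 1 = 1" "height i \<omega> = r - t i \<omega>"
      by (rule hitting_time_interval[OF D(1) r])
    have "T i \<omega> < T (Suc n) \<omega>"
    proof -
      have "T i \<omega> \<le> ereal r" by (rule i)
      also have "ereal r < ereal ?r" using lt by simp
      also have "\<dots> < T (Suc n) \<omega>" by (rule D)
      finally show ?thesis .
    qed
    then have "i \<le> n" using T_mono[OF D(1), of "Suc n" i] by (meson leD not_less_eq_eq)
    show False
    proof (cases "i = n")
      case True then show False using i(4) lt by simp
    next
      case False
      then have "Suc i \<le> n" using \<open>i \<le> n\<close> by simp
      then have f: "T (Suc i) \<omega> < \<infinity>" using T_mono[OF D(1), of "Suc i" n] D(2) by (meson le_less_trans)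
      have mi: "Y i \<omega> \<notin> plus_states X" using sgn_vals(1)[OF D(1), of i] i(3) by auto
      have "r < t (Suc i) \<omega>" using i(2) ereal_t[OF D(1) f] by (metis ereal_less_eq(3) linorder_not_le)
      then have "height (Suc i) \<omega> < 0" using i(4) drift_states(2)[OF D(1) mi] by simp
      then show False using D(3)[OF \<open>Suc i \<le> n\<close>] by (simp del: height.simps)
    qed
  qed
  have "Inf (ereal ` hitting_times \<omega>) = ereal ?r"
  proof (rule Inf_eqI)
    show "ereal ?r \<le> i" if "i \<in> ereal ` hitting_times \<omega>" for i using that least by auto
    show "y \<le> ereal ?r" if "\<And>i. i \<in> ereal ` hitting_times \<omega> \<Longrightarrow> y \<le> i" for y using that in_set by auto
  qed
  then show ?thesis by (simp add: tau_minus_def hitting_times_def)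
qed

text \<open>
  Either no height up to the current interval is negative, and then this interval contains the hit, or the hit lies
  in the interval before the first negative height.
\<close>

lemma hitting_time_hit:
  assumes sp: "\<omega> \<in> space M" and r: "r \<in> hitting_times \<omega>"
  shows "\<exists>n. \<omega> \<in> hit n"
proof -
  obtain n where n: "T n \<omega> \<le> ereal r" "ereal r < T (Suc n) \<omega>" "snd (Y n \<omega>) \<bullet> 1 = 1" "height n \<omega> = r - t n \<omega>"
    by (rule hitting_time_interval[OF sp r])
  note f = A_on_interval(3)[OF sp n(1,2)]
  show ?thesis
  proof (cases "\<forall>i\<le>n. 0 \<le> height i \<omega>")
    case True
    have "T n \<omega> + ereal (height n \<omega>) = ereal r"
    proof -
      obtain q where "T n \<omega> = ereal q" using ereal_t[OF sp f] by metis
      then show ?thesis using n(4) by simp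
    qed
    then have "\<omega> \<in> hit n" using True sp f n by (simp add: hit_def alive_def)
    then show ?thesis ..
  next
    case False
    then obtain j0 where j0: "j0 \<le> n" "height j0 \<omega> < 0" by (auto simp: not_le)
    define j where "j = (LEAST j. height j \<omega> < 0)"
    have j: "height j \<omega> < 0" "j \<le> j0" unfolding j_def by (rule LeastI[of _ j0], rule j0) (rule Least_le, rule j0)
    have below: "0 \<le> height i \<omega>" if "i < j" for i
      using not_less_Least[of i "\<lambda>j. height j \<omega> < 0"] that by (auto simp: j_def)
    have "j \<noteq> 0" using j(1) x by (intro notI) simp
    then obtain i where i: "j = Suc i" by (cases j) auto
    have fj: "T (Suc i) \<omega> < \<infinity>" using T_mono[OF sp, of j n] j(2) j0(1) f i by (metis le_less_trans order_trans)
    note g = t_less[OF sp fj]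
    have mi: "Y i \<omega> \<notin> plus_states X"
    proof
      assume "Y i \<omega> \<in> plus_states X"
      then have "height j \<omega> = height i \<omega> + gap i \<omega>" using drift_states(1)[OF sp] by (simp add: i)
      then show False using j(1) below[of i] g i by simp
    qed
    have lt: "t i \<omega> + height i \<omega> < t (Suc i) \<omega>" using j(1) drift_states(2)[OF sp mi] by (simp add: i)
    have "T i \<omega> + ereal (height i \<omega>) < T (Suc i) \<omega>"
    proof -
      obtain q where q: "T i \<omega> = ereal q" using ereal_t[OF sp, of i] g by metis
      have "ereal (t i \<omega> + height i \<omega>) < ereal (t (Suc i) \<omega>)" using lt by simp
      then show ?thesis using ereal_t[OF sp fj] by (simp add: q)
    qed
    then have "\<omega> \<in> hit i" using sp g sgn_vals(2)[OF sp mi] below i by (auto simp: hit_def alive_def)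
    then show ?thesis ..
  qed
qed

lemma no_hit_tau:
  assumes "\<omega> \<in> space M" "\<And>n. \<omega> \<notin> hit n" shows "tau_minus X (trajectory \<omega>) x = \<infinity>"
proof -
  have "hitting_times \<omega> = {}" using hitting_time_hit[OF assms(1)] assms(2) by blast
  then have "Inf (ereal ` hitting_times \<omega>) = \<infinity>" by (simp add: top_ereal_def)
  then show ?thesis by (simp add: tau_minus_def hitting_times_def)
qed

lemma hit_disjoint:
  assumes "\<omega> \<in> hit m" "\<omega> \<in> hit n" shows "m = n"
proof (rule ccontr)
  have key: False if "m < n" "\<omega> \<in> hit m" "\<omega> \<in> hit n" for m n
  proof -
    note D = hitD[OF that(2)] and D' = hitD[OF that(3)]
    have "T (Suc m) \<omega> \<le> T n \<omega>" using that(1) by (intro T_mono D) auto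
    also have "T n \<omega> \<le> ereal (t n \<omega> + height n \<omega>)" by (rule D'(6))
    also have "\<dots> = ereal (t m \<omega> + height m \<omega>)" using hit_tau[OF that(2)] hit_tau[OF that(3)] by simp
    also have "\<dots> < T (Suc m) \<omega>" by (rule D(7))
    finally show False by simp
  qed
  assume "m \<noteq> n"
  then show False using key[of m n] key[of n m] assms by (cases "m < n") auto
qed

text \<open>
  The random vector whose expectation is sought: the downward record, read as \<open>0\<close> in the cemetery state.
\<close>

definition landing :: "'w \<Rightarrow> (real, 'm) vec" where
  "landing \<omega> = (case down_record X (trajectory \<omega>) x of Some b \<Rightarrow> b | None \<Rightarrow> 0)"

lemma landing_hit:
  assumes h: "\<omega> \<in> hit n" shows "landing \<omega> = position n \<omega>" "position n \<omega> \<in> Zm"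
proof -
  note D = hitD[OF h]
  have fl: "A (t n \<omega> + height n \<omega>) \<omega> = flow X (height n \<omega>) (Y n \<omega>)"
    using A_on_interval(1)[OF D(1) D(6,7)] by simp
  have h0: "0 \<le> height n \<omega>" by (rule D(3)) simp
  show "landing \<omega> = position n \<omega>"
    unfolding landing_def down_record_def hit_tau[OF h] position_def
    using fl flow_eq_normalize[OF Y_states[OF D(1)] h0] by simp
  have "snd (flow X (height n \<omega>) (Y n \<omega>)) \<bullet> 1 = 1"
    using flow_snd[OF Y_states[OF D(1)] h0] D(4) by simp
  then have "flow X (height n \<omega>) (Y n \<omega>) \<in> minus_states X"
    using minus_iff[OF flow_in_states[OF Y_states[OF D(1)] h0]] by simp
  then show "position n \<omega> \<in> Zm"
    unfolding position_def flow_eq_normalize[OF Y_states[OF D(1)] h0, symmetric] by (auto simp: minus_states_def)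
qed

lemma landing_no_hit:
  assumes "\<omega> \<in> space M" "\<And>n. \<omega> \<notin> hit n" shows "landing \<omega> = 0"
  using no_hit_tau[OF assms] by (simp add: landing_def down_record_def)

lemma landing_series:
  fixes f :: "(real, 'm) vec \<Rightarrow> 'b::{topological_comm_monoid_add, t2_space}"
  assumes "\<omega> \<in> space M" "f 0 = 0"
  shows "(\<lambda>n. if \<omega> \<in> hit n then f (position n \<omega>) else 0) sums f (landing \<omega>)"
proof (cases "\<exists>n. \<omega> \<in> hit n")
  case True
  then obtain n where n: "\<omega> \<in> hit n" ..
  then have "(\<lambda>m. if \<omega> \<in> hit m then f (position m \<omega>) else 0) = (\<lambda>m. if m = n then f (position m \<omega>) else 0)"
    using hit_disjoint by fastforce
  then show ?thesis using sums_single[of n "\<lambda>m. f (position m \<omega>)"] landing_hit(1)[OF n] by simp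
next
  case False
  then show ?thesis using landing_no_hit[OF assms(1)] assms(2) by simp
qed

lemma tau_finite_iff:
  assumes "\<omega> \<in> space M" shows "tau_minus X (trajectory \<omega>) x < \<infinity> \<longleftrightarrow> (\<exists>n. \<omega> \<in> hit n)"
  using hit_tau no_hit_tau[OF assms] by fastforce

lemma tau_finite_sets: "{\<omega>\<in>space M. tau_minus X (trajectory \<omega>) x < \<infinity>} \<in> sets M"
proof -
  have "{\<omega>\<in>space M. tau_minus X (trajectory \<omega>) x < \<infinity>} = (\<Union>n. hit n)"
    using tau_finite_iff by (auto dest: hitD(1))
  then show ?thesis by simp
qed

lemma landing_measurable: "landing \<in> borel_measurable M"
proof -
  have "(\<lambda>\<omega>. \<Sum>n. if \<omega> \<in> hit n then position n \<omega> else 0) \<in> borel_measurable M" by measurable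
  then show ?thesis
    by (rule measurable_cong[THEN iffD1, rotated]) (use landing_series[where f="\<lambda>b. b"] in \<open>auto simp: sums_iff\<close>)
qed

lemma landing_inner_nonneg: "\<omega> \<in> space M \<Longrightarrow> w \<in> dual_cone Zm \<Longrightarrow> 0 \<le> landing \<omega> \<bullet> w"
  using landing_hit landing_no_hit by (cases "\<exists>n. \<omega> \<in> hit n") (auto simp: dual_cone_def)

lemma landing_one: "\<omega> \<in> space M \<Longrightarrow> landing \<omega> \<bullet> 1 = indicator {\<omega>\<in>space M. tau_minus X (trajectory \<omega>) x < \<infinity>} \<omega>"
  using landing_hit landing_no_hit tau_finite_iff
  by (cases "\<exists>n. \<omega> \<in> hit n") (auto simp: N.one indicator_def)

lemma landing_integrable: "integrable M landing"
proof -
  obtain R where R: "0 < R" "\<And>b. b \<in> Zm \<Longrightarrow> norm b \<le> R" using N.bounded by (auto simp: bounded_pos)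
  have "norm (landing \<omega>) \<le> R" if "\<omega> \<in> space M" for \<omega>
    using landing_hit landing_no_hit[OF that] R by (cases "\<exists>n. \<omega> \<in> hit n") (auto simp: less_imp_le)
  then show ?thesis
    by (intro integrable_const_bound[of _ R] landing_measurable) auto
qed

text \<open>
  No remainder occurs, because \<open>F 0\<close> and \<open>G 0\<close> vanish.
\<close>

lemma expected_partial_sums:
  assumes w: "w \<in> dual_cone Zm"
  shows "(\<integral>\<^sup>+\<omega>. indicator (alive n) \<omega> * ennreal (expected k w (Y n \<omega>) (height n \<omega>)) \<partial>M) =
    (\<Sum>i<k. \<integral>\<^sup>+\<omega>. indicator (hit (n + i)) \<omega> * ennreal (position (n + i) \<omega> \<bullet> w) \<partial>M)"
proof (induction k arbitrary: n)
  case 0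
  then show ?case by (simp add: mv.zero_left)
next
  case (Suc k)
  show ?case
    unfolding hit_step[OF w] Suc.IH sum.lessThan_Suc_shift by simp
qed

lemma landing_inner_expectation:
  assumes z0: "z0 = (\<alpha>, 0)" "\<alpha> \<in> Zp" and w: "w \<in> dual_cone Zm"
  shows "(\<integral>\<^sup>+\<omega>. ennreal (landing \<omega> \<bullet> w) \<partial>M) = ennreal (\<alpha> \<bullet> (fl.F_lim x *v w))"
proof -
  let ?e = "\<lambda>n. \<integral>\<^sup>+\<omega>. indicator (hit n) \<omega> * ennreal (position n \<omega> \<bullet> w) \<partial>M"
  have part: "(\<Sum>i<k. ?e i) = ennreal (\<alpha> \<bullet> (fl.F k x *v w))" for k
  proof -
    have "(\<Sum>i<k. ?e i) = (\<integral>\<^sup>+\<omega>. indicator (alive 0) \<omega> * ennreal (expected k w (Y 0 \<omega>) (height 0 \<omega>)) \<partial>M)"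
      using expected_partial_sums[OF w, of 0 k] by simp
    also have "\<dots> = (\<integral>\<^sup>+\<omega>. ennreal (\<alpha> \<bullet> (fl.F k x *v w)) \<partial>M)"
    proof (rule nn_integral_cong_AE, use start AE_space in eventually_elim)
      case (elim \<omega>)
      have "Y 0 \<omega> = z0" using Y_eq[OF elim(2), of 0] T_0[OF elim(2)] elim(1) by simp
      moreover have "\<omega> \<in> alive 0" using x T_0[OF elim(2)] elim(2) by (simp add: alive_def)
      ultimately show ?case using z0 by simp
    qed
    finally show ?thesis by (simp add: emeasure_space_1)
  qed
  have "(\<lambda>k. ennreal (\<alpha> \<bullet> (fl.F k x *v w))) \<longlonglongrightarrow> ennreal (\<alpha> \<bullet> (fl.F_lim x *v w))"
    by (intro tendsto_ennrealI tendsto_inner tendsto_const mv.tendsto fl.F_tendsto x)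
  then have "?e sums ennreal (\<alpha> \<bullet> (fl.F_lim x *v w))" unfolding sums_def part .
  then have "(\<Sum>n. ?e n) = ennreal (\<alpha> \<bullet> (fl.F_lim x *v w))" by (simp add: sums_iff)
  moreover have "(\<Sum>n. ?e n) = (\<integral>\<^sup>+\<omega>. (\<Sum>n. indicator (hit n) \<omega> * ennreal (position n \<omega> \<bullet> w)) \<partial>M)"
    by (intro nn_integral_suminf[symmetric]) measurable
  moreover have "\<dots> = (\<integral>\<^sup>+\<omega>. ennreal (landing \<omega> \<bullet> w) \<partial>M)"
  proof (rule nn_integral_cong)
    fix \<omega> assume sp: "\<omega> \<in> space M"
    have "(\<lambda>n. if \<omega> \<in> hit n then ennreal (position n \<omega> \<bullet> w) else 0) sums ennreal (landing \<omega> \<bullet> w)"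
      by (rule landing_series[OF sp, of "\<lambda>b. ennreal (b \<bullet> w)"]) simp
    moreover have "(\<lambda>n. if \<omega> \<in> hit n then ennreal (position n \<omega> \<bullet> w) else 0) = (\<lambda>n. indicator (hit n) \<omega> * ennreal (position n \<omega> \<bullet> w))"
      by (auto simp: indicator_def)
    ultimately show "(\<Sum>n. indicator (hit n) \<omega> * ennreal (position n \<omega> \<bullet> w)) = ennreal (landing \<omega> \<bullet> w)"
      by (simp add: sums_iff)
  qed
  ultimately show ?thesis by simp
qed

text \<open>
  Nonnegative \<open>w\<close> suffice, since every vector becomes nonnegative after adding a multiple of \<open>1\<close>.
\<close>

theorem landing_expectation:
  assumes z0: "z0 = (\<alpha>, 0)" "\<alpha> \<in> Zp"
  shows "(\<integral>\<omega>. landing \<omega> \<partial>M) = \<alpha> v* fl.F_lim x"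
proof (rule vector_eq_rdot[THEN iffD1], rule allI)
  let ?I = "\<integral>\<omega>. landing \<omega> \<partial>M"
  have dual: "?I \<bullet> w = (\<alpha> v* fl.F_lim x) \<bullet> w" if w: "w \<in> dual_cone Zm" for w
  proof -
    have "?I \<bullet> w = (\<integral>\<omega>. landing \<omega> \<bullet> w \<partial>M)" using landing_integrable by (simp add: integral_inner_left)
    also have "\<dots> = enn2real (\<integral>\<^sup>+\<omega>. ennreal (landing \<omega> \<bullet> w) \<partial>M)"
      by (rule integral_eq_nn_integral)
         (use landing_measurable landing_inner_nonneg[OF _ w] in \<open>auto intro!: AE_I2 borel_measurable_inner\<close>)
    also have "\<dots> = \<alpha> \<bullet> (fl.F_lim x *v w)"
      unfolding landing_inner_expectation[OF z0 w]
      using cone_positiveD[OF fl.F_lim_pos[OF x] w] z0(2) by (simp add: dual_cone_def)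
    finally show ?thesis by (simp add: dot_lmul_matrix)
  qed
  fix w
  obtain c where c: "0 \<le> c" "w + c *\<^sub>R 1 \<in> dual_cone Zm" by (rule N.dual_decompose) (rule that)
  show "?I \<bullet> w = (\<alpha> v* fl.F_lim x) \<bullet> w"
    using dual[OF c(2)] dual[OF N.one_dual] by (simp add: inner_add_right)
qed

end

lemma (in rap_data) Psi_iter_eq:
  assumes "fluid_data (orbits (plus X)) (orbits (minus X)) Gp Bp Gm Bm (Dpm X) (Dmp X)"
  shows "Psi X = fluid_data.psi Gp Bp Gm Bm (Dpm X) (Dmp X)"
    and "fluid_data.U Gp Bp Gm Bm (Dpm X) (Dmp X) = Cmat (minus X) + Dmp X ** Psi X"
proof -
  interpret fl: fluid_data "orbits (plus X)" "orbits (minus X)" Gp Bp Gm Bm "Dpm X" "Dmp X" by fact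
  have "Psi_iter X n = fl.psi_iter n" for n
    by (induction n) (simp_all add: Gamma_offdiag)
  then have "Psi_iter X = fl.psi_iter" by (rule ext)
  then show P: "Psi X = fl.psi" by (simp only: Psi_def fl.psi_def)
  show "fl.U = Cmat (minus X) + Dmp X ** Psi X"
    by (simp add: fl.U_def P Gamma_offdiag)
qed

lemma pdmp_path_of_pdmp_from:
  assumes "valid_rap X" "pdmp_from X M A z"
  obtains T Y where "pdmp_path X M A z T Y"
proof -
  obtain T Y where "(\<forall>n. T n \<in> borel_measurable M \<and> Y n \<in> borel_measurable M) \<and>
        (\<forall>n. \<forall>\<omega>\<in>space M. Y n \<omega> = A (real_of_ereal (T n \<omega>)) \<omega>) \<and>
        (\<forall>\<omega>\<in>space M.
           T 0 \<omega> = 0 \<and>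
           (\<forall>n. if T n \<omega> < \<infinity> then T n \<omega> < T (Suc n) \<omega> else T (Suc n) \<omega> = \<infinity>) \<and>
           (\<lambda>n. T n \<omega>) \<longlonglongrightarrow> \<infinity> \<and>
           (\<forall>n t. T n \<omega> \<le> ereal t \<and> ereal t < T (Suc n) \<omega> \<longrightarrow>
              A t \<omega> = flow X (t - real_of_ereal (T n \<omega>)) (Y n \<omega>))) \<and>
        (\<forall>n. \<forall>s\<ge>0. \<forall>B\<in>sets borel. AE \<omega> in M. T n \<omega> < \<infinity> \<longrightarrow>
           real_cond_exp M (jump_history M T Y n)
             (indicator {\<omega>\<in>space M. T (Suc n) \<omega> \<le> T n \<omega> + ereal s \<and> Y (Suc n) \<omega> \<in> B}) \<omega> =
           jump_kernel X (Y n \<omega>) s B)"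
    using assms(2) unfolding pdmp_from_def by blast
  note * = this
  have "pdmp_path X M A z T Y"
  proof (intro pdmp_path.intro rap_data.intro pdmp_path_axioms.intro)
    show "valid_rap X" by fact
    have "prob_space M \<and> (\<forall>\<omega>\<in>space M. \<forall>t\<ge>0. A t \<omega> \<in> plus_states X \<union> minus_states X) \<and> (AE \<omega> in M. A 0 \<omega> = z)"
      using assms(2) unfolding pdmp_from_def by blast
    note ** = this
    show "prob_space M" "AE \<omega> in M. A 0 \<omega> = z" using ** by blast+
    show "A t \<omega> \<in> plus_states X \<union> minus_states X" if "\<omega> \<in> space M" "0 \<le> t" for \<omega> t using ** that by blast
  qed (use * in blast)+
  then show thesis by (rule that)
qed

theorem corollary4p5:
  fixes X :: "('p::{finite,linorder}, 'm::{finite,linorder}) rap"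
    and P :: "('p, 'm) state \<Rightarrow> 'w measure"
    and A :: "real \<Rightarrow> 'w \<Rightarrow> ('p, 'm) state"
    and \<alpha> :: "(real, 'p) vec" and x :: real
  assumes "rap_fluid_process X P A"
    and "\<alpha> \<in> orbits (plus X)" and "x \<ge> 0"
  shows "has_bochner_integral (P (\<alpha>, 0))
           (\<lambda>\<omega>. case down_record X (\<lambda>t. A t \<omega>) x of Some b \<Rightarrow> b | None \<Rightarrow> 0)
           (\<alpha> v* Psi X v* mat_exp (x *\<^sub>R (Cmat (minus X) + Dmp X ** Psi X)))
       \<and> {\<omega>\<in>space (P (\<alpha>, 0)). tau_minus X (\<lambda>t. A t \<omega>) x < \<infinity>} \<in> sets (P (\<alpha>, 0))
       \<and> measure (P (\<alpha>, 0)) {\<omega>\<in>space (P (\<alpha>, 0)). tau_minus X (\<lambda>t. A t \<omega>) x < \<infinity>} =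
           (\<alpha> v* Psi X v* mat_exp (x *\<^sub>R (Cmat (minus X) + Dmp X ** Psi X))) \<bullet> 1"
proof -
  have valid: "valid_rap X" and pdmp: "\<And>z. z \<in> plus_states X \<union> minus_states X \<Longrightarrow> pdmp_from X (P z) A z"
    and nontrivial: "\<And>z. z \<in> plus_states X \<Longrightarrow>
      ((\<lambda>t. measure (P z) {\<omega>\<in>space (P z). \<forall>s\<in>{0..t}. A s \<omega> \<in> plus_states X}) \<longlongrightarrow> 0) at_top"
    using assms(1) by (auto simp: rap_fluid_process_def)
  interpret rap_data X by standard (rule valid)
  have plus: "(a, 0) \<in> plus_states X" if "a \<in> Zp" for a using that by (simp add: plus_states_def)
  have decay: "((\<lambda>t. mat_exp (t *\<^sub>R (Gp + Bp)) *v 1) \<longlongrightarrow> 0) at_top"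
  proof (rule P.tendsto_cone)
    fix a assume a: "a \<in> Zp"
    obtain T Y where "pdmp_path X (P (a, 0)) A (a, 0) T Y"
      using pdmp_path_of_pdmp_from[OF valid pdmp[OF UnI1[OF plus[OF a]]]] by blast
    then interpret path: pdmp_path X "P (a, 0)" A "(a, 0)" T Y .
    have "((\<lambda>t. a \<bullet> (mat_exp (t *\<^sub>R (Gp + Bp)) *v 1)) \<longlongrightarrow> 0) at_top"
    proof (rule tendsto_sandwich[OF _ _ tendsto_const nontrivial[OF plus[OF a]]])
      show "\<forall>\<^sub>F r in at_top. 0 \<le> a \<bullet> (mat_exp (r *\<^sub>R (Gp + Bp)) *v 1)"
      proof (rule eventually_at_top_linorderI)
        fix r :: real assume "0 \<le> r"
        from cone_positiveD[OF exp_positiveD[OF Cp_exp_positive this] P.one_dual] a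
        show "0 \<le> a \<bullet> (mat_exp (r *\<^sub>R (Gp + Bp)) *v 1)" by (simp add: dual_cone_def)
      qed
      show "\<forall>\<^sub>F r in at_top. a \<bullet> (mat_exp (r *\<^sub>R (Gp + Bp)) *v 1) \<le>
          measure (P (a, 0)) {\<omega>\<in>space (P (a, 0)). \<forall>s\<in>{0..r}. A s \<omega> \<in> plus_states X}"
        by (rule eventually_at_top_linorderI) (rule path.staying_probability[OF refl a])
    qed
    then show "((\<lambda>t. a \<bullet> (mat_exp (t *\<^sub>R (Gp + Bp)) *v 1)) \<longlongrightarrow> a \<bullet> 0) at_top" by simp
  qed
  have fluid: "fluid_data Zp Zm Gp Bp Gm Bm (Dpm X) (Dmp X)"
    using decay Bp_pos Bm_pos Dpm_pos Dmp_pos rows_zero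
      exp_positive_Gamma[OF valid_plus] exp_positive_Gamma[OF valid_minus]
    by unfold_locales (simp_all add: mv.add_left)
  obtain T Y where "pdmp_path X (P (\<alpha>, 0)) A (\<alpha>, 0) T Y"
    using pdmp_path_of_pdmp_from[OF valid pdmp[OF UnI1[OF plus[OF assms(2)]]]] by blast
  then have "pdmp_hitting X (P (\<alpha>, 0)) A (\<alpha>, 0) T Y x"
    using fluid assms(3) by (simp add: pdmp_hitting_def pdmp_hitting_axioms_def)
  then interpret h: pdmp_hitting X "P (\<alpha>, 0)" A "(\<alpha>, 0)" T Y x .
  let ?v = "\<alpha> v* Psi X v* mat_exp (x *\<^sub>R (Cmat (minus X) + Dmp X ** Psi X))"
  have v: "(\<integral>\<omega>. h.landing \<omega> \<partial>P (\<alpha>, 0)) = ?v"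
    using h.landing_expectation[OF refl assms(2)] h.fl.limit_eq(2)[OF assms(3)] Psi_iter_eq[OF fluid]
    by (simp add: vector_matrix_mul_assoc)
  let ?E = "{\<omega>\<in>space (P (\<alpha>, 0)). tau_minus X (\<lambda>t. A t \<omega>) x < \<infinity>}"
  have "has_bochner_integral (P (\<alpha>, 0)) h.landing ?v"
    using h.landing_integrable v by (simp add: has_bochner_integral_iff)
  moreover have "measure (P (\<alpha>, 0)) ?E = ?v \<bullet> 1"
  proof -
    have "measure (P (\<alpha>, 0)) ?E = (\<integral>\<omega>. indicator ?E \<omega> \<partial>P (\<alpha>, 0))"
      by (simp only: Bochner_Integration.integral_indicator sets.Int_space_eq2[OF h.tau_finite_sets])
    also have "\<dots> = (\<integral>\<omega>. h.landing \<omega> \<bullet> 1 \<partial>P (\<alpha>, 0))"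
      by (rule Bochner_Integration.integral_cong[OF refl h.landing_one[symmetric]])
    also have "\<dots> = ?v \<bullet> 1"
      using h.landing_integrable v by (simp add: integral_inner_left)
    finally show ?thesis .
  qed
  ultimately show ?thesis
    using h.tau_finite_sets unfolding h.landing_def[abs_def] by simp
qed

end
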